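(* Let $A$, $B$ be $C^2$ convex bodies in $\mathbb{R}^n$, and let $a$, $b$, $a+b$ be boundary points of $A$, $B$, $A+B$, respectively. Let $0\le\alpha\le 1$ and let $k$ be a nonnegative integer, $\infty$ or $\omega$. If $A$ is $C^{k,\alpha}$ near $a$ and $G_{A}(a)\neq 0$, then (i) $A+B$ is $C^2$ near $a+b$; (ii) $G_{B}(b)\neq 0$ if and only if $G_{A+B}(a+b)\neq 0$; (iii) $B$ is $C^{k,\alpha}$ near $b$ if and only if $A+B$ is $C^{k,\alpha}$ near $a+b$.
   Context: A convex body in $\mathbb{R}^n$ is a compact convex set with non-empty interior. A convex body (or a neighborhood of a boundary point of it) is $C^{k,\alpha}$ if its boundary is (near that point) a $C^{k,\alpha}$ submanifold of $\mathbb{R}^n$; here $C^\omega$ means real analytic and $C^{k,\alpha}$ refers to functions whose $k$th partial derivatives are continuous if $\alpha=0$, Lipschitz if $\alpha=1$, and $\alpha$-Hölder if $0<\alpha<1$. $A+B=\{a+b: a\in A, b\in B\}$ is the Minkowski sum. For a $C^2$ convex body $C$, $G_C$ denotes the Gaussian curvature of $\partial C$, i.e. the product of the eigenvalues of the differential of the Gauss map $\nu_C\colon\partial C\to S^{n-1}$ given by the unit outer normal. *)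

theory Defs
  imports "HOL-Analysis.Analysis"
begin

definition convex_body :: "(real^'n) set \<Rightarrow> bool" where
  "convex_body C \<longleftrightarrow> compact C \<and> convex C \<and> interior C \<noteq> {}"

definition minkowski_sum :: "(real^'n) set \<Rightarrow> (real^'n) set \<Rightarrow> (real^'n) set" where
  "minkowski_sum A B = {a + b | a b. a \<in> A \<and> b \<in> B}"

fun partials :: "nat \<Rightarrow> (real^'n \<Rightarrow> real) \<Rightarrow> (real^'n \<Rightarrow> real) set" where
  "partials 0 f = {f}"
| "partials (Suc k) f =
     {(\<lambda>x. frechet_derivative g (at x) (axis i 1)) | g i. g \<in> partials k f}"

definition Ck_on :: "nat \<Rightarrow> (real^'n) set \<Rightarrow> (real^'n \<Rightarrow> real) \<Rightarrow> bool" where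
  "Ck_on k V f \<longleftrightarrow>
     (\<forall>j<k. \<forall>g\<in>partials j f. g differentiable_on V) \<and>
     (\<forall>g\<in>partials k f. continuous_on V g)"

definition holder_on :: "real \<Rightarrow> (real^'n) set \<Rightarrow> (real^'n \<Rightarrow> real) \<Rightarrow> bool" where
  "holder_on \<alpha> V g \<longleftrightarrow> (\<exists>L. \<forall>x\<in>V. \<forall>y\<in>V. \<bar>g x - g y\<bar> \<le> L * dist x y powr \<alpha>)"

definition Ck_alpha_on :: "nat \<Rightarrow> real \<Rightarrow> (real^'n) set \<Rightarrow> (real^'n \<Rightarrow> real) \<Rightarrow> bool" where
  "Ck_alpha_on k \<alpha> V f \<longleftrightarrow>
     Ck_on k V f \<and> (\<alpha> > 0 \<longrightarrow> (\<forall>g\<in>partials k f. holder_on \<alpha> V g))"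

definition real_analytic_on :: "(real^'n) set \<Rightarrow> (real^'n \<Rightarrow> real) \<Rightarrow> bool" where
  "real_analytic_on V f \<longleftrightarrow>
     (\<forall>x0\<in>V. \<exists>r>0. ball x0 r \<subseteq> V \<and> (\<exists>c :: ('n \<Rightarrow> nat) \<Rightarrow> real.
        \<forall>x\<in>ball x0 r.
          ((\<lambda>\<beta>. c \<beta> * (\<Prod>i\<in>UNIV. (x $ i - x0 $ i) ^ (\<beta> i))) has_sum f x) UNIV))"

datatype smoothness = Fin nat | Infty | Omega

fun reg_on :: "smoothness \<Rightarrow> real \<Rightarrow> (real^'n) set \<Rightarrow> (real^'n \<Rightarrow> real) \<Rightarrow> bool" where
  "reg_on (Fin k) \<alpha> V f = Ck_alpha_on k \<alpha> V f"
| "reg_on Infty \<alpha> V f = (\<forall>k. Ck_on k V f)"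
| "reg_on Omega \<alpha> V f = real_analytic_on V f"

text \<open>S is a C^{k,alpha} hypersurface near p: within some ball around p, S coincides with
  the graph of a C^{k,alpha} function over a hyperplane u-perp (u a unit vector).
  The function is given on an open set V of R^n; only its values on the hyperplane matter.\<close>
definition hypersurface_near :: "(real^'n) set \<Rightarrow> real^'n \<Rightarrow> smoothness \<Rightarrow> real \<Rightarrow> bool" where
  "hypersurface_near S p \<kappa> \<alpha> \<longleftrightarrow>
     (\<exists>u r V f. norm u = 1 \<and> r > 0 \<and> open V \<and> reg_on \<kappa> \<alpha> V f \<and>
        S \<inter> ball p r = {x + f x *\<^sub>R u | x. x \<in> V \<and> x \<bullet> u = 0} \<inter> ball p r)"

definition body_reg_near :: "(real^'n) set \<Rightarrow> real^'n \<Rightarrow> smoothness \<Rightarrow> real \<Rightarrow> bool" where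
  "body_reg_near C p \<kappa> \<alpha> \<longleftrightarrow> hypersurface_near (frontier C) p \<kappa> \<alpha>"

definition C2_convex_body :: "(real^'n) set \<Rightarrow> bool" where
  "C2_convex_body C \<longleftrightarrow> convex_body C \<and> (\<forall>p\<in>frontier C. body_reg_near C p (Fin 2) 0)"

text \<open>Unit outer normal of a convex body at a boundary point (unique if the boundary is C^1).\<close>
definition outer_normal :: "(real^'n) set \<Rightarrow> real^'n \<Rightarrow> real^'n" where
  "outer_normal C p = (THE u. norm u = 1 \<and> (\<forall>x\<in>C. (x - p) \<bullet> u \<le> 0))"

text \<open>Gaussian curvature: determinant of the differential d nu_p of the Gauss map, viewed as
  an endomorphism of the tangent hyperplane nu(p)-perp.  The differential is the derivative of
  nu within the boundary; it is extended by the identity on the normal line, which does not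
  change the determinant.\<close>
definition gauss_curvature :: "(real^'n) set \<Rightarrow> real^'n \<Rightarrow> real" where
  "gauss_curvature C p =
     (let N = outer_normal C p;
          L = (SOME L. (outer_normal C has_derivative L) (at p within frontier C))
      in det (matrix (\<lambda>v. L (v - (v \<bullet> N) *\<^sub>R N) + (v \<bullet> N) *\<^sub>R N)))"

end

(*
  Let N be the common outer normal of A at a, of B at b and of A + B at a + b. Near these points the boundaries
  are graphs over the hyperplane orthogonal to N of functions f, g, h, and h is the supremal convolution
  h(x + y) = f(x) + g(y), where x and y are determined by grad f(x) = grad g(y). The Hessians of f and g are
  negative semidefinite and, as the curvature of A at a is nonzero, that of f is definite. Hence grad f has a
  local inverse phi, and Z(y) = y + phi(grad g(y)) is a local diffeomorphism with grad h o Z = grad g. This gives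
  the regularity of h and the statement on curvatures. Conversely y = z - phi(grad h(z)) for z = Z(y), so Z is as
  regular as f and h allow, and grad g = grad h o Z inherits the regularity. Only the inverse function theorem in
  each regularity class is needed; the analytic case follows by complexification.
*)
theory Submission
  imports Defs "HOL-Complex_Analysis.Complex_Analysis"
begin

section \<open>Partial derivatives and local Hoelder classes\<close>

text \<open>The curvature of B may vanish at b, so grad g need not be invertible. Z is a local
  diffeomorphism all the same: a kernel vector of its derivative at b would be a kernel vector of
  the sum of the two Hessians (made nondegenerate along N), and a negative definite form plus a
  negative semidefinite one has no kernel. The argument lives one derivative below the statement: Z
  and its inverse are only as smooth as the gradients, and the missing derivative of h comes back
  because grad h is itself a composite of maps of that class. Gradients must therefore be at least
  C^1, which confines the argument to k >= 2. For k = 0 and k = 1 both sides of (iii) hold outright,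
  since a C^2 function is locally C^{1,alpha} for every alpha <= 1. Hoelder constants valid on a
  whole neighborhood do not survive products, so the proof keeps local constants and shrinks the
  neighborhood once at the end. That h describes the boundary of A + B near a + b also needs that no
  far-away decomposition of a boundary point competes; this follows from strict concavity of f at a
  and compactness.\<close>

definition pd :: "'n \<Rightarrow> (real^'n \<Rightarrow> real) \<Rightarrow> real^'n \<Rightarrow> real" where
  "pd i f x = frechet_derivative f (at x) (axis i 1)"

definition grad :: "(real^'n \<Rightarrow> real) \<Rightarrow> real^'n \<Rightarrow> real^'n" where
  "grad f x = (\<chi> i. pd i f x)"

lemma grad_nth [simp]: "grad f x $ i = pd i f x"
  by (simp add: grad_def)

lemma pd_eqI: "(f has_derivative D) (at x) \<Longrightarrow> pd i f x = D (axis i 1)"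
  unfolding pd_def by (drule frechet_derivative_at) simp

lemma has_derivative_grad:
  assumes "f differentiable at x"
  shows "(f has_derivative (\<lambda>v. grad f x \<bullet> v)) (at x)"
proof -
  obtain D where D: "(f has_derivative D) (at x)"
    using assms by (auto simp: differentiable_def)
  have lin: "linear D" using D by (rule has_derivative_linear)
  have "D v = grad f x \<bullet> v" for v
  proof -
    have "D v = D (\<Sum>i\<in>UNIV. v$i *\<^sub>R axis i 1)"
      using basis_expansion[of v] by (simp add: scalar_mult_eq_scaleR)
    also have "\<dots> = (\<Sum>i\<in>UNIV. v$i * D (axis i 1))"
      using lin by (simp add: linear_sum linear_cmul)
    finally show ?thesis by (simp add: inner_vec_def pd_eqI[OF D] mult.commute)
  qed
  then have "D = (\<lambda>v. grad f x \<bullet> v)" by auto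
  with D show ?thesis by simp
qed

lemma grad_eqI:
  assumes "(f has_derivative (\<lambda>v. g \<bullet> v)) (at x)"
  shows "grad f x = g"
  by (simp add: vec_eq_iff pd_eqI[OF assms] inner_axis)

text \<open>Near x both functions have the same derivatives, if any, so the choice operator behind
  \<open>frechet_derivative\<close> picks the same map for both, even where neither is
  differentiable.\<close>

lemma pd_cong:
  assumes "open V" "\<And>x. x \<in> V \<Longrightarrow> f x = g x" "x \<in> V"
  shows "pd i f x = pd i g x"
proof -
  have "(f has_derivative D) (at x) \<longleftrightarrow> (g has_derivative D) (at x)" for D
    using has_derivative_transform_within_open[of f D x UNIV V g, OF _ assms(1,3)]
      has_derivative_transform_within_open[of g D x UNIV V f, OF _ assms(1,3)] assms(2) by metis
  then show ?thesis by (simp add: pd_def frechet_derivative_def)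
qed

lemma differentiable_on_cong_open:
  assumes "open V" "\<And>x. x \<in> V \<Longrightarrow> f x = g x" "f differentiable_on V"
  shows "g differentiable_on V"
  unfolding differentiable_on_def
proof
  fix x assume x: "x \<in> V"
  then obtain D where "(f has_derivative D) (at x within V)"
    using assms(3) by (auto simp: differentiable_on_def differentiable_def)
  then have "(g has_derivative D) (at x within V)"
    by (rule has_derivative_transform[rotated 2]) (use assms x in auto)
  then show "g differentiable at x within V" by (auto simp: differentiable_def)
qed

lemma differentiable_on_open_at: "open V \<Longrightarrow> f differentiable_on V \<longleftrightarrow> (\<forall>x\<in>V. f differentiable at x)"
  by (simp add: differentiable_on_eq_differentiable_at)

lemma pd_const [simp]: "pd i (\<lambda>x. c) x = 0"
  by (rule trans[OF pd_eqI[OF has_derivative_const]]) simp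

lemma pd_nth [simp]: "pd i (\<lambda>x. x $ j) x = axis i 1 $ j"
  by (rule pd_eqI) (rule bounded_linear.has_derivative[OF bounded_linear_vec_nth has_derivative_ident])

lemma pd_add:
  assumes "f differentiable at x" "g differentiable at x"
  shows "pd i (\<lambda>x. f x + g x) x = pd i f x + pd i g x"
  by (subst pd_eqI[OF has_derivative_add[OF assms[THEN has_derivative_grad]]]) (simp add: inner_axis)

lemma pd_mult:
  assumes "f differentiable at x" "g differentiable at x"
  shows "pd i (\<lambda>x. f x * g x) x = f x * pd i g x + pd i f x * g x"
  by (subst pd_eqI[OF has_derivative_mult[OF assms[THEN has_derivative_grad]]]) (simp add: inner_axis)

lemma pd_inverse:
  assumes "f differentiable at x" "f x \<noteq> 0"
  shows "pd i (\<lambda>x. inverse (f x)) x = - (pd i f x * (inverse (f x) * inverse (f x)))"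
  by (subst pd_eqI[OF Deriv.has_derivative_inverse[OF assms(2) has_derivative_grad[OF assms(1)]]])
     (simp add: inner_axis)

lemma has_derivative_vec_grad:
  fixes F :: "real^'m \<Rightarrow> real^'n"
  assumes "\<And>i. (\<lambda>x. F x $ i) differentiable at x"
  shows "(F has_derivative (\<lambda>v. \<chi> i. grad (\<lambda>x. F x $ i) x \<bullet> v)) (at x)"
  by (subst has_derivative_componentwise_within)
     (auto simp: Basis_vec_def inner_axis intro!: has_derivative_grad assms)

lemma pd_compose:
  fixes F :: "real^'m \<Rightarrow> real^'n"
  assumes "f differentiable at (F x)" "\<And>i. (\<lambda>x. F x $ i) differentiable at x"
  shows "pd i (\<lambda>x. f (F x)) x = (\<Sum>j\<in>UNIV. pd j f (F x) * pd i (\<lambda>x. F x $ j) x)"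
  using pd_eqI[OF diff_chain_at[OF has_derivative_vec_grad[of F x, OF assms(2)] has_derivative_grad[OF assms(1)]]]
  by (simp add: o_def inner_vec_def[of "grad f _"] inner_axis)

text \<open>\<open>partials\<close> adds the newest derivative on the outside; induction on the
  order of smoothness needs the first derivative split off instead, with f replaced by its
  partials.\<close>

lemma partials_Suc_pd: "partials (Suc k) f = (\<Union>i. partials k (pd i f))"
proof (induction k)
  case 0 show ?case by (auto simp: pd_def[abs_def])
next
  case (Suc k)
  have "partials (Suc (Suc k)) f = {pd j g | g j. g \<in> partials (Suc k) f}"
    by (subst partials.simps(2)) (auto simp: pd_def[abs_def])
  also have "\<dots> = (\<Union>i. {pd j g | g j. g \<in> partials k (pd i f)})"
    unfolding Suc by blast
  also have "\<dots> = (\<Union>i. partials (Suc k) (pd i f))"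
    by (simp add: pd_def[abs_def])
  finally show ?case .
qed

lemma Ck_on_Suc: "Ck_on (Suc k) V f \<longleftrightarrow> f differentiable_on V \<and> (\<forall>i. Ck_on k V (pd i f))"
proof -
  have "(\<forall>j<Suc k. \<forall>g\<in>partials j f. g differentiable_on V) \<longleftrightarrow>
     f differentiable_on V \<and> (\<forall>j<k. \<forall>g\<in>partials (Suc j) f. g differentiable_on V)"
    by (subst All_less_Suc2) simp
  then have "Ck_on (Suc k) V f \<longleftrightarrow>
      (f differentiable_on V \<and> (\<forall>j<k. \<forall>i. \<forall>g\<in>partials j (pd i f). g differentiable_on V)) \<and>
      (\<forall>i. \<forall>g\<in>partials k (pd i f). continuous_on V g)"
    by (simp only: Ck_on_def partials_Suc_pd ball_UN ball_UNIV)
  also have "\<dots> \<longleftrightarrow> f differentiable_on V \<and> (\<forall>i. Ck_on k V (pd i f))"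
    unfolding Ck_on_def by meson
  finally show ?thesis .
qed

section \<open>Locally Hoelder continuous functions\<close>

definition loc_holder :: "real \<Rightarrow> (real^'n) set \<Rightarrow> (real^'n \<Rightarrow> real) \<Rightarrow> bool" where
  "loc_holder \<alpha> V f \<longleftrightarrow> (\<forall>x\<in>V. \<exists>d>0. holder_on \<alpha> (ball x d \<inter> V) f)"

lemma loc_holderE:
  assumes "loc_holder \<alpha> V f" "x \<in> V"
  obtains d L where "d > 0" "L \<ge> 0"
    "\<And>y z. dist x y < d \<Longrightarrow> dist x z < d \<Longrightarrow> y \<in> V \<Longrightarrow> z \<in> V \<Longrightarrow> \<bar>f y - f z\<bar> \<le> L * dist y z powr \<alpha>"
proof -
  obtain d L where d: "d > 0" and
    *: "\<And>y z. y \<in> ball x d \<inter> V \<Longrightarrow> z \<in> ball x d \<inter> V \<Longrightarrow> \<bar>f y - f z\<bar> \<le> L * dist y z powr \<alpha>"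
    using assms unfolding loc_holder_def holder_on_def by blast
  show ?thesis
  proof (rule that[OF d, of "\<bar>L\<bar>"])
    fix y z assume "dist x y < d" "dist x z < d" "y \<in> V" "z \<in> V"
    then have "\<bar>f y - f z\<bar> \<le> L * dist y z powr \<alpha>" by (intro *) auto
    also have "\<dots> \<le> \<bar>L\<bar> * dist y z powr \<alpha>" by (intro mult_right_mono) auto
    finally show "\<bar>f y - f z\<bar> \<le> \<bar>L\<bar> * dist y z powr \<alpha>" .
  qed auto
qed

lemma loc_holderI:
  assumes "\<And>x. x \<in> V \<Longrightarrow> \<exists>d>0. \<exists>L. \<forall>y\<in>V. \<forall>z\<in>V. dist x y < d \<longrightarrow> dist x z < d \<longrightarrow>
    \<bar>f y - f z\<bar> \<le> L * dist y z powr \<alpha>"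
  shows "loc_holder \<alpha> V f"
  unfolding loc_holder_def holder_on_def
proof
  fix x assume "x \<in> V"
  with assms obtain d L where "d > 0"
    "\<forall>y\<in>V. \<forall>z\<in>V. dist x y < d \<longrightarrow> dist x z < d \<longrightarrow> \<bar>f y - f z\<bar> \<le> L * dist y z powr \<alpha>" by blast
  then show "\<exists>d>0. \<exists>L. \<forall>y\<in>ball x d \<inter> V. \<forall>z\<in>ball x d \<inter> V. \<bar>f y - f z\<bar> \<le> L * dist y z powr \<alpha>"
    by - (rule exI[of _ d], rule conjI, assumption, rule exI[of _ L], auto)
qed

lemma loc_holder_subset: "loc_holder \<alpha> V f \<Longrightarrow> U \<subseteq> V \<Longrightarrow> loc_holder \<alpha> U f"
proof (rule loc_holderI)
  fix x assume *: "loc_holder \<alpha> V f" "U \<subseteq> V" "x \<in> U"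
  then obtain d L where "d > 0" and f:
    "\<And>y z. dist x y < d \<Longrightarrow> dist x z < d \<Longrightarrow> y \<in> V \<Longrightarrow> z \<in> V \<Longrightarrow> \<bar>f y - f z\<bar> \<le> L * dist y z powr \<alpha>"
    using loc_holderE[OF *(1), of x] by (metis subsetD)
  then show "\<exists>d>0. \<exists>L. \<forall>y\<in>U. \<forall>z\<in>U. dist x y < d \<longrightarrow> dist x z < d \<longrightarrow> \<bar>f y - f z\<bar> \<le> L * dist y z powr \<alpha>"
    using * by - (rule exI[of _ d], rule conjI, assumption, rule exI[of _ L], auto)
qed

lemma loc_holder_cong: "(\<And>x. x \<in> V \<Longrightarrow> f x = g x) \<Longrightarrow> loc_holder \<alpha> V f \<Longrightarrow> loc_holder \<alpha> V g"
  unfolding loc_holder_def holder_on_def by simp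

lemma loc_holder_const: "loc_holder \<alpha> V (\<lambda>x. c)"
  by (rule loc_holderI) (rule exI[of _ 1], rule conjI, simp, rule exI[of _ 0], simp)

lemma loc_holder_add:
  assumes "loc_holder \<alpha> V f" "loc_holder \<alpha> V g"
  shows "loc_holder \<alpha> V (\<lambda>x. f x + g x)"
proof (rule loc_holderI)
  fix x assume x: "x \<in> V"
  obtain d L where d: "d > 0" "L \<ge> 0" and f:
    "\<And>y z. dist x y < d \<Longrightarrow> dist x z < d \<Longrightarrow> y \<in> V \<Longrightarrow> z \<in> V \<Longrightarrow> \<bar>f y - f z\<bar> \<le> L * dist y z powr \<alpha>"
    using loc_holderE[OF assms(1) x] by metis
  obtain d' L' where d': "d' > 0" "L' \<ge> 0" and g:
    "\<And>y z. dist x y < d' \<Longrightarrow> dist x z < d' \<Longrightarrow> y \<in> V \<Longrightarrow> z \<in> V \<Longrightarrow> \<bar>g y - g z\<bar> \<le> L' * dist y z powr \<alpha>"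
    using loc_holderE[OF assms(2) x] by metis
  show "\<exists>d>0. \<exists>L. \<forall>y\<in>V. \<forall>z\<in>V. dist x y < d \<longrightarrow> dist x z < d \<longrightarrow>
    \<bar>(f y + g y) - (f z + g z)\<bar> \<le> L * dist y z powr \<alpha>"
  proof (rule exI[of _ "min d d'"], rule conjI[rotated], rule exI[of _ "L + L'"], intro ballI impI)
    fix y z assume "y \<in> V" "z \<in> V" "dist x y < min d d'" "dist x z < min d d'"
    with f[of y z] g[of y z]
    show "\<bar>(f y + g y) - (f z + g z)\<bar> \<le> (L + L') * dist y z powr \<alpha>"
      by (auto simp: distrib_right)
  qed (use d d' in auto)
qed

lemma loc_bounded:
  fixes f :: "real^'n \<Rightarrow> real"
  assumes "continuous_on V f" "x \<in> V"
  obtains d where "d > 0" "\<And>y. dist x y < d \<Longrightarrow> y \<in> V \<Longrightarrow> \<bar>f y\<bar> \<le> \<bar>f x\<bar> + 1"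
proof -
  obtain d where "d > 0" "\<And>y. y \<in> V \<Longrightarrow> dist y x < d \<Longrightarrow> dist (f y) (f x) < 1"
    using assms unfolding continuous_on_iff by (metis zero_less_one)
  then show ?thesis by (intro that[of d]) (force simp: dist_real_def dist_commute)+
qed

text \<open>With one constant for all of V this would fail: the identity of the line is Lipschitz,
  its square is not. Locally the continuous factors are bounded, and the product rule for
  differences applies.\<close>

lemma loc_holder_mult:
  assumes "loc_holder \<alpha> V f" "loc_holder \<alpha> V g" "continuous_on V f" "continuous_on V g"
  shows "loc_holder \<alpha> V (\<lambda>x. f x * g x)"
proof (rule loc_holderI)
  fix x assume x: "x \<in> V"
  obtain d L where d: "d > 0" "L \<ge> 0" and f:
    "\<And>y z. dist x y < d \<Longrightarrow> dist x z < d \<Longrightarrow> y \<in> V \<Longrightarrow> z \<in> V \<Longrightarrow> \<bar>f y - f z\<bar> \<le> L * dist y z powr \<alpha>"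
    using loc_holderE[OF assms(1) x] by metis
  obtain d' L' where d': "d' > 0" "L' \<ge> 0" and g:
    "\<And>y z. dist x y < d' \<Longrightarrow> dist x z < d' \<Longrightarrow> y \<in> V \<Longrightarrow> z \<in> V \<Longrightarrow> \<bar>g y - g z\<bar> \<le> L' * dist y z powr \<alpha>"
    using loc_holderE[OF assms(2) x] by metis
  obtain e where e: "e > 0" "\<And>y. dist x y < e \<Longrightarrow> y \<in> V \<Longrightarrow> \<bar>f y\<bar> \<le> \<bar>f x\<bar> + 1"
    using loc_bounded[OF assms(3) x] by metis
  obtain e' where e': "e' > 0" "\<And>y. dist x y < e' \<Longrightarrow> y \<in> V \<Longrightarrow> \<bar>g y\<bar> \<le> \<bar>g x\<bar> + 1"
    using loc_bounded[OF assms(4) x] by metis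
  define C where "C = (\<bar>f x\<bar> + 1) * L' + L * (\<bar>g x\<bar> + 1)"
  show "\<exists>d>0. \<exists>L. \<forall>y\<in>V. \<forall>z\<in>V. dist x y < d \<longrightarrow> dist x z < d \<longrightarrow>
    \<bar>(f y * g y) - (f z * g z)\<bar> \<le> L * dist y z powr \<alpha>"
  proof (rule exI[of _ "Min {d, d', e, e'}"], rule conjI[rotated], rule exI[of _ C], intro ballI impI)
    fix y z assume yz: "y \<in> V" "z \<in> V" "dist x y < Min {d, d', e, e'}" "dist x z < Min {d, d', e, e'}"
    have "\<bar>f y * g y - f z * g z\<bar> = \<bar>f y * (g y - g z) + (f y - f z) * g z\<bar>"
      by (simp add: algebra_simps)
    also have "\<dots> \<le> \<bar>f y\<bar> * \<bar>g y - g z\<bar> + \<bar>f y - f z\<bar> * \<bar>g z\<bar>"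
      by (metis abs_mult abs_triangle_ineq)
    also have "\<dots> \<le> (\<bar>f x\<bar> + 1) * (L' * dist y z powr \<alpha>) + (L * dist y z powr \<alpha>) * (\<bar>g x\<bar> + 1)"
      using yz f[of y z] g[of y z] e(2)[of y] e'(2)[of z] d d'
      by (intro add_mono mult_mono) auto
    also have "\<dots> = C * dist y z powr \<alpha>" by (simp add: C_def algebra_simps)
    finally show "\<bar>(f y * g y) - (f z * g z)\<bar> \<le> C * dist y z powr \<alpha>" .
  qed (use d d' e e' in auto)
qed

lemma loc_holder_inverse:
  assumes "loc_holder \<alpha> V f" "continuous_on V f" "\<And>x. x \<in> V \<Longrightarrow> f x \<noteq> 0"
  shows "loc_holder \<alpha> V (\<lambda>x. inverse (f x))"
proof (rule loc_holderI)
  fix x assume x: "x \<in> V"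
  obtain d L where d: "d > 0" "L \<ge> 0" and f:
    "\<And>y z. dist x y < d \<Longrightarrow> dist x z < d \<Longrightarrow> y \<in> V \<Longrightarrow> z \<in> V \<Longrightarrow> \<bar>f y - f z\<bar> \<le> L * dist y z powr \<alpha>"
    using loc_holderE[OF assms(1) x] by metis
  have "continuous_on V (\<lambda>x. inverse (f x))"
    using assms by (auto intro!: continuous_intros)
  then obtain e where e: "e > 0" "\<And>y. dist x y < e \<Longrightarrow> y \<in> V \<Longrightarrow> \<bar>inverse (f y)\<bar> \<le> \<bar>inverse (f x)\<bar> + 1"
    using loc_bounded x by metis
  define B where "B = \<bar>inverse (f x)\<bar> + 1"
  show "\<exists>d>0. \<exists>L. \<forall>y\<in>V. \<forall>z\<in>V. dist x y < d \<longrightarrow> dist x z < d \<longrightarrow>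
    \<bar>inverse (f y) - inverse (f z)\<bar> \<le> L * dist y z powr \<alpha>"
  proof (rule exI[of _ "min d e"], rule conjI[rotated], rule exI[of _ "B * L * B"], intro ballI impI)
    fix y z assume yz: "y \<in> V" "z \<in> V" "dist x y < min d e" "dist x z < min d e"
    have "\<bar>inverse (f y) - inverse (f z)\<bar> = \<bar>inverse (f y)\<bar> * \<bar>f y - f z\<bar> * \<bar>inverse (f z)\<bar>"
      using assms(3)[OF yz(1)] assms(3)[OF yz(2)]
      by (subst inverse_diff_inverse) (auto simp: abs_mult)
    also have "\<dots> \<le> B * (L * dist y z powr \<alpha>) * B"
      using yz f[of y z] e(2)[of y] e(2)[of z] d
      by (intro mult_mono) (auto simp: B_def)
    finally show "\<bar>inverse (f y) - inverse (f z)\<bar> \<le> B * L * B * dist y z powr \<alpha>"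
      by (simp add: mult_ac)
  qed (use d e in auto)
qed

lemma loc_holder_lipschitz:
  assumes "loc_holder 1 V f" "0 < \<alpha>" "\<alpha> \<le> 1"
  shows "loc_holder \<alpha> V f"
proof (rule loc_holderI)
  fix x assume x: "x \<in> V"
  obtain d L where d: "d > 0" "L \<ge> 0" and f:
    "\<And>y z. dist x y < d \<Longrightarrow> dist x z < d \<Longrightarrow> y \<in> V \<Longrightarrow> z \<in> V \<Longrightarrow> \<bar>f y - f z\<bar> \<le> L * dist y z powr 1"
    using loc_holderE[OF assms(1) x] by metis
  show "\<exists>d>0. \<exists>L. \<forall>y\<in>V. \<forall>z\<in>V. dist x y < d \<longrightarrow> dist x z < d \<longrightarrow> \<bar>f y - f z\<bar> \<le> L * dist y z powr \<alpha>"
  \<comment> \<open>The radius 1/2 keeps y and z at distance at most 1, where t <=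
    t^\<alpha>.\<close>
  proof (rule exI[of _ "min d (1/2)"], rule conjI[rotated], rule exI[of _ L], intro ballI impI)
    fix y z assume yz: "y \<in> V" "z \<in> V" "dist x y < min d (1/2)" "dist x z < min d (1/2)"
    then have "dist y z \<le> 1" using dist_triangle3[of y z x] by auto
    then have "dist y z powr 1 \<le> dist y z powr \<alpha>" using assms by (intro powr_mono') auto
    then have "L * dist y z powr 1 \<le> L * dist y z powr \<alpha>" using d by (intro mult_left_mono)
    then show "\<bar>f y - f z\<bar> \<le> L * dist y z powr \<alpha>" using f[of y z] yz by auto
  qed (use d in auto)
qed

text \<open>The mean value inequality on a ball where the continuous gradient is bounded by its norm
  at the centre plus 1.\<close>

lemma C1_loc_lipschitz:
  assumes V: "open V" and f: "f differentiable_on V" and c: "\<And>i. continuous_on V (pd i f)"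
  shows "loc_holder 1 V f"
proof (rule loc_holderI)
  fix x assume x: "x \<in> V"
  have "continuous_on V (\<lambda>y. norm (grad f y))"
    unfolding grad_def by (intro continuous_intros c)
  then obtain e where e: "e > 0" "\<And>y. dist x y < e \<Longrightarrow> y \<in> V \<Longrightarrow> norm (grad f y) \<le> norm (grad f x) + 1"
    using loc_bounded[OF _ x, of "\<lambda>y. norm (grad f y)"] by (metis abs_norm_cancel)
  obtain e' where e': "e' > 0" "ball x e' \<subseteq> V" using V x open_contains_ball by blast
  show "\<exists>d>0. \<exists>L. \<forall>y\<in>V. \<forall>z\<in>V. dist x y < d \<longrightarrow> dist x z < d \<longrightarrow> \<bar>f y - f z\<bar> \<le> L * dist y z powr 1"
  proof (rule exI[of _ "min e e'"], rule conjI[rotated], rule exI[of _ "norm (grad f x) + 1"], intro ballI impI)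
    fix y z assume yz: "y \<in> V" "z \<in> V" "dist x y < min e e'" "dist x z < min e e'"
    have "norm (f y - f z) \<le> (norm (grad f x) + 1) * norm (y - z)"
    proof (rule differentiable_bound[of "ball x (min e e')" f "\<lambda>y v. grad f y \<bullet> v"])
      fix w assume w: "w \<in> ball x (min e e')"
      then have wV: "w \<in> V" using e' by auto
      then show "(f has_derivative (\<lambda>v. grad f w \<bullet> v)) (at w within ball x (min e e'))"
        using f V by - (rule has_derivative_at_withinI, rule has_derivative_grad, simp add: differentiable_on_open_at)
      show "onorm (\<lambda>v. grad f w \<bullet> v) \<le> norm (grad f x) + 1"
      proof (rule onorm_le)
        fix v
        have "norm (grad f w \<bullet> v) \<le> norm (grad f w) * norm v" by (simp add: Cauchy_Schwarz_ineq2)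
        also have "\<dots> \<le> (norm (grad f x) + 1) * norm v"
          using e(2)[OF _ wV] w by (intro mult_right_mono) auto
        finally show "norm (grad f w \<bullet> v) \<le> (norm (grad f x) + 1) * norm v" .
      qed
    qed (use yz in auto)
    then show "\<bar>f y - f z\<bar> \<le> (norm (grad f x) + 1) * dist y z powr 1"
      by (simp add: dist_norm)
  qed (use e e' in auto)
qed

section \<open>The classes C^{k,alpha} with local Hoelder bounds\<close>

fun creg :: "nat \<Rightarrow> real \<Rightarrow> (real^'n) set \<Rightarrow> (real^'n \<Rightarrow> real) \<Rightarrow> bool" where
  "creg 0 \<alpha> V f \<longleftrightarrow> continuous_on V f \<and> (\<alpha> > 0 \<longrightarrow> loc_holder \<alpha> V f)"
| "creg (Suc k) \<alpha> V f \<longleftrightarrow> f differentiable_on V \<and> (\<forall>i. creg k \<alpha> V (pd i f))"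

lemma creg_cong:
  assumes "open V" "\<And>x. x \<in> V \<Longrightarrow> f x = g x" "creg k \<alpha> V f"
  shows "creg k \<alpha> V g"
  using assms(2,3)
proof (induction k arbitrary: f g)
  case 0
  then show ?case using loc_holder_cong[of V f g] by (auto cong: continuous_on_cong)
next
  case (Suc k)
  have "f differentiable_on V" "creg k \<alpha> V (pd i f)" for i
    using Suc.prems(2) by auto
  moreover have "creg k \<alpha> V (pd i g)" for i
    using Suc.IH[of "pd i f" "pd i g"] pd_cong[of V f g, OF assms(1) Suc.prems(1)] calculation(2) by blast
  moreover have "g differentiable_on V"
    using differentiable_on_cong_open[of V f g, OF assms(1) Suc.prems(1)] calculation(1) by blast
  ultimately show ?case by simp
qed

lemma creg_subset: "creg k \<alpha> V f \<Longrightarrow> U \<subseteq> V \<Longrightarrow> creg k \<alpha> U f"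
  by (induction k arbitrary: f) (auto intro: continuous_on_subset loc_holder_subset differentiable_on_subset)

lemma creg_continuous: "creg k \<alpha> V f \<Longrightarrow> continuous_on V f"
  by (cases k) (auto simp: differentiable_imp_continuous_on)

text \<open>A derivative in hand makes f locally Lipschitz, hence \<alpha>-Hoelder, whatever the
  exponent \<beta> was. The product and chain rules multiply derivatives of class k by
  undifferentiated factors of class k + 1; this brings both to the same level.\<close>

lemma creg_Suc_imp:
  assumes "open V" "\<alpha> \<le> 1" "creg (Suc k) \<beta> V f"
  shows "creg k \<alpha> V f"
  using assms(3)
proof (induction k arbitrary: f)
  case 0
  then show ?case using C1_loc_lipschitz[OF assms(1), of f] loc_holder_lipschitz[of V f] assms(2)
    by (auto simp: differentiable_imp_continuous_on)
next
  case (Suc k)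
  have "f differentiable_on V" "creg (Suc k) \<beta> V (pd i f)" for i
    using Suc.prems by (auto simp only: creg.simps(2)[of "Suc k"])
  then show ?case
    using Suc.IH by (subst creg.simps(2)) blast
qed

lemma creg_const: "creg k \<alpha> V (\<lambda>x. c)"
  by (induction k arbitrary: c) (auto simp: loc_holder_const pd_const[abs_def] differentiable_on_def)

lemma creg_nth: "\<alpha> \<le> 1 \<Longrightarrow> creg k \<alpha> V (\<lambda>x. x $ i)"
proof -
  have *: "creg (Suc k) \<beta> UNIV (\<lambda>x. x $ i)" for k \<beta>
    by (auto simp: pd_nth[abs_def] creg_const differentiable_on_def
        intro!: bounded_linear_imp_differentiable bounded_linear_vec_nth)
  assume "\<alpha> \<le> 1"
  then have "creg k \<alpha> UNIV (\<lambda>x. x $ i)" using creg_Suc_imp[OF open_UNIV _ *] by blast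
  then show ?thesis using creg_subset by blast
qed

lemma creg_add:
  assumes "open V" "creg k \<alpha> V f" "creg k \<alpha> V g"
  shows "creg k \<alpha> V (\<lambda>x. f x + g x)"
  using assms(2,3)
proof (induction k arbitrary: f g)
  case 0
  then show ?case by (auto intro: continuous_on_add loc_holder_add)
next
  case (Suc k)
  show ?case
  proof (simp, intro conjI allI)
    show "(\<lambda>x. f x + g x) differentiable_on V" using Suc.prems by (auto intro: differentiable_on_add)
    fix i
    have "creg k \<alpha> V (\<lambda>x. pd i f x + pd i g x)" using Suc by auto
    then show "creg k \<alpha> V (pd i (\<lambda>x. f x + g x))"
      by (rule creg_cong[OF assms(1), rotated])
         (use Suc.prems assms(1) in \<open>auto simp: pd_add differentiable_on_open_at\<close>)
  qed
qed

lemma creg_mult: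
  assumes "open V" "\<alpha> \<le> 1" "creg k \<alpha> V f" "creg k \<alpha> V g"
  shows "creg k \<alpha> V (\<lambda>x. f x * g x)"
  using assms(3,4)
proof (induction k arbitrary: f g)
  case 0
  then show ?case by (auto intro: continuous_on_mult loc_holder_mult)
next
  case (Suc k)
  note down = creg_Suc_imp[OF assms(1,2)]
  show ?case
  proof (simp, intro conjI allI)
    show "(\<lambda>x. f x * g x) differentiable_on V" using Suc.prems by (auto intro: differentiable_on_mult)
    fix i
    have "creg k \<alpha> V (\<lambda>x. f x * pd i g x + pd i f x * g x)"
      using Suc.prems down[OF Suc.prems(1)] down[OF Suc.prems(2)] by (intro creg_add assms Suc.IH) auto
    then show "creg k \<alpha> V (pd i (\<lambda>x. f x * g x))"
      by (rule creg_cong[OF assms(1), rotated])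
         (use Suc.prems assms(1) in \<open>auto simp: pd_mult differentiable_on_open_at\<close>)
  qed
qed

lemma creg_inverse:
  assumes "open V" "\<alpha> \<le> 1" "creg k \<alpha> V f" "\<And>x. x \<in> V \<Longrightarrow> f x \<noteq> 0"
  shows "creg k \<alpha> V (\<lambda>x. inverse (f x))"
  using assms(3,4)
proof (induction k arbitrary: f)
  case 0
  then show ?case by (auto intro: continuous_on_inverse loc_holder_inverse)
next
  case (Suc k)
  note down = creg_Suc_imp[OF assms(1,2)]
  show ?case
  proof (simp, intro conjI allI)
    show "(\<lambda>x. inverse (f x)) differentiable_on V"
      using Suc.prems by (auto intro: differentiable_on_inverse)
    fix i
    have "creg k \<alpha> V (\<lambda>x. (-1) * (pd i f x * (inverse (f x) * inverse (f x))))"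
      using Suc.prems down[OF Suc.prems(1)]  by (intro creg_mult creg_const assms Suc.IH) auto
    then show "creg k \<alpha> V (pd i (\<lambda>x. inverse (f x)))"
      by (rule creg_cong[OF assms(1), rotated])
         (use Suc.prems assms(1) in \<open>auto simp: pd_inverse differentiable_on_open_at\<close>)
  qed
qed

lemma creg_sum:
  assumes "open V" "\<And>i. i \<in> I \<Longrightarrow> creg k \<alpha> V (f i)"
  shows "creg k \<alpha> V (\<lambda>x. \<Sum>i\<in>I. f i x)"
  using assms(2)
proof (induction I rule: infinite_finite_induct)
  case (insert i I)
  then show ?case by (simp add: creg_add[OF assms(1)])
qed (auto simp: creg_const)

lemma creg_prod:
  assumes "open V" "\<alpha> \<le> 1" "\<And>i. i \<in> I \<Longrightarrow> creg k \<alpha> V (f i)"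
  shows "creg k \<alpha> V (\<lambda>x. \<Prod>i\<in>I. f i x)"
  using assms(3)
proof (induction I rule: infinite_finite_induct)
  case (insert i I)
  then show ?case by (simp add: creg_mult[OF assms(1,2)])
qed (auto simp: creg_const)

lemma creg_det:
  fixes A :: "real^'n \<Rightarrow> real^'m^'m"
  assumes "open V" "\<alpha> \<le> 1" "\<And>i j. creg k \<alpha> V (\<lambda>x. A x $ i $ j)"
  shows "creg k \<alpha> V (\<lambda>x. det (A x))"
  unfolding det_def by (intro creg_sum creg_mult creg_prod creg_const assms)

text \<open>The inner map has to be Lipschitz: two \<alpha>-Hoelder maps compose only to the
  exponent \<alpha> squared. Componentwise Lipschitz constants are added through the l1 norm, and
  their sum enters to the power \<alpha>.\<close>

lemma loc_holder_compose:
  fixes F :: "real^'m \<Rightarrow> real^'n"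
  assumes f: "loc_holder \<alpha> V f" and F: "\<And>i. loc_holder 1 U (\<lambda>x. F x $ i)"
    and c: "continuous_on U F" and im: "F ` U \<subseteq> V" and \<alpha>: "\<alpha> > 0"
  shows "loc_holder \<alpha> U (\<lambda>x. f (F x))"
proof (rule loc_holderI)
  fix x assume x: "x \<in> U"
  then have "F x \<in> V" using im by auto
  then obtain d L where d: "d > 0" "L \<ge> 0" and f:
    "\<And>y z. dist (F x) y < d \<Longrightarrow> dist (F x) z < d \<Longrightarrow> y \<in> V \<Longrightarrow> z \<in> V \<Longrightarrow> \<bar>f y - f z\<bar> \<le> L * dist y z powr \<alpha>"
    using loc_holderE[OF f] by metis
  have "\<forall>i. \<exists>d C. d > 0 \<and> C \<ge> 0 \<and> (\<forall>y z. dist x y < d \<longrightarrow> dist x z < d \<longrightarrow> y \<in> U \<longrightarrow> z \<in> U \<longrightarrow> \<bar>F y $ i - F z $ i\<bar> \<le> C * dist y z powr 1)"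
    using loc_holderE[OF F x] by metis
  then obtain e C where e: "\<And>i. e i > 0" "\<And>i. C i \<ge> 0"
    "\<And>i y z. dist x y < e i \<Longrightarrow> dist x z < e i \<Longrightarrow> y \<in> U \<Longrightarrow> z \<in> U \<Longrightarrow> \<bar>F y $ i - F z $ i\<bar> \<le> C i * dist y z powr 1"
    by metis
  obtain e' where e': "e' > 0" "\<And>y. y \<in> U \<Longrightarrow> dist y x < e' \<Longrightarrow> dist (F y) (F x) < d"
    using c x d(1) unfolding continuous_on_iff by metis
  define K where "K = (\<Sum>i\<in>UNIV. C i)"
  have K: "K \<ge> 0" unfolding K_def using e by (simp add: sum_nonneg)
  let ?m = "Min (insert e' (range e))"
  show "\<exists>d>0. \<exists>L. \<forall>y\<in>U. \<forall>z\<in>U. dist x y < d \<longrightarrow> dist x z < d \<longrightarrow> \<bar>f (F y) - f (F z)\<bar> \<le> L * dist y z powr \<alpha>"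
  proof (rule exI[of _ ?m], rule conjI[rotated], rule exI[of _ "L * K powr \<alpha>"], intro ballI impI)
    show "?m > 0" using e e' by (subst Min_gr_iff) auto
    fix y z assume yz: "y \<in> U" "z \<in> U" "dist x y < ?m" "dist x z < ?m"
    have "dist (F y) (F z) \<le> (\<Sum>i\<in>UNIV. \<bar>(F y - F z) $ i\<bar>)"
      unfolding dist_norm by (rule norm_le_l1_cart)
    also have "\<dots> \<le> (\<Sum>i\<in>UNIV. C i * dist y z)"
      using e(3)[of y _ z] yz by (intro sum_mono) auto
    also have "\<dots> = K * dist y z" by (simp add: K_def sum_distrib_right)
    finally have "dist (F y) (F z) powr \<alpha> \<le> (K * dist y z) powr \<alpha>" using \<alpha> by (intro powr_mono2) auto
    also have "\<dots> = K powr \<alpha> * dist y z powr \<alpha>" using K by (simp add: powr_mult)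
    finally have 1: "L * dist (F y) (F z) powr \<alpha> \<le> L * (K powr \<alpha> * dist y z powr \<alpha>)"
      using d by (intro mult_left_mono)
    have "\<bar>f (F y) - f (F z)\<bar> \<le> L * dist (F y) (F z) powr \<alpha>"
      using yz e'(2)[of y] e'(2)[of z] im by (intro f) (auto simp: dist_commute)
    with 1 show "\<bar>f (F y) - f (F z)\<bar> \<le> L * K powr \<alpha> * dist y z powr \<alpha>" by (simp add: mult_ac)
  qed
qed

text \<open>The induction lowers k down to 0, where \<open>creg\<close> in general no longer gives
  Lipschitz bounds on F; therefore the Lipschitz property is a premise of its own that stays
  fixed.\<close>

lemma creg_compose:
  fixes F :: "real^'m \<Rightarrow> real^'n"
  assumes V: "open V" and U: "open U" and a: "\<alpha> \<le> 1"
    and f: "creg k \<alpha> V f" and F: "\<And>i. creg k \<alpha> U (\<lambda>x. F x $ i)" "\<And>i. loc_holder 1 U (\<lambda>x. F x $ i)"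
    and im: "F ` U \<subseteq> V"
  shows "creg k \<alpha> U (\<lambda>x. f (F x))"
  using f F(1)
proof (induction k arbitrary: f)
  case 0
  have "continuous_on U (\<lambda>x. \<chi> i. F x $ i)"
    using 0 by (intro continuous_on_vec_lambda) auto
  then have c: "continuous_on U F" by simp
  then have "continuous_on U (\<lambda>x. f (F x))" using 0 im
    by (auto intro: continuous_on_compose2)
  then show ?case using loc_holder_compose[OF _ F(2) c im] 0 by auto
next
  case (Suc k)
  have dF: "\<And>i x. x \<in> U \<Longrightarrow> (\<lambda>x. F x $ i) differentiable at x" using Suc.prems(2) U
    by (auto simp: differentiable_on_open_at)
  have df: "\<And>x. x \<in> U \<Longrightarrow> f differentiable at (F x)" using Suc.prems(1) V im
    by (auto simp: differentiable_on_open_at)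
  show ?case
  proof (simp, intro conjI allI)
    have "(\<lambda>x. f (F x)) differentiable at x" if "x \<in> U" for x
      using diff_chain_at[OF has_derivative_vec_grad[OF dF] has_derivative_grad[OF df]] that
      unfolding o_def differentiable_def by metis
    then show "(\<lambda>x. f (F x)) differentiable_on U"
      using U by (simp add: differentiable_on_open_at)
    fix i
    have Fk: "creg k \<alpha> U (\<lambda>x. F x $ j)" for j using creg_Suc_imp[OF U a Suc.prems(2)] .
    have "creg k \<alpha> V (pd j f)" for j using Suc.prems(1) by simp
    then have "creg k \<alpha> U (\<lambda>x. pd j f (F x))" for j using Suc.IH[of "pd j f"] Fk by blast
    moreover have "creg k \<alpha> U (pd i (\<lambda>x. F x $ j))" for j using Suc.prems(2) by simp
    ultimately have "creg k \<alpha> U (\<lambda>x. \<Sum>j\<in>UNIV. pd j f (F x) * pd i (\<lambda>x. F x $ j) x)"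
      by (rule creg_sum[OF U creg_mult[OF U a]])
    then show "creg k \<alpha> U (pd i (\<lambda>x. f (F x)))"
      by (rule creg_cong[OF U, rotated]) (auto simp: pd_compose[OF df dF])
  qed
qed

section \<open>Power series in several complex variables\<close>

definition mpow :: "'a::comm_monoid_mult^'n \<Rightarrow> ('n \<Rightarrow> nat) \<Rightarrow> 'a" where
  "mpow z \<beta> = (\<Prod>i\<in>UNIV. z $ i ^ \<beta> i)"

definition cset :: "'a^'n \<Rightarrow> 'n \<Rightarrow> 'a \<Rightarrow> 'a^'n" where
  "cset z j w = (\<chi> i. if i = j then w else z $ i)"

lemma cset_nth [simp]: "cset z j w $ i = (if i = j then w else z $ i)"
  by (simp add: cset_def)

definition polydisc :: "real \<Rightarrow> ('a::real_normed_vector^'n) set" where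
  "polydisc R = {z. \<forall>i. norm (z $ i) < R}"

lemma polydisc_cset: "z \<in> polydisc R \<Longrightarrow> norm w < R \<Longrightarrow> cset z j w \<in> polydisc R"
  by (auto simp: polydisc_def)

lemma mpow_upd: "mpow z (\<beta>(j := k)) = z $ j ^ k * (\<Prod>i\<in>UNIV - {j}. z $ i ^ \<beta> i)"
proof -
  have "mpow z (\<beta>(j := k)) = z $ j ^ (\<beta>(j := k)) j * (\<Prod>i\<in>UNIV - {j}. z $ i ^ (\<beta>(j := k)) i)"
    unfolding mpow_def by (rule prod.remove) auto
  also have "(\<Prod>i\<in>UNIV - {j}. z $ i ^ (\<beta>(j := k)) i) = (\<Prod>i\<in>UNIV - {j}. z $ i ^ \<beta> i)"
    by (rule prod.cong) auto
  finally show ?thesis by (simp only: fun_upd_same)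
qed

lemma sum_upd: "(\<Sum>i\<in>UNIV. (\<beta>(j := k)) i) = k + (\<Sum>i\<in>UNIV - {j::'n::finite}. (\<beta> i :: nat))"
proof -
  have "(\<Sum>i\<in>UNIV. (\<beta>(j := k)) i) = (\<beta>(j := k)) j + (\<Sum>i\<in>UNIV - {j}. (\<beta>(j := k)) i)"
    by (rule sum.remove) auto
  also have "(\<Sum>i\<in>UNIV - {j}. (\<beta>(j := k)) i) = (\<Sum>i\<in>UNIV - {j}. \<beta> i)"
    by (rule sum.cong) auto
  finally show ?thesis by (simp only: fun_upd_same)
qed

text \<open>A multi-index is a point of a product of copies of the naturals, so the sum factors into
  one geometric series per coordinate. It serves as the majorant of the multivariate
  expansions.\<close>

lemma geometric_multi_summable:
  fixes q :: "'n::finite \<Rightarrow> real"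
  assumes "\<And>i. 0 \<le> q i" "\<And>i. q i < 1"
  shows "(\<lambda>\<beta>. \<Prod>i\<in>UNIV. q i ^ \<beta> i) summable_on UNIV"
proof -
  have "Infinite_Set_Sum.abs_summable_on (\<lambda>\<beta>. \<Prod>i\<in>UNIV. q i ^ \<beta> i) (PiE UNIV (\<lambda>_. UNIV))"
  proof (rule abs_summable_on_prod_PiE)
    fix i show "Infinite_Set_Sum.abs_summable_on (\<lambda>n. q i ^ n) UNIV"
      using assms by (subst abs_summable_on_nat_iff') (simp add: summable_geometric)
  qed auto
  then have "(\<lambda>\<beta>. norm (\<Prod>i\<in>UNIV. q i ^ \<beta> i)) summable_on UNIV"
    by (simp add: abs_summable_equivalent[symmetric])
  then show ?thesis by (rule abs_summable_summable)
qed

text \<open>The k-th Taylor coefficient at 0 in the j-th variable, as a function of the other ones: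
  \<open>cset\<close> overwrites the coordinate z $ j, so the value does not depend on it.\<close>

definition taylor_coeff :: "(complex^'n \<Rightarrow> complex) \<Rightarrow> 'n \<Rightarrow> nat \<Rightarrow> complex^'n \<Rightarrow> complex" where
  "taylor_coeff F j k z = (deriv ^^ k) (\<lambda>w. F (cset z j w)) 0 / fact k"

context
  fixes F :: "complex^'n \<Rightarrow> complex" and j :: 'n and R r M :: real
  assumes rR: "0 < r" "r < R"
    and bd: "\<And>z. z \<in> polydisc R \<Longrightarrow> norm (F z) \<le> M"
    and hol: "\<And>z. z \<in> polydisc R \<Longrightarrow> (\<lambda>w. F (cset z j w)) holomorphic_on ball 0 R"
begin

lemma taylor_coeff_sums:
  assumes "z \<in> polydisc R" "norm w < R"
  shows "(\<lambda>k. taylor_coeff F j k z * w ^ k) sums F (cset z j w)"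
  using holomorphic_power_series[OF hol[OF assms(1)], of w] assms(2) by (simp add: taylor_coeff_def)

lemma taylor_coeff_bound:
  assumes "z \<in> polydisc R"
  shows "norm (taylor_coeff F j k z) \<le> M / r ^ k"
proof -
  have "norm ((deriv ^^ k) (\<lambda>w. F (cset z j w)) 0) \<le> fact k * M / r ^ k"
  proof (rule Cauchy_inequality)
    show "(\<lambda>w. F (cset z j w)) holomorphic_on ball 0 r"
      by (rule holomorphic_on_subset[OF hol[OF assms]]) (use rR in auto)
    have "(\<lambda>w. F (cset z j w)) holomorphic_on cball 0 r"
      by (rule holomorphic_on_subset[OF hol[OF assms]]) (use rR in auto)
    then show "continuous_on (cball 0 r) (\<lambda>w. F (cset z j w))"
      by (rule holomorphic_on_imp_continuous_on)
    fix w :: complex assume "norm (0 - w) = r"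
    then show "norm (F (cset z j w)) \<le> M" using rR assms by (intro bd polydisc_cset) auto
  qed (use rR in auto)
  then show ?thesis by (simp add: taylor_coeff_def norm_divide field_simps)
qed

text \<open>Dividing the tail of the series at w = r q by w^k leaves the k-th coefficient plus terms
  bounded by M / r^k * q^l for l >= 1, by the Cauchy bounds. The geometric sum of these is the same
  for all z and tends to 0 with q, which makes the limit uniform.\<close>

lemma taylor_coeff_approx:
  assumes "z \<in> polydisc R" and q: "0 < q" "q < 1"
  shows "norm ((F (cset z j (of_real (r * q))) - (\<Sum>l<k. taylor_coeff F j l z * of_real (r * q) ^ l)) / of_real (r * q) ^ k
      - taylor_coeff F j k z) \<le> M / r ^ k * (q / (1 - q))"
proof -
  let ?a = "\<lambda>l. taylor_coeff F j l z" and ?t = "complex_of_real (r * q)"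
  have t0: "?t \<noteq> 0" using q rR by simp
  have nt: "norm ?t = r * q" using q rR by (simp add: norm_mult)
  have "r * q < r * 1" using q rR by (intro mult_strict_left_mono) auto
  then have "norm ?t < R" using rR nt by linarith
  then have "(\<lambda>l. ?a l * ?t ^ l) sums F (cset z j ?t)" using taylor_coeff_sums assms by blast
  then have "(\<lambda>l. ?a (l + k) * ?t ^ (l + k)) sums (F (cset z j ?t) - (\<Sum>l<k. ?a l * ?t ^ l))"
    using sums_split_initial_segment by blast
  then have "(\<lambda>l. ?a (l + k) * ?t ^ (l + k) / ?t ^ k) sums ((F (cset z j ?t) - (\<Sum>l<k. ?a l * ?t ^ l)) / ?t ^ k)"
    by (rule sums_divide)
  also have "(\<lambda>l. ?a (l + k) * ?t ^ (l + k) / ?t ^ k) = (\<lambda>l. ?a (l + k) * ?t ^ l)"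
    using t0 by (simp add: power_add)
  finally have "(\<lambda>l. ?a (l + k) * ?t ^ l) sums ((F (cset z j ?t) - (\<Sum>l<k. ?a l * ?t ^ l)) / ?t ^ k)" .
  then have s: "(\<lambda>l. ?a (Suc l + k) * ?t ^ Suc l) sums ((F (cset z j ?t) - (\<Sum>l<k. ?a l * ?t ^ l)) / ?t ^ k - ?a k)"
    by (subst sums_Suc_iff[of "\<lambda>l. ?a (l + k) * ?t ^ l"]) simp
  have g: "(\<lambda>l. M / r ^ k * q * q ^ l) sums (M / r ^ k * q * (1 / (1 - q)))"
    using q by (intro sums_mult geometric_sums) auto
  have "norm ((F (cset z j ?t) - (\<Sum>l<k. ?a l * ?t ^ l)) / ?t ^ k - ?a k) \<le> M / r ^ k * q * (1 / (1 - q))"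
  proof (rule norm_sums_le[OF s g])
    fix l
    have "norm (?a (Suc l + k) * ?t ^ Suc l) \<le> M / r ^ (Suc l + k) * (r * q) ^ Suc l"
      unfolding norm_mult norm_power nt using taylor_coeff_bound[OF assms(1), of "Suc l + k"] q rR
      by (intro mult_right_mono) auto
    also have "\<dots> = M / r ^ k * q * q ^ l" using rR by (simp add: power_add power_mult_distrib)
    finally show "norm (?a (Suc l + k) * ?t ^ Suc l) \<le> M / r ^ k * q * q ^ l" .
  qed
  then show ?thesis by simp
qed

text \<open>Each coefficient is the locally uniform limit of difference quotients of \<open>F\<close> built from the previous
  coefficients, so no differentiation under an integral sign is needed.\<close>
lemma taylor_coeff_holomorphic:
  assumes "i \<noteq> j" and holi: "\<And>z. z \<in> polydisc R \<Longrightarrow> (\<lambda>w. F (cset z i w)) holomorphic_on ball 0 R"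
    and z: "z \<in> polydisc R"
  shows "(\<lambda>w. taylor_coeff F j k (cset z i w)) holomorphic_on ball 0 R"
proof (induction k rule: less_induct)
  case (less k)
  \<comment> \<open>The offset 2 keeps q n strictly between 0 and 1 also for n = 0, and makes q n /
    (1 - q n) equal to 1 / (n + 1).\<close>
  define q where "q n = 1 / (real n + 2)" for n
  have q: "0 < q n" "q n < 1" for n by (auto simp: q_def)
  define f where "f n w = (F (cset (cset z i w) j (of_real (r * q n))) -
      (\<Sum>l<k. taylor_coeff F j l (cset z i w) * of_real (r * q n) ^ l)) / of_real (r * q n) ^ k" for n w
  have "q n / (1 - q n) = 1 / real (Suc n)" for n
    by (simp add: q_def divide_simps)
  then have qlim: "(\<lambda>n. M / r ^ k * (q n / (1 - q n))) \<longlonglongrightarrow> M / r ^ k * 0"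
    using LIMSEQ_inverse_real_of_nat by (intro tendsto_mult tendsto_const) (simp add: inverse_eq_divide)
  have "uniform_limit (ball 0 R) f (\<lambda>w. taylor_coeff F j k (cset z i w)) sequentially"
  proof (rule uniform_limitI)
    fix e :: real assume "e > 0"
    with qlim have "\<forall>\<^sub>F n in sequentially. M / r ^ k * (q n / (1 - q n)) < e"
      by (intro order_tendstoD(2)[of _ "M / r ^ k * 0"]) auto
    then show "\<forall>\<^sub>F n in sequentially. \<forall>w\<in>ball 0 R. dist (f n w) (taylor_coeff F j k (cset z i w)) < e"
    proof eventually_elim
      case (elim n)
      show ?case
      proof
        fix w :: complex assume "w \<in> ball 0 R"
        then have "cset z i w \<in> polydisc R" using z by (intro polydisc_cset) auto
        from taylor_coeff_approx[OF this q, of n k] elim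
        show "dist (f n w) (taylor_coeff F j k (cset z i w)) < e"
          by (simp add: f_def dist_norm)
      qed
    qed
  qed
  then have ul: "uniform_limit (cball x d) f (\<lambda>w. taylor_coeff F j k (cset z i w)) sequentially"
    if "cball x d \<subseteq> ball 0 R" for x d using that uniform_limit_on_subset by blast
  show ?case
  proof (rule holomorphic_uniform_sequence[of _ f])
    fix n
    have "r * q n < r * 1" using q[of n] rR by (intro mult_strict_left_mono) auto
    then have "r * q n < R" using rR by linarith
    then have "norm (complex_of_real (r * q n)) < R"
      using rR q[of n] unfolding norm_of_real by (simp add: abs_mult)
    then have "cset z j (of_real (r * q n)) \<in> polydisc R" using z by (intro polydisc_cset)
    then have "(\<lambda>w. F (cset (cset z j (of_real (r * q n))) i w)) holomorphic_on ball 0 R" by (rule holi)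
    moreover have "cset (cset z j u) i w = cset (cset z i w) j u" for u w
      using \<open>i \<noteq> j\<close> by (auto simp: vec_eq_iff)
    ultimately have "(\<lambda>w. F (cset (cset z i w) j (of_real (r * q n)))) holomorphic_on ball 0 R" by simp
    then show "f n holomorphic_on ball 0 R"
      unfolding f_def[abs_def] using q[of n] rR by (intro holomorphic_intros less) auto
  next
    fix x :: complex assume "x \<in> ball 0 R"
    then obtain d where "d > 0" "cball x d \<subseteq> ball 0 R" using open_contains_cball open_ball by blast
    with ul show "\<exists>d>0. cball x d \<subseteq> ball 0 R \<and> uniform_limit (cball x d) f (\<lambda>w. taylor_coeff F j k (cset z i w)) sequentially"
      by blast
  qed auto
qed

end

text \<open>Induction over the set I of variables in play. The Taylor coefficients in one more
  variable are holomorphic in each of the remaining ones and bounded by M / r^k, so the induction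
  hypothesis expands each of them with that bound. The uniform bound M stands in for the joint
  continuity that an iterated Cauchy integral would ask for.\<close>

proposition separately_holomorphic_expansion:
  fixes F :: "complex^'n \<Rightarrow> complex"
  assumes "finite I" and rR: "0 < r" "r < R"
    and "\<And>z. z \<in> polydisc R \<Longrightarrow> norm (F z) \<le> M"
    and "\<And>i z. i \<in> I \<Longrightarrow> z \<in> polydisc R \<Longrightarrow> (\<lambda>w. F (cset z i w)) holomorphic_on ball 0 R"
  shows "\<exists>c. (\<forall>\<beta>. norm (c \<beta>) \<le> M / r ^ (\<Sum>i\<in>UNIV. \<beta> i)) \<and>
    (\<forall>z\<in>polydisc r. (\<forall>i. i \<notin> I \<longrightarrow> z $ i = 0) \<longrightarrow>
       ((\<lambda>\<beta>. c \<beta> * mpow z \<beta>) has_sum F z) {\<beta>. \<forall>i. i \<notin> I \<longrightarrow> \<beta> i = 0})"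
  using assms(1,4,5)
proof (induction I arbitrary: F M rule: finite_induct)
  case empty
  have "norm (F 0) \<le> M" using empty rR by (auto simp: polydisc_def)
  then have M: "M \<ge> 0" using norm_ge_zero order_trans by blast
  show ?case
  proof (intro exI[of _ "\<lambda>\<beta>. if \<beta> = (\<lambda>_. 0) then F 0 else 0"] conjI allI ballI impI)
    fix \<beta> :: "'n \<Rightarrow> nat"
    show "norm (if \<beta> = (\<lambda>_. 0) then F 0 else 0) \<le> M / r ^ (\<Sum>i\<in>UNIV. \<beta> i)"
      using M rR \<open>norm (F 0) \<le> M\<close> by auto
  next
    fix z :: "complex^'n" assume "\<forall>i. i \<notin> {} \<longrightarrow> z $ i = 0"
    then have "z = 0" by (simp add: vec_eq_iff)
    moreover have "{\<beta>. \<forall>i. i \<notin> {} \<longrightarrow> \<beta> i = 0} = {\<lambda>_::'n. 0::nat}" by auto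
    ultimately show "((\<lambda>\<beta>. (if \<beta> = (\<lambda>_. 0) then F 0 else 0) * mpow z \<beta>) has_sum F z) {\<beta>. \<forall>i. i \<notin> {} \<longrightarrow> \<beta> i = 0}"
      by (auto intro!: has_sum_finiteI simp: mpow_def)
  qed
next
  case (insert j I)
  let ?S = "\<lambda>I. {\<beta>::'n \<Rightarrow> nat. \<forall>i. i \<notin> I \<longrightarrow> \<beta> i = 0}"
  note hyps = rR insert.prems(1) insert.prems(2)[OF insertI1]
  have "norm (F 0) \<le> M" using insert.prems rR by (auto simp: polydisc_def)
  then have M: "M \<ge> 0" using norm_ge_zero order_trans by blast
  have ex: "\<exists>c. (\<forall>\<beta>. norm (c \<beta>) \<le> (M / r ^ k) / r ^ (\<Sum>i\<in>UNIV. \<beta> i)) \<and>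
    (\<forall>z\<in>polydisc r. (\<forall>i. i \<notin> I \<longrightarrow> z $ i = 0) \<longrightarrow>
       ((\<lambda>\<beta>. c \<beta> * mpow z \<beta>) has_sum taylor_coeff F j k z) (?S I))" for k
  proof (rule insert.IH)
    show "norm (taylor_coeff F j k z) \<le> M / r ^ k" if "z \<in> polydisc R" for z
      by (rule taylor_coeff_bound[OF hyps that])
    show "(\<lambda>w. taylor_coeff F j k (cset z i w)) holomorphic_on ball 0 R" if "i \<in> I" "z \<in> polydisc R" for i z
      by (rule taylor_coeff_holomorphic[OF hyps]) (use insert that in auto)
  qed
  have "\<exists>c. \<forall>k. (\<forall>\<beta>. norm (c k \<beta>) \<le> (M / r ^ k) / r ^ (\<Sum>i\<in>UNIV. \<beta> i)) \<and>
    (\<forall>z\<in>polydisc r. (\<forall>i. i \<notin> I \<longrightarrow> z $ i = 0) \<longrightarrow>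
       ((\<lambda>\<beta>. c k \<beta> * mpow z \<beta>) has_sum taylor_coeff F j k z) (?S I))"
    by (rule choice, rule allI, rule ex)
  then obtain c where c: "\<And>k \<beta>. norm (c k \<beta>) \<le> (M / r ^ k) / r ^ (\<Sum>i\<in>UNIV. \<beta> i)"
    "\<And>k z. z \<in> polydisc r \<Longrightarrow> (\<And>i. i \<notin> I \<Longrightarrow> z $ i = 0) \<Longrightarrow>
       ((\<lambda>\<beta>. c k \<beta> * mpow z \<beta>) has_sum taylor_coeff F j k z) (?S I)"
    by blast
  \<comment> \<open>The j-th entry of a multi-index is the order in the new variable; the rest, with
    entry 0 at j, indexes the expansion of that Taylor coefficient.\<close>
  define d where "d \<beta> = c (\<beta> j) (\<beta>(j := 0))" for \<beta>
  have dbound: "norm (d \<beta>) \<le> M / r ^ (\<Sum>i\<in>UNIV. \<beta> i)" for \<beta>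
  proof -
    have "norm (d \<beta>) \<le> (M / r ^ \<beta> j) / r ^ (\<Sum>i\<in>UNIV. (\<beta>(j := 0)) i)"
      unfolding d_def by (rule c)
    also have "\<dots> = M / r ^ (\<beta> j + (\<Sum>i\<in>UNIV - {j}. \<beta> i))"
      unfolding sum_upd by (simp add: power_add)
    also have "\<beta> j + (\<Sum>i\<in>UNIV - {j}. \<beta> i) = (\<Sum>i\<in>UNIV. \<beta> i)"
      by (rule sum.remove[symmetric]) auto
    finally show ?thesis .
  qed
  have "((\<lambda>\<beta>. d \<beta> * mpow z \<beta>) has_sum F z) (?S (insert j I))"
    if z: "z \<in> polydisc r" and z0: "\<And>i. i \<notin> insert j I \<Longrightarrow> z $ i = 0" for z
  proof -
    let ?h = "\<lambda>(k, \<beta>). \<beta>(j := k :: nat)" and ?w = "z $ j" and ?z = "cset z j 0"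
    let ?f = "\<lambda>(k, \<beta>). c k \<beta> * mpow ?z \<beta> * ?w ^ k"
    have zR: "?z \<in> polydisc R" "norm ?w < R" and zr: "?z \<in> polydisc r"
      using z rR by (auto simp: polydisc_def intro: less_trans[OF _ rR(2)])
    have bij: "bij_betw ?h (UNIV \<times> ?S I) (?S (insert j I))"
      by (rule bij_betw_byWitness[of _ "\<lambda>\<beta>. (\<beta> j, \<beta>(j := 0))"]) (use insert.hyps in \<open>auto simp: fun_eq_iff\<close>)
    have eq: "d (?h p) * mpow z (?h p) = ?f p" if "p \<in> UNIV \<times> ?S I" for p
    proof -
      obtain k \<beta> where p1: "p = (k, \<beta>)" by (cases p)
      with that insert.hyps have p: "p = (k, \<beta>)" "\<beta> j = 0" by auto
      have b: "\<beta>(j := 0) = \<beta>" using p by auto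
      have "mpow ?z \<beta> = (\<Prod>i\<in>UNIV - {j}. z $ i ^ \<beta> i)"
        using mpow_upd[of ?z \<beta> j 0] unfolding b by (simp only: power_0 mult_1) (intro prod.cong, auto)
      then show ?thesis by (simp add: p d_def mpow_upd b mult_ac)
    qed
    \<comment> \<open>Iterated sums alone do not yield an unordered sum over all multi-indices;
      \<open>has_sum_SigmaI\<close> asks for summability of the whole family, which the geometric
      majorant provides.\<close>
    have "(\<lambda>\<beta>. norm (d \<beta> * mpow z \<beta>)) summable_on ?S (insert j I)"
    proof (rule Infinite_Sum.abs_summable_on_comparison_test')
      have "(\<lambda>\<beta>. M * (\<Prod>i\<in>UNIV. (norm (z $ i) / r) ^ \<beta> i)) summable_on UNIV"
        using z rR by (intro summable_on_cmult_right geometric_multi_summable) (auto simp: polydisc_def)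
      then show "(\<lambda>\<beta>. M * (\<Prod>i\<in>UNIV. (norm (z $ i) / r) ^ \<beta> i)) summable_on ?S (insert j I)"
        by (rule summable_on_subset) auto
      fix \<beta>
      have "norm (d \<beta> * mpow z \<beta>) \<le> M / r ^ (\<Sum>i\<in>UNIV. \<beta> i) * norm (mpow z \<beta>)"
        unfolding norm_mult by (intro mult_right_mono dbound) auto
      also have "\<dots> = M * (\<Prod>i\<in>UNIV. (norm (z $ i) / r) ^ \<beta> i)"
        by (simp add: mpow_def power_sum power_divide prod_dividef norm_power flip: prod_norm)
      finally show "norm (d \<beta> * mpow z \<beta>) \<le> M * (\<Prod>i\<in>UNIV. (norm (z $ i) / r) ^ \<beta> i)" .
    qed
    then have "(\<lambda>\<beta>. d \<beta> * mpow z \<beta>) summable_on ?S (insert j I)" by (rule abs_summable_summable)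
    then have "(\<lambda>p. d (?h p) * mpow z (?h p)) summable_on UNIV \<times> ?S I"
      by (subst summable_on_reindex_bij_betw[OF bij, where f="\<lambda>\<beta>. d \<beta> * mpow z \<beta>"])
    then have sm: "?f summable_on UNIV \<times> ?S I"
      by (subst (asm) summable_on_cong[OF eq]) auto
    have inner: "((\<lambda>\<beta>. ?f (k, \<beta>)) has_sum taylor_coeff F j k ?z * ?w ^ k) (?S I)" for k
      using c(2)[OF zr, of k] z0 by (auto intro!: has_sum_cmult_left)
    have "summable (\<lambda>k. norm (taylor_coeff F j k ?z * ?w ^ k))"
    proof (rule summable_comparison_test')
      have "norm ?w / r < 1" using z rR by (auto simp: polydisc_def)
      then show "summable (\<lambda>k. M * (norm ?w / r) ^ k)"
        using rR by (intro summable_mult summable_geometric) auto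
      fix k :: nat
      have "norm (taylor_coeff F j k ?z * ?w ^ k) \<le> M / r ^ k * norm ?w ^ k"
        unfolding norm_mult norm_power by (intro mult_right_mono taylor_coeff_bound[OF hyps zR(1)]) auto
      then show "norm (norm (taylor_coeff F j k ?z * ?w ^ k)) \<le> M * (norm ?w / r) ^ k"
        by (simp add: power_divide)
    qed
    moreover have "(\<lambda>k. taylor_coeff F j k ?z * ?w ^ k) sums F (cset ?z j ?w)"
      by (rule taylor_coeff_sums[OF hyps zR])
    moreover have "cset ?z j ?w = z" by (simp add: vec_eq_iff)
    ultimately have outer: "((\<lambda>k. taylor_coeff F j k ?z * ?w ^ k) has_sum F z) UNIV"
      using norm_summable_imp_has_sum by metis
    have "(?f has_sum F z) (UNIV \<times> ?S I)"
      by (rule has_sum_SigmaI[OF inner outer sm])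
    then have "((\<lambda>p. d (?h p) * mpow z (?h p)) has_sum F z) (UNIV \<times> ?S I)"
      by (subst has_sum_cong[OF eq]) auto
    then show ?thesis
      by (subst (asm) has_sum_reindex_bij_betw[OF bij, where f="\<lambda>\<beta>. d \<beta> * mpow z \<beta>"])
  qed
  with dbound show ?case by blast
qed

text \<open>The partial derivative of the monomial \<open>mpow\<close> in the i-th variable. Where
  the exponent \<beta> i is 0 the truncated difference is again 0, but the leading factor makes the
  value 0 as it should be.\<close>

definition dmpow :: "'n \<Rightarrow> 'a::comm_semiring_1^'n \<Rightarrow> ('n \<Rightarrow> nat) \<Rightarrow> 'a" where
  "dmpow i z \<beta> = of_nat (\<beta> i) * mpow z (\<beta>(i := \<beta> i - 1))"

lemma has_derivative_mpow:
  fixes z :: "complex^'n"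
  shows "((\<lambda>z. mpow z \<beta>) has_derivative (\<lambda>v. \<Sum>i\<in>UNIV. v $ i * dmpow i z \<beta>)) (at z within S)"
proof -
  have "((\<lambda>z. \<Prod>i\<in>UNIV. z $ i ^ \<beta> i) has_derivative
      (\<lambda>v. \<Sum>i\<in>UNIV. (of_nat (\<beta> i) * v $ i * z $ i ^ (\<beta> i - 1)) * (\<Prod>j\<in>UNIV - {i}. z $ j ^ \<beta> j))) (at z within S)"
    by (intro has_derivative_prod has_derivative_power bounded_linear.has_derivative[OF bounded_linear_vec_nth] has_derivative_ident)
  also have "(\<lambda>v. \<Sum>i\<in>UNIV. (of_nat (\<beta> i) * v $ i * z $ i ^ (\<beta> i - 1)) * (\<Prod>j\<in>UNIV - {i}. z $ j ^ \<beta> j)) =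
      (\<lambda>v. \<Sum>i\<in>UNIV. v $ i * dmpow i z \<beta>)"
    unfolding dmpow_def mpow_upd by (simp add: mult_ac)
  finally show ?thesis unfolding mpow_def .
qed

lemma dmpow_bound:
  fixes z :: "complex^'n"
  assumes \<rho>: "0 < s" "s < \<rho>" and K: "\<And>m. real m * s ^ (m - 1) \<le> K * \<rho> ^ m" and z: "\<And>i. norm (z $ i) \<le> s"
  shows "norm (dmpow i z \<beta>) \<le> K * \<rho> ^ (\<Sum>i\<in>UNIV. \<beta> i)"
proof (cases "\<beta> i = 0")
  case True
  have "0 \<le> K * \<rho> ^ 0" using K[of 0] by simp
  then have "0 \<le> K" by simp
  then show ?thesis using True \<rho> by (simp add: dmpow_def)
next
  case False
  let ?m = "\<Sum>i\<in>UNIV. \<beta> i"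
  have m: "?m = \<beta> i + (\<Sum>i\<in>UNIV - {i}. \<beta> i)" by (rule sum.remove) auto
  have "norm (mpow z (\<beta>(i := \<beta> i - 1))) \<le> (\<Prod>j\<in>UNIV. s ^ (\<beta>(i := \<beta> i - 1)) j)"
    unfolding mpow_def prod_norm[symmetric] norm_power
    using z \<rho> by (intro prod_mono conjI power_mono) auto
  also have "\<dots> = s ^ (?m - 1)"
    using False unfolding m power_sum[symmetric] sum_upd by simp
  finally have "norm (dmpow i z \<beta>) \<le> real (\<beta> i) * s ^ (?m - 1)"
    unfolding dmpow_def norm_mult by (intro mult_mono) auto
  also have "\<dots> \<le> real ?m * s ^ (?m - 1)"
    using m \<rho> by (intro mult_right_mono) (auto simp flip: of_nat_add)
  also have "\<dots> \<le> K * \<rho> ^ ?m" by (rule K)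
  finally show ?thesis .
qed

text \<open>Differentiating a power costs a factor m and one factor s. Shrinking the radius from
  \<rho> to s pays for both: m (s / \<rho>)^m tends to 0, so it has a bound C, and K is C /
  s.\<close>

lemma power_derivative_bound:
  fixes s \<rho> :: real
  assumes "0 < s" "s < \<rho>"
  obtains K where "K \<ge> 0" "\<And>m. real m * s ^ (m - 1) \<le> K * \<rho> ^ m"
proof -
  have "(\<lambda>m. real m * (s / \<rho>) ^ m) \<longlonglongrightarrow> 0"
    using assms by (intro powser_times_n_limit_0) auto
  then have "Bseq (\<lambda>m. real m * (s / \<rho>) ^ m)"
    by (intro convergent_imp_Bseq convergentI)
  then obtain C where C: "C > 0" "\<And>m. norm (real m * (s / \<rho>) ^ m) \<le> C" by (auto elim: BseqE)
  have "real m * s ^ (m - 1) \<le> (C / s) * \<rho> ^ m" for m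
  proof (cases m)
    case (Suc l)
    have "real m * (s / \<rho>) ^ m \<le> C" using C(2)[of m] assms by auto
    then have "real m * s ^ m \<le> C * \<rho> ^ m" using assms by (simp add: power_divide field_simps)
    then show ?thesis using assms Suc by (simp add: field_simps)
  qed (use C assms in auto)
  then show ?thesis using C assms by (intro that[of "C / s"]) auto
qed

definition pseries :: "(('n \<Rightarrow> nat) \<Rightarrow> complex) \<Rightarrow> complex^'n \<Rightarrow> complex" where
  "pseries c z = infsum (\<lambda>\<beta>. c \<beta> * mpow z \<beta>) UNIV"

definition dcoeff :: "'n \<Rightarrow> (('n \<Rightarrow> nat) \<Rightarrow> complex) \<Rightarrow> ('n \<Rightarrow> nat) \<Rightarrow> complex" where
  "dcoeff i c \<beta> = of_nat (\<beta> i + 1) * c (\<beta>(i := \<beta> i + 1))"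

text \<open>Absolute convergence at the corner point with all coordinates \<rho>, hence on the whole
  closed polydisc of that radius.\<close>

definition conv_at :: "(('n::finite \<Rightarrow> nat) \<Rightarrow> complex) \<Rightarrow> real \<Rightarrow> bool" where
  "conv_at c \<rho> \<longleftrightarrow> (\<lambda>\<beta>. norm (c \<beta>) * \<rho> ^ (\<Sum>i\<in>UNIV. \<beta> i)) summable_on UNIV"

lemma norm_mpow_le:
  fixes z :: "complex^'n"
  assumes "\<And>i. norm (z $ i) \<le> \<rho>"
  shows "norm (mpow z \<beta>) \<le> \<rho> ^ (\<Sum>i\<in>UNIV. \<beta> i)"
proof -
  have "norm (mpow z \<beta>) \<le> (\<Prod>j\<in>UNIV. \<rho> ^ \<beta> j)"
    unfolding mpow_def prod_norm[symmetric] norm_power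
    using assms by (intro prod_mono conjI power_mono) auto
  then show ?thesis by (simp add: power_sum)
qed

lemma pseries_has_sum:
  fixes z :: "complex^'n"
  assumes "conv_at c \<rho>" "\<And>i. norm (z $ i) \<le> \<rho>"
  shows "((\<lambda>\<beta>. c \<beta> * mpow z \<beta>) has_sum pseries c z) UNIV"
proof -
  have "(\<lambda>\<beta>. norm (c \<beta> * mpow z \<beta>)) summable_on UNIV"
    using assms(1) unfolding conv_at_def
    by (rule Infinite_Sum.abs_summable_on_comparison_test')
       (auto simp: norm_mult intro!: mult_left_mono norm_mpow_le assms)
  then show ?thesis unfolding pseries_def by (rule has_sum_infsum[OF abs_summable_summable])
qed

lemma inj_upd_Suc: "inj (\<lambda>\<beta>::'n \<Rightarrow> nat. \<beta>(i := \<beta> i + 1))"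
proof (rule injI)
  fix \<beta> \<gamma> :: "'n \<Rightarrow> nat" assume eq: "\<beta>(i := \<beta> i + 1) = \<gamma>(i := \<gamma> i + 1)"
  show "\<beta> = \<gamma>"
  proof
    fix j show "\<beta> j = \<gamma> j" using fun_cong[OF eq, of j] by (auto split: if_splits)
  qed
qed

lemma range_upd_Suc: "\<beta> i \<noteq> 0 \<Longrightarrow> \<beta> \<in> range (\<lambda>\<beta>::'n \<Rightarrow> nat. \<beta>(i := \<beta> i + 1))"
  by (rule image_eqI[of _ _ "\<beta>(i := \<beta> i - 1)"]) auto

lemma conv_at_dcoeff:
  assumes c: "conv_at c \<rho>" and \<rho>: "0 < s" "s < \<rho>"
  shows "conv_at (dcoeff i c) s"
proof -
  obtain K where K: "K \<ge> 0" "\<And>m. real m * s ^ (m - 1) \<le> K * \<rho> ^ m"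
    using power_derivative_bound[OF \<rho>] by metis
  let ?h = "\<lambda>\<beta>::'a \<Rightarrow> nat. \<beta>(i := \<beta> i + 1)"
  have "(\<lambda>\<beta>. norm (c \<beta>) * \<rho> ^ (\<Sum>i\<in>UNIV. \<beta> i)) summable_on range ?h"
    using c unfolding conv_at_def by (rule summable_on_subset) auto
  then have "(\<lambda>\<beta>. norm (c (?h \<beta>)) * \<rho> ^ (\<Sum>i\<in>UNIV. ?h \<beta> i)) summable_on UNIV"
    by (subst (asm) summable_on_reindex[OF inj_upd_Suc]) (simp add: o_def)
  then have "(\<lambda>\<beta>. K * (norm (c (?h \<beta>)) * \<rho> ^ (\<Sum>i\<in>UNIV. ?h \<beta> i))) summable_on UNIV"
    by (rule summable_on_cmult_right)
  then have "(\<lambda>\<beta>. norm (norm (dcoeff i c \<beta>) * s ^ (\<Sum>i\<in>UNIV. \<beta> i))) summable_on UNIV"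
  proof (rule Infinite_Sum.abs_summable_on_comparison_test')
    fix \<beta> :: "'a \<Rightarrow> nat"
    let ?m = "\<Sum>i\<in>UNIV. ?h \<beta> i"
    have m: "?m = \<beta> i + 1 + (\<Sum>i\<in>UNIV - {i}. \<beta> i)" by (rule sum_upd)
    have "(\<Sum>i\<in>UNIV. \<beta> i) = \<beta> i + (\<Sum>i\<in>UNIV - {i}. \<beta> i)" by (rule sum.remove) auto
    with m have m1: "(\<Sum>i\<in>UNIV. \<beta> i) = ?m - 1" by simp
    have "real (\<beta> i + 1) * s ^ (?m - 1) \<le> real ?m * s ^ (?m - 1)"
      using \<rho> m by (intro mult_right_mono of_nat_mono zero_le_power) linarith+
    also have "\<dots> \<le> K * \<rho> ^ ?m" by (rule K)
    finally have "norm (c (?h \<beta>)) * (real (\<beta> i + 1) * s ^ (?m - 1)) \<le> norm (c (?h \<beta>)) * (K * \<rho> ^ ?m)"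
      by (intro mult_left_mono) auto
    then show "norm (norm (dcoeff i c \<beta>) * s ^ (\<Sum>i\<in>UNIV. \<beta> i)) \<le> K * (norm (c (?h \<beta>)) * \<rho> ^ ?m)"
      unfolding m1 dcoeff_def norm_mult using \<rho> by (simp add: mult_ac del: of_nat_add of_nat_Suc)
  qed
  then have "(\<lambda>\<beta>. norm (dcoeff i c \<beta>) * s ^ (\<Sum>i\<in>UNIV. \<beta> i)) summable_on UNIV"
    by (rule abs_summable_summable)
  then show ?thesis unfolding conv_at_def .
qed

text \<open>The derived series occurs in two indexings: termwise differentiation gives
  \<open>dmpow\<close>, while \<open>dcoeff\<close> collects by the resulting monomial. The shift
  between them misses exactly the multi-indices with \<beta> i = 0, whose terms vanish.\<close>

lemma pseries_dcoeff_has_sum: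
  fixes z :: "complex^'n"
  assumes "conv_at c \<rho>" "0 < s" "s < \<rho>" "\<And>i. norm (z $ i) \<le> s"
  shows "((\<lambda>\<beta>. c \<beta> * dmpow i z \<beta>) has_sum pseries (dcoeff i c) z) UNIV"
proof -
  let ?h = "\<lambda>\<beta>::'n \<Rightarrow> nat. \<beta>(i := \<beta> i + 1)"
  have "((\<lambda>\<beta>. dcoeff i c \<beta> * mpow z \<beta>) has_sum pseries (dcoeff i c) z) UNIV"
    using assms by (intro pseries_has_sum[OF conv_at_dcoeff])
  also have "(\<lambda>\<beta>. dcoeff i c \<beta> * mpow z \<beta>) = (\<lambda>\<beta>. c \<beta> * dmpow i z \<beta>) \<circ> ?h"
    by (auto simp: fun_eq_iff dcoeff_def dmpow_def mult_ac simp del: of_nat_add of_nat_Suc)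
  finally have "((\<lambda>\<beta>. c \<beta> * dmpow i z \<beta>) has_sum pseries (dcoeff i c) z) (range ?h)"
    by (subst (asm) has_sum_reindex[OF inj_upd_Suc, symmetric])
  moreover have "c \<beta> * dmpow i z \<beta> = 0" if "\<beta> \<notin> range ?h" for \<beta>
    using that range_upd_Suc[of \<beta> i] by (auto simp: dmpow_def)
  ultimately show ?thesis
    using has_sum_cong_neutral[of UNIV "range ?h" "\<lambda>\<beta>. c \<beta> * dmpow i z \<beta>" "\<lambda>\<beta>. c \<beta> * dmpow i z \<beta>"]
    by simp
qed

text \<open>Termwise differentiation: on a slightly smaller polydisc the differentiated series
  converges uniformly by the Weierstrass test, and convexity of that polydisc then gives the
  derivative of the limit.\<close>

lemma has_derivative_pseries:
  fixes z :: "complex^'n"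
  assumes c: "conv_at c \<rho>" and z: "z \<in> polydisc \<rho>" and "\<rho> > 0"
  shows "(pseries c has_derivative (\<lambda>v. \<Sum>i\<in>UNIV. v $ i * pseries (dcoeff i c) z)) (at z)"
proof -
  define m where "m = Max (range (\<lambda>i. norm (z $ i)))"
  have "m < \<rho>" and m: "\<And>i. norm (z $ i) \<le> m"
    using z by (auto simp: m_def polydisc_def)
  moreover have "0 \<le> m" using m[of undefined] norm_ge_zero order_trans by blast
  ultimately have "max 0 m < \<rho>" "\<And>i. norm (z $ i) \<le> max 0 m" "0 \<le> max 0 m" using \<open>\<rho> > 0\<close> by auto
  then obtain s where s: "0 < s" "s < \<rho>" "\<And>i. norm (z $ i) < s"
    by (metis dense le_less_trans)
  obtain K where K: "K \<ge> 0" "\<And>m. real m * s ^ (m - 1) \<le> K * \<rho> ^ m"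
    using power_derivative_bound[OF s(1,2)] by metis
  let ?S = "polydisc s :: (complex^'n) set"
  have S: "?S = (\<Inter>i. {z. norm (z $ i) < s})" by (auto simp: polydisc_def)
  have opn: "open ?S" unfolding S
    by (intro open_INT ballI open_Collect_less continuous_intros) auto
  have convex: "convex ?S" unfolding S
  proof (rule convex_INT)
    fix i
    have "{z::complex^'n. norm (z $ i) < s} = (\<lambda>z. z $ i) -` ball 0 s" by auto
    then show "convex {z::complex^'n. norm (z $ i) < s}"
      by (simp add: convex_linear_vimage bounded_linear.linear[OF bounded_linear_vec_nth])
  qed
  \<comment> \<open>Uniform convergence comes along the net of finite index sets, but
    \<open>has_derivative_sequence\<close> speaks of sequences. The boxes B n are finite and
    eventually contain every finite set, so they are a cofinal sequence.\<close>
  define B where "B n = {\<beta>::'n \<Rightarrow> nat. \<forall>i. \<beta> i \<le> n}" for n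
  have finB: "finite (B n)" for n
  proof -
    have "B n = PiE UNIV (\<lambda>_. {..n})" by (auto simp: B_def PiE_def Pi_def extensional_def)
    then show ?thesis by (simp add: finite_PiE)
  qed
  have Blim: "filterlim B (finite_subsets_at_top UNIV) sequentially"
  proof (rule filterlim_finite_subsets_at_top[THEN iffD2], intro allI impI)
    fix X :: "('n \<Rightarrow> nat) set" assume "finite X \<and> X \<subseteq> UNIV"
    then have fin: "finite (\<Union>\<beta>\<in>X. range \<beta>)" by auto
    show "\<forall>\<^sub>F n in sequentially. finite (B n) \<and> X \<subseteq> B n \<and> B n \<subseteq> UNIV"
    proof (rule eventually_sequentiallyI)
      fix n assume "Max (insert 0 (\<Union>\<beta>\<in>X. range \<beta>)) \<le> n"
      then have "\<beta> i \<le> n" if "\<beta> \<in> X" for \<beta> i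
        using fin that Max_ge[of "insert 0 (\<Union>\<beta>\<in>X. range \<beta>)" "\<beta> i"] by auto
      then show "finite (B n) \<and> X \<subseteq> B n \<and> B n \<subseteq> UNIV" using finB by (auto simp: B_def)
    qed
  qed
  have ul: "uniform_limit ?S (\<lambda>X z. \<Sum>\<beta>\<in>X. c \<beta> * dmpow i z \<beta>)
      (\<lambda>z. infsum (\<lambda>\<beta>. c \<beta> * dmpow i z \<beta>) UNIV) (finite_subsets_at_top UNIV)" for i
  proof (rule Weierstrass_m_test_general)
    show "(\<lambda>\<beta>. K * (norm (c \<beta>) * \<rho> ^ (\<Sum>i\<in>UNIV. \<beta> i))) summable_on UNIV"
      using c unfolding conv_at_def by (rule summable_on_cmult_right)
    fix \<beta> and z :: "complex^'n" assume "z \<in> ?S"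
    then have "norm (c \<beta> * dmpow i z \<beta>) \<le> norm (c \<beta>) * (K * \<rho> ^ (\<Sum>i\<in>UNIV. \<beta> i))"
      unfolding norm_mult by (intro mult_left_mono dmpow_bound[OF s(1,2) K(2)]) (auto simp: polydisc_def less_imp_le)
    then show "norm (c \<beta> * dmpow i z \<beta>) \<le> K * (norm (c \<beta>) * \<rho> ^ (\<Sum>i\<in>UNIV. \<beta> i))"
      by (simp add: mult_ac)
  qed
  have lim_eq: "infsum (\<lambda>\<beta>. c \<beta> * dmpow i z \<beta>) UNIV = pseries (dcoeff i c) z" if "z \<in> ?S" for i z
    using that by (intro infsumI pseries_dcoeff_has_sum[OF c s(1,2)]) (auto simp: polydisc_def less_imp_le)
  have ev: "\<forall>\<^sub>F n in sequentially. \<forall>z\<in>?S. dist (\<Sum>\<beta>\<in>B n. c \<beta> * dmpow i z \<beta>) (pseries (dcoeff i c) z) < e"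
    if "e > 0" for e i
    using eventually_compose_filterlim[OF uniform_limitD[OF ul[of i] that] Blim] by (simp add: lim_eq)
  have z0: "((\<lambda>n. \<Sum>\<beta>\<in>B n. c \<beta> * mpow z \<beta>) \<longlonglongrightarrow> pseries c z)" if "z \<in> ?S" for z
  proof -
    have "((\<lambda>\<beta>. c \<beta> * mpow z \<beta>) has_sum pseries c z) UNIV"
      using that s by (intro pseries_has_sum[OF c]) (auto simp: polydisc_def intro: less_imp_le less_trans)
    then show ?thesis unfolding has_sum_def by (rule filterlim_compose[OF _ Blim])
  qed
  have zS: "z \<in> ?S" using s by (simp add: polydisc_def)
  have "\<exists>g. \<forall>x\<in>?S. (\<lambda>n. \<Sum>\<beta>\<in>B n. c \<beta> * mpow x \<beta>) \<longlonglongrightarrow> g x \<and>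
     (g has_derivative (\<lambda>v. \<Sum>i\<in>UNIV. v $ i * pseries (dcoeff i c) x)) (at x within ?S)"
  proof (rule has_derivative_sequence[OF convex])
    fix n x
    have "((\<lambda>z. \<Sum>\<beta>\<in>B n. c \<beta> * mpow z \<beta>) has_derivative (\<lambda>v. \<Sum>\<beta>\<in>B n. c \<beta> * (\<Sum>i\<in>UNIV. v $ i * dmpow i x \<beta>))) (at x within ?S)"
      by (intro has_derivative_sum has_derivative_mult_right has_derivative_mpow)
    also have "(\<lambda>v. \<Sum>\<beta>\<in>B n. c \<beta> * (\<Sum>i\<in>UNIV. v $ i * dmpow i x \<beta>)) = (\<lambda>v. \<Sum>i\<in>UNIV. v $ i * (\<Sum>\<beta>\<in>B n. c \<beta> * dmpow i x \<beta>))"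
      by (rule ext) (simp add: sum_distrib_left mult_ac, rule sum.swap)
    finally show "((\<lambda>z. \<Sum>\<beta>\<in>B n. c \<beta> * mpow z \<beta>) has_derivative (\<lambda>v. \<Sum>i\<in>UNIV. v $ i * (\<Sum>\<beta>\<in>B n. c \<beta> * dmpow i x \<beta>))) (at x within ?S)" .
  next
    fix e :: real assume "e > 0"
    \<comment> \<open>The error e is divided evenly among the coordinate terms of the
      derivative.\<close>
    define N where "N = real CARD('n)"
    have N: "N > 0" by (simp add: N_def)
    have "\<forall>\<^sub>F n in sequentially. \<forall>i\<in>UNIV. \<forall>z\<in>?S. dist (\<Sum>\<beta>\<in>B n. c \<beta> * dmpow i z \<beta>) (pseries (dcoeff i c) z) < e / N"
      using \<open>e > 0\<close> N by (intro eventually_ball_finite ballI ev) auto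
    then show "\<forall>\<^sub>F n in sequentially. \<forall>x\<in>?S. \<forall>h. norm ((\<Sum>i\<in>UNIV. h $ i * (\<Sum>\<beta>\<in>B n. c \<beta> * dmpow i x \<beta>)) -
        (\<Sum>i\<in>UNIV. h $ i * pseries (dcoeff i c) x)) \<le> e * norm h"
    proof eventually_elim
      case (elim n)
      show ?case
      proof (intro ballI allI)
        fix x h assume x: "x \<in> ?S"
        have "norm ((\<Sum>i\<in>UNIV. h $ i * (\<Sum>\<beta>\<in>B n. c \<beta> * dmpow i x \<beta>)) - (\<Sum>i\<in>UNIV. h $ i * pseries (dcoeff i c) x))
          = norm (\<Sum>i\<in>UNIV. h $ i * ((\<Sum>\<beta>\<in>B n. c \<beta> * dmpow i x \<beta>) - pseries (dcoeff i c) x))"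
          by (simp add: sum_subtractf right_diff_distrib)
        also have "\<dots> \<le> (\<Sum>i\<in>(UNIV::'n set). norm h * (e / N))"
        proof (rule sum_norm_le)
          fix i
          have "norm ((\<Sum>\<beta>\<in>B n. c \<beta> * dmpow i x \<beta>) - pseries (dcoeff i c) x) \<le> e / N"
            using elim x by (auto simp: dist_norm intro: less_imp_le)
          then show "norm (h $ i * ((\<Sum>\<beta>\<in>B n. c \<beta> * dmpow i x \<beta>) - pseries (dcoeff i c) x)) \<le> norm h * (e / N)"
            unfolding norm_mult by (intro mult_mono Finite_Cartesian_Product.norm_nth_le) auto
        qed
        also have "\<dots> = e * norm h" using N by (simp add: N_def)
        finally show "norm ((\<Sum>i\<in>UNIV. h $ i * (\<Sum>\<beta>\<in>B n. c \<beta> * dmpow i x \<beta>)) - (\<Sum>i\<in>UNIV. h $ i * pseries (dcoeff i c) x)) \<le> e * norm h" .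
      qed
    qed
  qed (use zS z0 in auto)
  then obtain g where g: "\<And>x. x \<in> ?S \<Longrightarrow> (\<lambda>n. \<Sum>\<beta>\<in>B n. c \<beta> * mpow x \<beta>) \<longlonglongrightarrow> g x"
    "\<And>x. x \<in> ?S \<Longrightarrow> (g has_derivative (\<lambda>v. \<Sum>i\<in>UNIV. v $ i * pseries (dcoeff i c) x)) (at x within ?S)" by blast
  have geq: "g x = pseries c x" if "x \<in> ?S" for x using LIMSEQ_unique[OF g(1) z0] that by blast
  have "(g has_derivative (\<lambda>v. \<Sum>i\<in>UNIV. v $ i * pseries (dcoeff i c) z)) (at z)"
    using g(2)[OF zS] unfolding at_within_open[OF zS opn] .
  then show ?thesis
    by (rule has_derivative_transform_within_open[OF _ opn zS]) (rule geq)
qed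

section \<open>Real analytic functions\<close>

text \<open>Complex differentiability on a set of \<open>\<complex>\<^sup>n\<close>: a real total derivative that is complex linear. Closure under
  composition and the holomorphic inverse function theorem thereby reduce to the real ones.\<close>
definition cdiff :: "(complex^'n) set \<Rightarrow> (complex^'n \<Rightarrow> complex) \<Rightarrow> bool" where
  "cdiff U F \<longleftrightarrow> (\<forall>z\<in>U. \<exists>D. (F has_derivative D) (at z) \<and> (\<forall>c v. D (c *s v) = c * D v))"

lemma cdiff_subset: "cdiff U F \<Longrightarrow> V \<subseteq> U \<Longrightarrow> cdiff V F"
  by (auto simp: cdiff_def)

lemma cdiff_continuous: "cdiff U F \<Longrightarrow> continuous_on U F"
  unfolding cdiff_def by (intro continuous_at_imp_continuous_on) (blast intro: has_derivative_continuous)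

lemma polydisc_in_ball:
  assumes "r > 0"
  obtains s where "s > 0" "polydisc s \<subseteq> ball (0::complex^'n) r" 
proof (rule that[of "r / real CARD('n)"])
  show "polydisc (r / real CARD('n)) \<subseteq> ball (0::complex^'n) r"
  proof
    fix z :: "complex^'n" assume z: "z \<in> polydisc (r / real CARD('n))"
    have "norm z \<le> (\<Sum>i\<in>UNIV. norm (z $ i))" by (simp add: norm_vec_def L2_set_le_sum)
    also have "\<dots> < (\<Sum>i\<in>(UNIV::'n set). r / real CARD('n))"
      using z by (intro sum_strict_mono) (auto simp: polydisc_def)
    finally show "z \<in> ball 0 r" by simp
  qed
qed (use assms in auto)

lemma ball_in_polydisc: "ball (0::'a::real_normed_vector^'n) s \<subseteq> polydisc s"
  by (auto simp: polydisc_def intro: le_less_trans[OF Finite_Cartesian_Product.norm_nth_le])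

text \<open>A complex linear derivative makes F holomorphic in each variable, and continuity bounds
  it on the closed ball of radius \<delta> / 2. That is all the separate expansion asks for.\<close>

lemma cdiff_expansion:
  fixes F :: "complex^'n \<Rightarrow> complex"
  assumes hol: "cdiff (ball z0 \<delta>) F" and \<delta>: "\<delta> > 0"
  shows "\<exists>c \<rho>. \<rho> > 0 \<and> conv_at c \<rho> \<and> (\<forall>z\<in>polydisc \<rho>. F (z0 + z) = pseries c z)"
proof -
  obtain R where R: "R > 0" "polydisc R \<subseteq> ball (0::complex^'n) (\<delta> / 2)"
    using polydisc_in_ball[of "\<delta> / 2"] \<delta> by auto
  have "continuous_on (cball z0 (\<delta> / 2)) F"
    by (rule continuous_on_subset[OF cdiff_continuous[OF hol]]) (use \<delta> in auto)
  then have "bounded (F ` cball z0 (\<delta> / 2))"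
    by (intro compact_imp_bounded compact_continuous_image) auto
  then obtain M where M: "\<And>z. z \<in> cball z0 (\<delta> / 2) \<Longrightarrow> norm (F z) \<le> M"
    unfolding bounded_iff by blast
  let ?F = "\<lambda>z. F (z0 + z)"
  have bd: "norm (?F z) \<le> M" if "z \<in> polydisc R" for z
  proof -
    have "z \<in> ball 0 (\<delta> / 2)" using R that by blast
    then show ?thesis by (intro M) (simp add: dist_norm)
  qed
  have sep: "(\<lambda>w. ?F (cset z i w)) holomorphic_on ball 0 R" if z: "z \<in> polydisc R" for i z
  proof (rule holomorphic_onI)
    fix w :: complex assume "w \<in> ball 0 R"
    then have "cset z i w \<in> polydisc R" using z by (intro polydisc_cset) auto
    then have "z0 + cset z i w \<in> ball z0 \<delta>" using R(2) \<delta> by (force simp: dist_norm)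
    then obtain D where D: "(F has_derivative D) (at (z0 + cset z i w))" "\<And>c v. D (c *s v) = c * D v"
      using hol unfolding cdiff_def by blast
    have "((\<lambda>w. z0 + cset z i w) has_derivative (\<lambda>h. axis i h)) (at w)"
    proof -
      have lin: "bounded_linear (\<lambda>h::complex. axis i h :: complex^'n)"
        by (rule linear_conv_bounded_linear[THEN iffD1], rule linearI) (auto simp: axis_def vec_eq_iff)
      have "(\<lambda>w. z0 + cset z i w) = (\<lambda>w. (z0 + cset z i 0) + axis i w)"
        by (auto simp: fun_eq_iff vec_eq_iff axis_def)
      then show ?thesis
        by (auto intro!: derivative_eq_intros bounded_linear.has_derivative[OF lin])
    qed
    from diff_chain_at[OF this D(1)]
    have "((\<lambda>w. ?F (cset z i w)) has_derivative (\<lambda>h. D (axis i h))) (at w)"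
      by (simp add: o_def)
    also have "(\<lambda>h. D (axis i h)) = (\<lambda>h. D (axis i 1) * h)"
    proof
      fix h :: complex
      have "axis i h = h *s (axis i 1 :: complex^'n)" by (auto simp: vec_eq_iff axis_def)
      then show "D (axis i h) = D (axis i 1) * h" by (metis D(2) mult.commute)
    qed
    finally have "((\<lambda>w. ?F (cset z i w)) has_field_derivative D (axis i 1)) (at w)"
      by (simp add: has_field_derivative_def)
    then show "(\<lambda>w. ?F (cset z i w)) field_differentiable (at w within ball 0 R)"
      unfolding field_differentiable_def using has_field_derivative_at_within by blast
  qed
  define r where "r = R / 2"
  have r: "0 < r" "r < R" using R by (auto simp: r_def)
  have "\<exists>c. (\<forall>\<beta>. norm (c \<beta>) \<le> M / r ^ (\<Sum>i\<in>UNIV. \<beta> i)) \<and>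
    (\<forall>z\<in>polydisc r. (\<forall>i. i \<notin> UNIV \<longrightarrow> z $ i = 0) \<longrightarrow>
       ((\<lambda>\<beta>. c \<beta> * mpow z \<beta>) has_sum ?F z) {\<beta>. \<forall>i. i \<notin> UNIV \<longrightarrow> \<beta> i = 0})"
    using r bd sep by (intro separately_holomorphic_expansion[where F="?F" and M=M and I=UNIV and r=r and R=R]) auto
  then obtain c where c1: "\<forall>\<beta>. norm (c \<beta>) \<le> M / r ^ (\<Sum>i\<in>UNIV. \<beta> i)"
     and c2: "\<forall>z\<in>polydisc r. ((\<lambda>\<beta>. c \<beta> * mpow z \<beta>) has_sum ?F z) UNIV"
    by auto
  note c = c1[rule_format] c2[rule_format]
  \<comment> \<open>Half the radius turns the Cauchy bound on c into a geometric majorant of ratio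
    1/2 in every coordinate.\<close>
  have "conv_at c (r / 2)" unfolding conv_at_def
  proof (rule abs_summable_summable, rule Infinite_Sum.abs_summable_on_comparison_test')
    show "(\<lambda>\<beta>. M * (\<Prod>i\<in>(UNIV::'n set). (1 / 2) ^ \<beta> i)) summable_on UNIV"
      by (intro summable_on_cmult_right geometric_multi_summable) auto
    fix \<beta> :: "'n \<Rightarrow> nat"
    have "norm (c \<beta>) * (r / 2) ^ (\<Sum>i\<in>UNIV. \<beta> i) \<le> M / r ^ (\<Sum>i\<in>UNIV. \<beta> i) * (r / 2) ^ (\<Sum>i\<in>UNIV. \<beta> i)"
      using r by (intro mult_right_mono c) auto
    also have "\<dots> = M * (\<Prod>i\<in>UNIV. (1 / 2) ^ \<beta> i)"
      using r by (simp add: power_sum power_divide prod_dividef)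
    finally show "norm (norm (c \<beta>) * (r / 2) ^ (\<Sum>i\<in>UNIV. \<beta> i)) \<le> M * (\<Prod>i\<in>UNIV. (1 / 2) ^ \<beta> i)"
      using r by simp
  qed
  moreover have "F (z0 + z) = pseries c z" if "z \<in> polydisc (r / 2)" for z
  proof -
    have "z \<in> polydisc r" using that r unfolding polydisc_def by (auto intro: less_trans[of _ "r / 2"])
    from infsumI[OF c(2)[OF this]] show ?thesis by (simp add: pseries_def)
  qed
  ultimately show ?thesis using r by (intro exI[of _ c] exI[of _ "r / 2"]) auto
qed

lemma has_derivative_shift:
  assumes "(f has_derivative D) (at (z - z0))"
  shows "((\<lambda>z. f (z - z0)) has_derivative D) (at z)"
proof -
  have "((\<lambda>z. z - z0) has_derivative (\<lambda>v. v)) (at z)" by (auto intro!: derivative_eq_intros)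
  from diff_chain_at[OF this assms] show ?thesis by (simp add: o_def)
qed

lemma cdiff_pseries:
  fixes c :: "('n::finite \<Rightarrow> nat) \<Rightarrow> complex"
  assumes "conv_at c \<rho>" "\<rho> > 0"
  shows "cdiff (ball z0 \<rho>) (\<lambda>z. pseries c (z - z0))"
  unfolding cdiff_def
proof
  fix z assume "z \<in> ball z0 \<rho>"
  then have "z - z0 \<in> ball 0 \<rho>" by (simp add: dist_norm norm_minus_commute)
  then have "z - z0 \<in> polydisc \<rho>" using ball_in_polydisc by blast
  from has_derivative_pseries[OF assms(1) this assms(2)]
  have "(pseries c has_derivative (\<lambda>v. \<Sum>i\<in>UNIV. v $ i * pseries (dcoeff i c) (z - z0))) (at (z - z0))" .
  then have "((\<lambda>z. pseries c (z - z0)) has_derivative (\<lambda>v. \<Sum>i\<in>UNIV. v $ i * pseries (dcoeff i c) (z - z0))) (at z)"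
    by (rule has_derivative_shift)
  moreover have "\<forall>d v. (\<Sum>i\<in>UNIV. (d *s v) $ i * pseries (dcoeff i c) (z - z0)) = d * (\<Sum>i\<in>UNIV. v $ i * pseries (dcoeff i c) (z - z0))"
    by (simp add: sum_distrib_left mult_ac)
  ultimately show "\<exists>D. ((\<lambda>z. pseries c (z - z0)) has_derivative D) (at z) \<and> (\<forall>c v. D (c *s v) = c * D v)"
    by blast
qed

text \<open>\<open>cdiff\<close> says nothing about how the derivative varies; that the partials are
  again complex differentiable is read off from the power series, whose derived series converges at
  every smaller radius.\<close>

lemma cdiff_partials:
  fixes F :: "complex^'n \<Rightarrow> complex"
  assumes hol: "cdiff (ball z0 \<delta>) F" and \<delta>: "\<delta> > 0"
  obtains G \<epsilon> where "\<epsilon> > 0" "\<epsilon> \<le> \<delta>" "\<And>i. cdiff (ball z0 \<epsilon>) (G i)"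
    "\<And>z. z \<in> ball z0 \<epsilon> \<Longrightarrow> (F has_derivative (\<lambda>v. \<Sum>i\<in>UNIV. v $ i * G i z)) (at z)"
proof -
  obtain c \<rho> where c: "\<rho> > 0" "conv_at c \<rho>" "\<And>z. z \<in> polydisc \<rho> \<Longrightarrow> F (z0 + z) = pseries c z"
    using cdiff_expansion[OF assms] by blast
  define \<epsilon> where "\<epsilon> = min \<delta> (\<rho> / 2)"
  have \<epsilon>: "\<epsilon> > 0" "\<epsilon> \<le> \<delta>" "\<epsilon> < \<rho>" using c \<delta> by (auto simp: \<epsilon>_def)
  show ?thesis
  proof (rule that[OF \<epsilon>(1,2)])
    show "cdiff (ball z0 \<epsilon>) (\<lambda>z. pseries (dcoeff i c) (z - z0))" for i
      using c \<epsilon> by (intro cdiff_pseries conv_at_dcoeff[of c \<rho>])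
    fix z assume z: "z \<in> ball z0 \<epsilon>"
    have pd: "y - z0 \<in> polydisc \<rho>" if "y \<in> ball z0 \<epsilon>" for y
      using that \<epsilon> ball_in_polydisc[of \<rho>] by (force simp: dist_norm norm_minus_commute)
    have "((\<lambda>z. pseries c (z - z0)) has_derivative (\<lambda>v. \<Sum>i\<in>UNIV. v $ i * pseries (dcoeff i c) (z - z0))) (at z)"
      by (rule has_derivative_shift[OF has_derivative_pseries[OF c(2) pd[OF z] c(1)]])
    then show "(F has_derivative (\<lambda>v. \<Sum>i\<in>UNIV. v $ i * pseries (dcoeff i c) (z - z0))) (at z)"
    proof (rule has_derivative_transform_within_open[OF _ open_ball z])
      fix y assume "y \<in> ball z0 \<epsilon>"
      from c(3)[OF pd[OF this]] show "pseries c (y - z0) = F y" by simp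
    qed
  qed
qed

section \<open>Real points of complex space and complexification of real analytic functions\<close>

definition cvec :: "real^'n \<Rightarrow> complex^'n" where "cvec x = (\<chi> i. of_real (x $ i))"

lemma cvec_nth [simp]: "cvec x $ i = of_real (x $ i)" by (simp add: cvec_def)

lemma cvec_diff: "cvec (x - y) = cvec x - cvec y" by (simp add: vec_eq_iff)

lemma norm_cvec [simp]: "norm (cvec x) = norm x" by (simp add: norm_vec_def)

lemma dist_cvec [simp]: "dist (cvec x) (cvec y) = dist x y"
  by (simp add: dist_norm cvec_diff[symmetric])

lemma bounded_linear_cvec: "bounded_linear cvec"
  by (rule linear_conv_bounded_linear[THEN iffD1], rule linearI) (auto simp: vec_eq_iff, simp add: scaleR_conv_of_real)

lemma mpow_cvec: "mpow (cvec x) \<beta> = of_real (mpow x \<beta>)"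
  by (simp add: mpow_def)

text \<open>Real analyticity at a point in terms of a complex differentiable extension.\<close>
definition analytic_at_pt :: "(real^'n \<Rightarrow> real) \<Rightarrow> real^'n \<Rightarrow> bool" where
  "analytic_at_pt f x \<longleftrightarrow> (\<exists>F \<delta>. \<delta> > 0 \<and> cdiff (ball (cvec x) \<delta>) F \<and> (\<forall>y\<in>ball x \<delta>. F (cvec y) = of_real (f y)))"

text \<open>Evaluating the real series at the diagonal point x + (\<rho>, ..., \<rho>) gives
  unordered, hence absolute, convergence there; the same coefficients then converge at complex
  points of that polydisc.\<close>

lemma real_analytic_imp_analytic_at_pt:
  fixes f :: "real^'n \<Rightarrow> real"
  assumes "real_analytic_on V f" "x \<in> V"
  shows "analytic_at_pt f x"
proof -
  obtain r c where r: "r > 0" and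
    c: "\<And>y. y \<in> ball x r \<Longrightarrow> ((\<lambda>\<beta>. c \<beta> * (\<Prod>i\<in>UNIV. (y $ i - x $ i) ^ \<beta> i)) has_sum f y) UNIV"
    using assms unfolding real_analytic_on_def by blast
  \<comment> \<open>Dividing by n + 1 makes the l1 norm n \<rho> of the diagonal vector less than
    r.\<close>
  define \<rho> where "\<rho> = r / (real CARD('n) + 1)"
  have \<rho>: "\<rho> > 0" "\<rho> * real CARD('n) < r" using r by (auto simp: \<rho>_def field_simps)
  have "\<rho> * 1 \<le> \<rho> * real CARD('n)" using \<rho> by (intro mult_left_mono) (auto simp: Suc_le_eq)
  then have "\<rho> < r" using \<rho>(2) by linarith
  have "norm ((\<chi> i. \<rho>) :: real^'n) \<le> (\<Sum>i\<in>UNIV. \<bar>((\<chi> i. \<rho>) :: real^'n) $ i\<bar>)"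
    by (rule norm_le_l1_cart)
  also have "\<dots> < r" using \<rho> by (simp add: mult.commute)
  finally have "x + (\<chi> i. \<rho>) \<in> ball x r" by (simp add: dist_norm)
  from c[OF this] have "(\<lambda>\<beta>. c \<beta> * \<rho> ^ (\<Sum>i\<in>UNIV. \<beta> i)) summable_on UNIV"
    by (simp add: has_sum_imp_summable power_sum)
  then have "(\<lambda>\<beta>. norm (c \<beta> * \<rho> ^ (\<Sum>i\<in>UNIV. \<beta> i))) summable_on UNIV"
    by (subst (asm) summable_on_iff_abs_summable_on_real)
  then have cv: "conv_at (\<lambda>\<beta>. of_real (c \<beta>)) \<rho>"
    using \<rho> by (simp add: conv_at_def abs_mult)
  show ?thesis unfolding analytic_at_pt_def
  proof (rule exI[of _ "\<lambda>z. pseries (\<lambda>\<beta>. of_real (c \<beta>)) (z - cvec x)"], rule exI[of _ \<rho>], intro conjI ballI)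
    show "cdiff (ball (cvec x) \<rho>) (\<lambda>z. pseries (\<lambda>\<beta>. complex_of_real (c \<beta>)) (z - cvec x))"
      by (rule cdiff_pseries[OF cv \<rho>(1)])
    fix y assume y: "y \<in> ball x \<rho>"
    have "((\<lambda>\<beta>. complex_of_real (c \<beta> * mpow (y - x) \<beta>)) has_sum of_real (f y)) UNIV"
      using c[of y] y \<open>\<rho> < r\<close> by (intro has_sum_of_real) (simp add: mpow_def)
    then have "((\<lambda>\<beta>. complex_of_real (c \<beta>) * mpow (cvec y - cvec x) \<beta>) has_sum of_real (f y)) UNIV"
      by (simp add: mpow_cvec flip: cvec_diff)
    then show "pseries (\<lambda>\<beta>. complex_of_real (c \<beta>)) (cvec y - cvec x) = complex_of_real (f y)"
      unfolding pseries_def by (rule infsumI)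
  qed (rule \<rho>)
qed

lemma analytic_at_pt_imp_real_analytic:
  fixes f :: "real^'n \<Rightarrow> real"
  assumes V: "open V" and "\<And>x. x \<in> V \<Longrightarrow> analytic_at_pt f x"
  shows "real_analytic_on V f"
  unfolding real_analytic_on_def
proof
  fix x assume x: "x \<in> V"
  obtain F \<delta> where F: "\<delta> > 0" "cdiff (ball (cvec x) \<delta>) F" "\<And>y. y \<in> ball x \<delta> \<Longrightarrow> F (cvec y) = of_real (f y)"
    using assms(2)[OF x] unfolding analytic_at_pt_def by blast
  obtain c \<rho> where c: "\<rho> > 0" "conv_at c \<rho>" "\<And>z. z \<in> polydisc \<rho> \<Longrightarrow> F (cvec x + z) = pseries c z"
    using cdiff_expansion[OF F(2,1)] by blast
  obtain e where e: "e > 0" "ball x e \<subseteq> V" using V x open_contains_ball by blast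
  let ?r = "min e (min \<delta> \<rho>)"
  \<comment> \<open>At real points the monomials and the sum are real, so the real parts of the
    complex coefficients represent f.\<close>
  have "((\<lambda>\<beta>. Re (c \<beta>) * (\<Prod>i\<in>UNIV. (y $ i - x $ i) ^ \<beta> i)) has_sum f y) UNIV" if y: "y \<in> ball x ?r" for y
  proof -
    have "cvec (y - x) \<in> ball 0 \<rho>" using y by (simp add: dist_norm norm_minus_commute)
    then have pd: "cvec (y - x) \<in> polydisc \<rho>" using ball_in_polydisc by blast
    then have "((\<lambda>\<beta>. c \<beta> * mpow (cvec (y - x)) \<beta>) has_sum pseries c (cvec (y - x))) UNIV"
      by (intro pseries_has_sum[OF c(2)]) (auto simp: polydisc_def less_imp_le)
    also have "pseries c (cvec (y - x)) = of_real (f y)"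
      using c(3)[OF pd] F(3)[of y] y by (simp add: cvec_diff)
    finally have "((\<lambda>\<beta>. Re (c \<beta> * mpow (cvec (y - x)) \<beta>)) has_sum Re (of_real (f y))) UNIV"
      by (rule has_sum_Re)
    then show ?thesis by (simp add: mpow_cvec) (simp add: mpow_def)
  qed
  then show "\<exists>r>0. ball x r \<subseteq> V \<and> (\<exists>c. \<forall>y\<in>ball x r. ((\<lambda>\<beta>. c \<beta> * (\<Prod>i\<in>UNIV. (y $ i - x $ i) ^ \<beta> i)) has_sum f y) UNIV)"
    using e F(1) c(1) by (intro exI[of _ ?r] conjI exI[of _ "\<lambda>\<beta>. Re (c \<beta>)"]) auto
qed

lemma has_derivative_vec:
  fixes H :: "'a::real_normed_vector \<Rightarrow> 'b::euclidean_space^'n"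
  assumes "\<And>i. ((\<lambda>z. H z $ i) has_derivative D i) net"
  shows "(H has_derivative (\<lambda>v. \<chi> i. D i v)) net"
proof -
  have lin: "bounded_linear (\<lambda>h::'b. axis i h :: 'b^'n)" for i
    by (rule linear_conv_bounded_linear[THEN iffD1], rule linearI) (auto simp: axis_def vec_eq_iff)
  have dec: "(\<Sum>i\<in>UNIV. axis i (w i)) = (\<chi> i. w i)" for w :: "'n \<Rightarrow> 'b"
    by (simp add: vec_eq_iff axis_def)
  have "((\<lambda>z. \<Sum>i\<in>UNIV. axis i (H z $ i)) has_derivative (\<lambda>v. \<Sum>i\<in>UNIV. axis i (D i v))) net"
    by (intro has_derivative_sum bounded_linear.has_derivative[OF lin] assms)
  then show ?thesis unfolding dec by simp
qed

text \<open>The inverse function theorem freed from bounded linear function objects: in finite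
  dimensions an injective derivative has a left inverse, and continuity in the operator norm follows
  from continuity on basis vectors.\<close>

lemma inverse_function:
  fixes f :: "'a::euclidean_space \<Rightarrow> 'a"
  assumes U: "open U" "x0 \<in> U" and der: "\<And>x. x \<in> U \<Longrightarrow> (f has_derivative f' x) (at x)"
    and cont: "\<And>b. b \<in> Basis \<Longrightarrow> continuous_on U (\<lambda>x. f' x b)"
    and inj: "\<And>v. f' x0 v = 0 \<Longrightarrow> v = 0"
  obtains U' V g where "open U'" "U' \<subseteq> U" "x0 \<in> U'" "open V" "f x0 \<in> V" "homeomorphism U' V f g"
    "\<And>y. y \<in> V \<Longrightarrow> (g has_derivative inv (f' (g y))) (at y)" "\<And>y. y \<in> V \<Longrightarrow> bij (f' (g y))"
proof -
  define F where "F x = Blinfun (f' x)" for x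
  have F: "blinfun_apply (F x) = f' x" if "x \<in> U" for x
    unfolding F_def using der[OF that] by (intro bounded_linear_Blinfun_apply has_derivative_bounded_linear)
  have cF: "continuous_on U F"
  proof (rule continuous_on_blinfun_componentwise)
    fix b :: 'a assume "b \<in> Basis"
    from cont[OF this] show "continuous_on U (\<lambda>x. blinfun_apply (F x) b)"
      by (simp add: F cong: continuous_on_cong)
  qed
  have lin: "linear (f' x0)" using der[OF U(2)] by (rule has_derivative_linear)
  have "inj (f' x0)" using lin inj by (simp add: linear_injective_0)
  then obtain h where h: "linear h" "h \<circ> f' x0 = id"
    using linear_injective_left_inverse[OF lin] by blast
  have "Blinfun h o\<^sub>L F x0 = id_blinfun"
    using h F[OF U(2)]
    by (intro blinfun_eqI) (simp add: bounded_linear_Blinfun_apply linear_conv_bounded_linear fun_eq_iff)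
  from inverse_function_theorem[OF U(1) _ cF U(2) this] F der
  obtain U' V g g' where g: "open U'" "U' \<subseteq> U" "x0 \<in> U'" "open V" "f x0 \<in> V" "homeomorphism U' V f g"
    "\<And>y. y \<in> V \<Longrightarrow> (g has_derivative (g' y)) (at y)"
    "\<And>y. y \<in> V \<Longrightarrow> g' y = inv (blinfun_apply (F (g y)))"
    "\<And>y. y \<in> V \<Longrightarrow> bij (blinfun_apply (F (g y)))"
    by metis
  have "g y \<in> U" if "y \<in> V" for y using g(2,6) that by (auto simp: homeomorphism_def)
  then show ?thesis using g F by (intro that[of U' V g]) auto
qed

section \<open>Algebra of complex differentiable and of real analytic functions\<close>

lemma cdiff_const: "cdiff U (\<lambda>z. c)"
  unfolding cdiff_def by (intro ballI exI[of _ "\<lambda>_. 0"]) auto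

lemma cdiff_nth: "cdiff U (\<lambda>z. z $ i)"
  unfolding cdiff_def
  by (intro ballI exI[of _ "\<lambda>v. v $ i"]) (auto intro!: bounded_linear_imp_has_derivative bounded_linear_vec_nth)

lemma cdiff_add: "cdiff U F \<Longrightarrow> cdiff U G \<Longrightarrow> cdiff U (\<lambda>z. F z + G z)"
  unfolding cdiff_def
proof
  fix z assume *: "\<forall>z\<in>U. \<exists>D. (F has_derivative D) (at z) \<and> (\<forall>c v. D (c *s v) = c * D v)"
    "\<forall>z\<in>U. \<exists>D. (G has_derivative D) (at z) \<and> (\<forall>c v. D (c *s v) = c * D v)" "z \<in> U"
  then obtain D E where "(F has_derivative D) (at z)" "\<forall>c v. D (c *s v) = c * D v"
    "(G has_derivative E) (at z)" "\<forall>c v. E (c *s v) = c * E v" by blast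
  then show "\<exists>D. ((\<lambda>z. F z + G z) has_derivative D) (at z) \<and> (\<forall>c v. D (c *s v) = c * D v)"
    by (intro exI[of _ "\<lambda>v. D v + E v"]) (auto intro!: has_derivative_add simp: algebra_simps)
qed

lemma cdiff_mult: "cdiff U F \<Longrightarrow> cdiff U G \<Longrightarrow> cdiff U (\<lambda>z. F z * G z)"
  unfolding cdiff_def
proof
  fix z assume *: "\<forall>z\<in>U. \<exists>D. (F has_derivative D) (at z) \<and> (\<forall>c v. D (c *s v) = c * D v)"
    "\<forall>z\<in>U. \<exists>D. (G has_derivative D) (at z) \<and> (\<forall>c v. D (c *s v) = c * D v)" "z \<in> U"
  then obtain D E where "(F has_derivative D) (at z)" "\<forall>c v. D (c *s v) = c * D v"
    "(G has_derivative E) (at z)" "\<forall>c v. E (c *s v) = c * E v" by blast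
  then show "\<exists>D. ((\<lambda>z. F z * G z) has_derivative D) (at z) \<and> (\<forall>c v. D (c *s v) = c * D v)"
    by (intro exI[of _ "\<lambda>v. F z * E v + D v * G z"] conjI has_derivative_mult) (auto simp: algebra_simps)
qed

lemma analytic_at_ptE:
  assumes "analytic_at_pt f x"
  obtains F \<delta> where "\<delta> > 0" "cdiff (ball (cvec x) \<delta>) F" "\<And>y. y \<in> ball x \<delta> \<Longrightarrow> F (cvec y) = of_real (f y)"
  using assms unfolding analytic_at_pt_def by blast

lemma analytic_at_ptI:
  assumes "\<delta> > 0" "cdiff (ball (cvec x) \<delta>) F" "\<And>y. y \<in> ball x \<delta> \<Longrightarrow> F (cvec y) = of_real (f y)"
  shows "analytic_at_pt f x"
  using assms unfolding analytic_at_pt_def by blast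

lemma analytic_at_pt_cong:
  assumes "open V" "x \<in> V" "\<And>y. y \<in> V \<Longrightarrow> f y = g y" "analytic_at_pt f x"
  shows "analytic_at_pt g x"
proof -
  obtain F \<delta> where F: "\<delta> > 0" "cdiff (ball (cvec x) \<delta>) F" "\<And>y. y \<in> ball x \<delta> \<Longrightarrow> F (cvec y) = of_real (f y)"
    using assms(4) by (rule analytic_at_ptE) blast
  obtain e where "e > 0" "ball x e \<subseteq> V" using assms(1,2) open_contains_ball by blast
  then show ?thesis
    using F assms(3) by (intro analytic_at_ptI[of "min \<delta> e" x F]) (auto intro: cdiff_subset)
qed

lemma analytic_at_pt_const: "analytic_at_pt (\<lambda>x. c) x"
  by (rule analytic_at_ptI[of 1 _ "\<lambda>z. of_real c"]) (auto simp: cdiff_const)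

lemma analytic_at_pt_nth: "analytic_at_pt (\<lambda>x. x $ i) x"
  by (rule analytic_at_ptI[of 1 _ "\<lambda>z. z $ i"]) (auto simp: cdiff_nth)

lemma analytic_at_pt_add:
  assumes "analytic_at_pt f x" "analytic_at_pt g x"
  shows "analytic_at_pt (\<lambda>x. f x + g x) x"
proof -
  obtain F \<delta> where F: "\<delta> > 0" "cdiff (ball (cvec x) \<delta>) F" "\<And>y. y \<in> ball x \<delta> \<Longrightarrow> F (cvec y) = of_real (f y)"
    using assms(1) by (rule analytic_at_ptE) blast
  obtain G \<epsilon> where G: "\<epsilon> > 0" "cdiff (ball (cvec x) \<epsilon>) G" "\<And>y. y \<in> ball x \<epsilon> \<Longrightarrow> G (cvec y) = of_real (g y)"
    using assms(2) by (rule analytic_at_ptE) blast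
  show ?thesis
    using F G by (intro analytic_at_ptI[of "min \<delta> \<epsilon>" _ "\<lambda>z. F z + G z"] cdiff_add) (auto intro: cdiff_subset)
qed

lemma analytic_at_pt_mult:
  assumes "analytic_at_pt f x" "analytic_at_pt g x"
  shows "analytic_at_pt (\<lambda>x. f x * g x) x"
proof -
  obtain F \<delta> where F: "\<delta> > 0" "cdiff (ball (cvec x) \<delta>) F" "\<And>y. y \<in> ball x \<delta> \<Longrightarrow> F (cvec y) = of_real (f y)"
    using assms(1) by (rule analytic_at_ptE) blast
  obtain G \<epsilon> where G: "\<epsilon> > 0" "cdiff (ball (cvec x) \<epsilon>) G" "\<And>y. y \<in> ball x \<epsilon> \<Longrightarrow> G (cvec y) = of_real (g y)"
    using assms(2) by (rule analytic_at_ptE) blast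
  show ?thesis
    using F G by (intro analytic_at_ptI[of "min \<delta> \<epsilon>" _ "\<lambda>z. F z * G z"] cdiff_mult) (auto intro: cdiff_subset)
qed

lemma analytic_at_pt_vec:
  fixes F :: "real^'m \<Rightarrow> real^'n"
  assumes "\<And>i. analytic_at_pt (\<lambda>x. F x $ i) x"
  obtains H :: "complex^'m \<Rightarrow> complex^'n" and \<delta>
  where "\<delta> > 0" "\<And>i. cdiff (ball (cvec x) \<delta>) (\<lambda>z. H z $ i)"
    "\<And>y. y \<in> ball x \<delta> \<Longrightarrow> H (cvec y) = cvec (F y)" "continuous_on (ball (cvec x) \<delta>) H"
proof -
  have "\<forall>i. \<exists>d G. d > 0 \<and> cdiff (ball (cvec x) d) G \<and> (\<forall>y\<in>ball x d. G (cvec y) = of_real (F y $ i))"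
    using assms unfolding analytic_at_pt_def by blast
  then obtain d G where G: "\<And>i. d i > 0" "\<And>i. cdiff (ball (cvec x) (d i)) (G i)"
    "\<And>i y. y \<in> ball x (d i) \<Longrightarrow> G i (cvec y) = of_real (F y $ i)"
    by metis
  define \<delta> where "\<delta> = Min (range d)"
  have \<delta>: "\<delta> > 0" "\<And>i. \<delta> \<le> d i" using G by (auto simp: \<delta>_def)
  have c: "cdiff (ball (cvec x) \<delta>) (G i)" for i
    using G(2)[of i] \<delta>(2)[of i] by (auto intro: cdiff_subset)
  show ?thesis
  proof (rule that[of \<delta> "\<lambda>z. \<chi> i. G i z"])
    show "cdiff (ball (cvec x) \<delta>) (\<lambda>z. (\<chi> i. G i z) $ i)" for i using c by simp
    show "(\<chi> i. G i (cvec y)) = cvec (F y)" if "y \<in> ball x \<delta>" for y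
    proof -
      have "y \<in> ball x (d i)" for i using that \<delta>(2)[of i] by auto
      then show ?thesis using G(3) by (simp add: vec_eq_iff)
    qed
    show "continuous_on (ball (cvec x) \<delta>) (\<lambda>z. \<chi> i. G i z)"
      by (intro continuous_on_vec_lambda cdiff_continuous c)
  qed (rule \<delta>)
qed

lemma analytic_at_pt_compose:
  fixes F :: "real^'m \<Rightarrow> real^'n"
  assumes f: "analytic_at_pt f (F x)" and F: "\<And>i. analytic_at_pt (\<lambda>x. F x $ i) x"
  shows "analytic_at_pt (\<lambda>x. f (F x)) x"
proof -
  obtain G e where G: "e > 0" "cdiff (ball (cvec (F x)) e) G" "\<And>y. y \<in> ball (F x) e \<Longrightarrow> G (cvec y) = of_real (f y)"
    using f by (rule analytic_at_ptE) blast
  obtain H :: "complex^'m \<Rightarrow> complex^'n" and d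
    where H: "d > 0" "\<And>i. cdiff (ball (cvec x) d) (\<lambda>z. H z $ i)"
    "\<And>y. y \<in> ball x d \<Longrightarrow> H (cvec y) = cvec (F y)" "continuous_on (ball (cvec x) d) H"
    by (rule analytic_at_pt_vec[OF F], rule that)
  have Hx: "H (cvec x) = cvec (F x)" using H by simp
  obtain d' where d': "d' > 0" "\<And>z. z \<in> ball (cvec x) d \<Longrightarrow> dist z (cvec x) < d' \<Longrightarrow> dist (H z) (cvec (F x)) < e"
    using H(4)[unfolded continuous_on_iff, rule_format, of "cvec x" e] H(1) G(1) by (auto simp: Hx)
  have inb: "H z \<in> ball (cvec (F x)) e" if "z \<in> ball (cvec x) (min d d')" for z
    using d'(2)[of z] that by (auto simp: dist_commute)
  show ?thesis
  proof (rule analytic_at_ptI[of "min d d'" _ "\<lambda>z. G (H z)"])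
    show "cdiff (ball (cvec x) (min d d')) (\<lambda>z. G (H z))" unfolding cdiff_def
    proof
      fix z assume z: "z \<in> ball (cvec x) (min d d')"
      then have "z \<in> ball (cvec x) d" by simp
      with H(2) have "\<forall>i. \<exists>D. ((\<lambda>z. H z $ i) has_derivative D) (at z) \<and> (\<forall>c v. D (c *s v) = c * D v)"
        unfolding cdiff_def by blast
      then obtain D where D: "\<And>i. ((\<lambda>z. H z $ i) has_derivative D i) (at z)" "\<And>i c v. D i (c *s v) = c * D i v"
        by metis
      obtain E where E: "(G has_derivative E) (at (H z))" "\<And>c v. E (c *s v) = c * E v"
        using G(2) inb[OF z] unfolding cdiff_def by blast
      have "(\<chi> i. D i (c *s v)) = c *s (\<chi> i. D i v)" for c v by (simp add: D(2) vec_eq_iff)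
      then show "\<exists>D. ((\<lambda>z. G (H z)) has_derivative D) (at z) \<and> (\<forall>c v. D (c *s v) = c * D v)"
        using diff_chain_at[OF has_derivative_vec[OF D(1)] E(1)] E(2)
        by (intro exI[of _ "\<lambda>v. E (\<chi> i. D i v)"]) (simp add: o_def)
    qed
    fix y assume y: "y \<in> ball x (min d d')"
    then have "cvec y \<in> ball (cvec x) (min d d')" by simp
    then have "cvec (F y) \<in> ball (cvec (F x)) e" using inb[of "cvec y"] H(3)[of y] y by simp
    then show "G (H (cvec y)) = complex_of_real (f (F y))"
      using G(3)[of "F y"] H(3)[of y] y by simp
  qed (use d' H in auto)
qed

text \<open>The complex partials of the extension F extend the real partials of f: F is real at real
  points, so the imaginary part of its derivative vanishes in real directions and the real part is
  the derivative of f.\<close>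

lemma analytic_at_pt_partials:
  fixes f :: "real^'n \<Rightarrow> real"
  assumes "analytic_at_pt f x"
  obtains F G \<epsilon> where "\<epsilon> > 0" "\<And>i. cdiff (ball (cvec x) \<epsilon>) (G i)"
    "\<And>z. z \<in> ball (cvec x) \<epsilon> \<Longrightarrow> (F has_derivative (\<lambda>v. \<Sum>i\<in>UNIV. v $ i * G i z)) (at z)"
    "\<And>y. y \<in> ball x \<epsilon> \<Longrightarrow> F (cvec y) = of_real (f y)"
    "\<And>y. y \<in> ball x \<epsilon> \<Longrightarrow> f differentiable at y"
    "\<And>i y. y \<in> ball x \<epsilon> \<Longrightarrow> G i (cvec y) = of_real (pd i f y)"
proof -
  obtain F \<delta> where F: "\<delta> > 0" "cdiff (ball (cvec x) \<delta>) F" "\<And>y. y \<in> ball x \<delta> \<Longrightarrow> F (cvec y) = of_real (f y)"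
    using assms by (rule analytic_at_ptE) blast
  obtain G \<epsilon> where G: "\<epsilon> > 0" "\<epsilon> \<le> \<delta>" "\<And>i. cdiff (ball (cvec x) \<epsilon>) (G i)"
    "\<And>z. z \<in> ball (cvec x) \<epsilon> \<Longrightarrow> (F has_derivative (\<lambda>v. \<Sum>i\<in>UNIV. v $ i * G i z)) (at z)"
    by (rule cdiff_partials[OF F(2,1)], rule that)
  have der: "((\<lambda>y. F (cvec y)) has_derivative (\<lambda>v. \<Sum>i\<in>UNIV. cvec v $ i * G i (cvec y))) (at y)"
    if "y \<in> ball x \<epsilon>" for y
    using diff_chain_at[OF bounded_linear_imp_has_derivative[OF bounded_linear_cvec] G(4)[of "cvec y"]] that
    by (simp add: o_def)
  have re: "(f has_derivative (\<lambda>v. Re (\<Sum>i\<in>UNIV. cvec v $ i * G i (cvec y)))) (at y)"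
    if y: "y \<in> ball x \<epsilon>" for y
  proof -
    have "((\<lambda>y. Re (F (cvec y))) has_derivative (\<lambda>v. Re (\<Sum>i\<in>UNIV. cvec v $ i * G i (cvec y)))) (at y)"
      by (rule bounded_linear.has_derivative[OF bounded_linear_Re der[OF y]])
    then show ?thesis
      by (rule has_derivative_transform_within_open[OF _ open_ball y]) (use F(3) G(2) in auto)
  qed
  have im: "Im (\<Sum>i\<in>UNIV. cvec v $ i * G i (cvec y)) = 0" if y: "y \<in> ball x \<epsilon>" for y v
  proof -
    have "((\<lambda>y. Im (F (cvec y))) has_derivative (\<lambda>v. Im (\<Sum>i\<in>UNIV. cvec v $ i * G i (cvec y)))) (at y)"
      by (rule bounded_linear.has_derivative[OF bounded_linear_Im der[OF y]])
    then have "((\<lambda>y. 0) has_derivative (\<lambda>v. Im (\<Sum>i\<in>UNIV. cvec v $ i * G i (cvec y)))) (at y)"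
      by (rule has_derivative_transform_within_open[OF _ open_ball y]) (use F(3) G(2) in auto)
    from has_derivative_unique[OF this has_derivative_const] show ?thesis by (rule fun_cong)
  qed
  have ax: "(\<Sum>j\<in>UNIV. cvec (axis i 1) $ j * G j (cvec y)) = G i (cvec y)" for i y
    by (simp add: axis_def if_distrib[of of_real] if_distrib[of "\<lambda>c. c * _"] cong: if_cong)
  have Gre: "G i (cvec y) = of_real (pd i f y)" if y: "y \<in> ball x \<epsilon>" for i y
    using im[OF y, of "axis i 1"] pd_eqI[OF re[OF y], of i] unfolding ax by (simp add: complex_eq_iff)
  show ?thesis
  proof (rule that[OF G(1,3,4)])
    show "f differentiable at y" if "y \<in> ball x \<epsilon>" for y using re[OF that] by (auto simp: differentiable_def)
  qed (use F(3) G(2) Gre in auto)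
qed

lemma analytic_at_pt_pd:
  assumes "analytic_at_pt f x"
  shows "f differentiable at x" "analytic_at_pt (pd i f) x"
proof -
  obtain F G \<epsilon> where *: "\<epsilon> > 0" "\<And>i. cdiff (ball (cvec x) \<epsilon>) (G i)"
    "\<And>z. z \<in> ball (cvec x) \<epsilon> \<Longrightarrow> (F has_derivative (\<lambda>v. \<Sum>i\<in>UNIV. v $ i * G i z)) (at z)"
    "\<And>y. y \<in> ball x \<epsilon> \<Longrightarrow> F (cvec y) = of_real (f y)"
    "\<And>y. y \<in> ball x \<epsilon> \<Longrightarrow> f differentiable at y"
    "\<And>i y. y \<in> ball x \<epsilon> \<Longrightarrow> G i (cvec y) = of_real (pd i f y)"
    by (rule analytic_at_pt_partials[OF assms], rule that)
  show "f differentiable at x" using * by simp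
  show "analytic_at_pt (pd i f) x" using * by (intro analytic_at_ptI[of \<epsilon> x "G i"]) auto
qed

text \<open>The extension \<open>HH\<close> of F has the complexification of DF as derivative at the
  real point, so it has a local inverse W with complex linear derivative; as \<open>HH\<close> is
  injective near that point, W restricts to G on real points.\<close>

lemma analytic_at_pt_inverse:
  fixes F G :: "real^'n \<Rightarrow> real^'n"
  assumes V: "open V" "y0 \<in> V" and FG: "\<And>y. y \<in> V \<Longrightarrow> F (G y) = y"
    and F: "\<And>i. analytic_at_pt (\<lambda>x. F x $ i) (G y0)"
    and G: "\<And>i. (\<lambda>y. G y $ i) differentiable at y0"
  shows "analytic_at_pt (\<lambda>y. G y $ i) y0"
proof -
  let ?x = "G y0"
  define Q where "Q i d H P \<longleftrightarrow> d > 0 \<and> (\<forall>j. cdiff (ball (cvec ?x) d) (P j)) \<and>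
      (\<forall>z\<in>ball (cvec ?x) d. (H has_derivative (\<lambda>v. \<Sum>j\<in>UNIV. v $ j * P j z)) (at z)) \<and>
      (\<forall>y\<in>ball ?x d. H (cvec y) = of_real (F y $ i)) \<and>
      (\<lambda>x. F x $ i) differentiable at ?x \<and> (\<forall>j. P j (cvec ?x) = of_real (pd j (\<lambda>x. F x $ i) ?x))" for i d H P
  have "\<forall>i. \<exists>d H P. Q i d H P"
  proof
    fix i
    obtain H P d where *: "d > 0" "\<And>i. cdiff (ball (cvec ?x) d) (P i)"
      "\<And>z. z \<in> ball (cvec ?x) d \<Longrightarrow> (H has_derivative (\<lambda>v. \<Sum>i\<in>UNIV. v $ i * P i z)) (at z)"
      "\<And>y. y \<in> ball ?x d \<Longrightarrow> H (cvec y) = of_real (F y $ i)"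
      "\<And>y. y \<in> ball ?x d \<Longrightarrow> (\<lambda>x. F x $ i) differentiable at y"
      "\<And>j y. y \<in> ball ?x d \<Longrightarrow> P j (cvec y) = of_real (pd j (\<lambda>x. F x $ i) y)"
      by (rule analytic_at_pt_partials[OF F[of i]], rule that)
    show "\<exists>d H P. Q i d H P" unfolding Q_def
      by (rule exI[of _ d], rule exI[of _ H], rule exI[of _ P], intro conjI allI ballI) (use * in auto)
  qed
  then obtain d H P where Q: "\<And>i. Q i (d i) (H i) (P i)" by metis
  have d: "\<And>i. d i > 0" and P: "\<And>i j. cdiff (ball (cvec ?x) (d i)) (P i j)"
    and H: "\<And>i z. z \<in> ball (cvec ?x) (d i) \<Longrightarrow> (H i has_derivative (\<lambda>v. \<Sum>j\<in>UNIV. v $ j * P i j z)) (at z)"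
    and HF: "\<And>i y. y \<in> ball ?x (d i) \<Longrightarrow> H i (cvec y) = of_real (F y $ i)"
    and dF: "\<And>i. (\<lambda>x. F x $ i) differentiable at ?x"
    and PF: "\<And>i j. P i j (cvec ?x) = of_real (pd j (\<lambda>x. F x $ i) ?x)"
    using Q unfolding Q_def by blast+
  define \<delta> where "\<delta> = Min (range d)"
  have \<delta>: "\<delta> > 0" "\<And>i. \<delta> \<le> d i" using d by (auto simp: \<delta>_def)
  let ?U = "ball (cvec ?x) \<delta>"
  have sub: "?U \<subseteq> ball (cvec ?x) (d i)" for i using \<delta>(2)[of i] by auto
  define HH where "HH z = (\<chi> i. H i z)" for z
  define D where "D z v = (\<chi> i. \<Sum>j\<in>UNIV. v $ j * P i j z)" for z v
  have derH: "(HH has_derivative D z) (at z)" if "z \<in> ?U" for z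
    unfolding D_def HH_def by (rule has_derivative_vec) (simp, rule H[OF subsetD[OF sub that]])
  have HHF: "HH (cvec y) = cvec (F y)" if "y \<in> ball ?x \<delta>" for y
  proof -
    have "y \<in> ball ?x (d i)" for i using that \<delta>(2)[of i] by auto
    then show ?thesis using HF by (simp add: HH_def vec_eq_iff)
  qed
  have Dlin: "D z (c *s v) = c *s D z v" for z c v
    by (simp add: D_def vec_eq_iff sum_distrib_left mult_ac)
  have FV: "((\<lambda>y. F (G y)) has_derivative (\<lambda>v. v)) (at y0)"
    by (rule has_derivative_transform_within_open[OF has_derivative_ident V]) (simp add: FG)
  have dG: "(G has_derivative (\<lambda>v. \<chi> i. grad (\<lambda>x. G x $ i) y0 \<bullet> v)) (at y0)"
    by (rule has_derivative_vec_grad[OF G])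
  define DF where "DF v = (\<chi> i. grad (\<lambda>x. F x $ i) ?x \<bullet> v)" for v
  have DF: "(F has_derivative DF) (at ?x)" unfolding DF_def by (rule has_derivative_vec_grad[OF dF])
  from diff_chain_at[OF dG DF] FV have comp: "DF \<circ> (\<lambda>v. \<chi> i. grad (\<lambda>x. G x $ i) y0 \<bullet> v) = (\<lambda>v. v)"
    unfolding o_def using has_derivative_unique by blast
  have linDF: "linear DF" using DF by (rule has_derivative_linear)
  \<comment> \<open>Differentiating F (G y) = y gives only a right inverse of DF; equal finite
    dimensions turn surjectivity into injectivity.\<close>
  have "surj DF" using comp by (metis comp_eq_dest_lhs surjI)
  then have injDF: "inj DF" using linDF linear_surjective_imp_injective by blast
  have DF0: "v = 0" if "DF v = 0" for v
    using linear_injective_0[OF linDF] injDF that by blast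
  \<comment> \<open>The matrix of the derivative is real here, so the real and imaginary parts of a
    complex kernel vector lie in the kernel of DF.\<close>
  have D0: "v = 0" if v: "D (cvec ?x) v = 0" for v
  proof -
    have *: "(\<Sum>j\<in>UNIV. v $ j * of_real (pd j (\<lambda>x. F x $ i) ?x)) = 0" for i
      using v by (simp add: D_def vec_eq_iff PF)
    have "DF (\<chi> j. Re (v $ j)) = 0"
      using arg_cong[OF *, of Re] by (simp add: DF_def vec_eq_iff inner_vec_def mult.commute)
    moreover have "DF (\<chi> j. Im (v $ j)) = 0"
      using arg_cong[OF *, of Im] by (simp add: DF_def vec_eq_iff inner_vec_def mult.commute)
    ultimately have "(\<chi> j. Re (v $ j)) = 0" "(\<chi> j. Im (v $ j)) = 0" using DF0 by blast+
    then show ?thesis by (simp add: vec_eq_iff complex_eq_iff)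
  qed
  have cD: "continuous_on ?U (\<lambda>z. D z b)" for b
    unfolding D_def
    by (intro continuous_on_vec_lambda continuous_on_sum continuous_on_mult continuous_on_const
        continuous_on_subset[OF cdiff_continuous[OF P] sub])
  have xU: "cvec ?x \<in> ?U" using \<delta> by simp
  have "\<exists>U' V' W. open U' \<and> U' \<subseteq> ?U \<and> cvec ?x \<in> U' \<and> open V' \<and> HH (cvec ?x) \<in> V' \<and> homeomorphism U' V' HH W \<and>
    (\<forall>y\<in>V'. (W has_derivative inv (D (W y))) (at y)) \<and> (\<forall>y\<in>V'. bij (D (W y)))"
  proof (rule inverse_function[of ?U "cvec ?x" HH D])
    fix U' V' W
    assume "open U'" "U' \<subseteq> ?U" "cvec ?x \<in> U'" "open V'" "HH (cvec ?x) \<in> V'" "homeomorphism U' V' HH W"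
    "\<And>y. y \<in> V' \<Longrightarrow> (W has_derivative inv (D (W y))) (at y)" "\<And>y. y \<in> V' \<Longrightarrow> bij (D (W y))"
    then show ?thesis by blast
  qed (use xU derH cD D0 in auto)
  then obtain U' V' W where W: "open U'" "U' \<subseteq> ?U" "cvec ?x \<in> U'" "open V'" "HH (cvec ?x) \<in> V'" "homeomorphism U' V' HH W"
    "\<And>y. y \<in> V' \<Longrightarrow> (W has_derivative inv (D (W y))) (at y)" "\<And>y. y \<in> V' \<Longrightarrow> bij (D (W y))"
    by blast
  have "HH (cvec ?x) = cvec y0" using HHF[of ?x] \<delta> FG[OF V(2)] by simp
  with W obtain e where e: "e > 0" "ball (cvec y0) e \<subseteq> V'" by (metis open_contains_ball)
  have "isCont G y0" using dG has_derivative_continuous by blast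
  then have "isCont (\<lambda>y. cvec (G y)) y0"
    by (intro continuous_intros bounded_linear.isCont[OF bounded_linear_cvec])
  then have "\<forall>\<^sub>F y in nhds y0. cvec (G y) \<in> U'"
    using W(1,3) by (simp add: isCont_def eventually_nhds_conv_at topological_tendstoD tendsto_def)
  moreover have "\<forall>\<^sub>F y in nhds y0. y \<in> V" using V by (rule eventually_nhds_in_open)
  ultimately have "\<forall>\<^sub>F y in nhds y0. cvec (G y) \<in> U' \<and> y \<in> V" by (rule eventually_conj)
  then obtain e' where e': "e' > 0" "\<And>y. dist y y0 < e' \<Longrightarrow> cvec (G y) \<in> U' \<and> y \<in> V"
    unfolding eventually_nhds_metric by blast
  show ?thesis
  proof (rule analytic_at_ptI[of "min e e'" _ "\<lambda>z. W z $ i"])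
    show "cdiff (ball (cvec y0) (min e e')) (\<lambda>z. W z $ i)" unfolding cdiff_def
    proof
      fix z assume "z \<in> ball (cvec y0) (min e e')"
      then have z: "z \<in> V'" using e by auto
      \<comment> \<open>The inverse of a bijective complex linear map is complex linear; the real
        inverse function theorem by itself yields only real linearity.\<close>
      have "inv (D (W z)) (c *s v) = c *s inv (D (W z)) v" for c v
      proof -
        have "D (W z) (c *s inv (D (W z)) v) = c *s v"
          using bij_is_surj[OF W(8)[OF z]] by (simp add: Dlin surj_f_inv_f)
        then show ?thesis using inv_f_f[OF bij_is_inj[OF W(8)[OF z]], of "c *s inv (D (W z)) v"] by simp
      qed
      then show "\<exists>D. ((\<lambda>z. W z $ i) has_derivative D) (at z) \<and> (\<forall>c v. D (c *s v) = c * D v)"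
        using bounded_linear.has_derivative[OF bounded_linear_vec_nth W(7)[OF z], of i]
        by (intro exI[of _ "\<lambda>v. inv (D (W z)) v $ i"]) auto
    qed
    fix y assume "y \<in> ball y0 (min e e')"
    then have y: "cvec (G y) \<in> U'" "y \<in> V" using e'(2)[of y] by (auto simp: dist_commute)
    then have "G y \<in> ball ?x \<delta>" using W(2) by auto
    from HHF[OF this] FG[OF y(2)] have "HH (cvec (G y)) = cvec y" by simp
    then have "W (cvec y) = cvec (G y)" using W(6) y(1) by (metis homeomorphism_apply1)
    then show "W (cvec y) $ i = complex_of_real (G y $ i)" by simp
  qed (use e e' in auto)
qed

section \<open>Composition and inverse functions in all regularity classes\<close>

text \<open>The localised version of \<open>reg_on\<close> (Hoelder bounds only near each point, analyticity through a
  holomorphic extension), which unlike \<open>reg_on\<close> is stable under composition and inversion.\<close>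
definition lreg :: "smoothness \<Rightarrow> real \<Rightarrow> (real^'n) set \<Rightarrow> (real^'n \<Rightarrow> real) \<Rightarrow> bool" where
  "lreg \<kappa> \<alpha> V f \<longleftrightarrow> (case \<kappa> of Fin k \<Rightarrow> creg k \<alpha> V f | Infty \<Rightarrow> \<forall>k. creg k 0 V f
     | Omega \<Rightarrow> \<forall>x\<in>V. analytic_at_pt f x)"

lemma lreg_simps [simp]:
  "lreg (Fin k) \<alpha> V f \<longleftrightarrow> creg k \<alpha> V f"
  "lreg Infty \<alpha> V f \<longleftrightarrow> (\<forall>k. creg k 0 V f)"
  "lreg Omega \<alpha> V f \<longleftrightarrow> (\<forall>x\<in>V. analytic_at_pt f x)"
  by (auto simp: lreg_def)

text \<open>The regularity class of the gradient; \<open>Fin 0\<close> is sent to itself.\<close>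
fun spred :: "smoothness \<Rightarrow> smoothness" where
  "spred (Fin k) = Fin (k - 1)" | "spred Infty = Infty" | "spred Omega = Omega"

lemma lreg_cong:
  assumes "open V" "\<And>x. x \<in> V \<Longrightarrow> f x = g x" "lreg \<kappa> \<alpha> V f"
  shows "lreg \<kappa> \<alpha> V g"
proof (cases \<kappa>)
  case (Fin k) then show ?thesis using creg_cong[OF assms(1,2)] assms(3) by simp
next
  case Infty then show ?thesis using creg_cong[OF assms(1,2)] assms(3) by simp
next
  case Omega then show ?thesis using analytic_at_pt_cong[OF assms(1) _ assms(2)] assms(3) by simp
qed

lemma lreg_subset: "lreg \<kappa> \<alpha> V f \<Longrightarrow> U \<subseteq> V \<Longrightarrow> lreg \<kappa> \<alpha> U f"
  by (cases \<kappa>) (auto intro: creg_subset)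

lemma lreg_const: "lreg \<kappa> \<alpha> V (\<lambda>x. c)"
  by (cases \<kappa>) (auto intro: creg_const analytic_at_pt_const)

lemma lreg_nth: "\<alpha> \<le> 1 \<Longrightarrow> lreg \<kappa> \<alpha> V (\<lambda>x. x $ i)"
  by (cases \<kappa>) (auto intro: creg_nth analytic_at_pt_nth)

lemma lreg_add: "open V \<Longrightarrow> lreg \<kappa> \<alpha> V f \<Longrightarrow> lreg \<kappa> \<alpha> V g \<Longrightarrow> lreg \<kappa> \<alpha> V (\<lambda>x. f x + g x)"
  by (cases \<kappa>) (auto intro: creg_add analytic_at_pt_add)

lemma lreg_mult: "open V \<Longrightarrow> \<alpha> \<le> 1 \<Longrightarrow> lreg \<kappa> \<alpha> V f \<Longrightarrow> lreg \<kappa> \<alpha> V g \<Longrightarrow> lreg \<kappa> \<alpha> V (\<lambda>x. f x * g x)"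
  by (cases \<kappa>) (auto intro: creg_mult analytic_at_pt_mult)

lemma lreg_diff:
  assumes "open V" "\<alpha> \<le> 1" "lreg \<kappa> \<alpha> V f" "lreg \<kappa> \<alpha> V g"
  shows "lreg \<kappa> \<alpha> V (\<lambda>x. f x - g x)"
  using lreg_add[OF assms(1,3) lreg_mult[OF assms(1,2) lreg_const[of _ _ _ "-1"] assms(4)]] by simp

lemma lreg_sum:
  assumes "open V" "\<And>i. i \<in> I \<Longrightarrow> lreg \<kappa> \<alpha> V (f i)"
  shows "lreg \<kappa> \<alpha> V (\<lambda>x. \<Sum>i\<in>I. f i x)"
  using assms(2)
proof (induction I rule: infinite_finite_induct)
  case (insert i I)
  then show ?case by (simp add: lreg_add[OF assms(1)])
qed (auto simp: lreg_const)

lemma creg_Suc_holder: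
  assumes "open V" "creg (Suc k) \<alpha> V f"
  shows "loc_holder 1 V f"
  using assms by (intro C1_loc_lipschitz) (auto intro: creg_continuous)

lemma lreg_pd:
  assumes "open V" "\<kappa> \<noteq> Fin 0" "lreg \<kappa> \<alpha> V f"
  shows "f differentiable_on V" "lreg (spred \<kappa>) \<alpha> V (pd i f)"
proof -
  have "f differentiable_on V \<and> lreg (spred \<kappa>) \<alpha> V (pd i f)"
  proof (cases \<kappa>)
    case (Fin k)
    then obtain m where "k = Suc m" using assms(2) by (cases k) auto
    then show ?thesis using Fin assms(3) by simp
  next
    case Infty
    then have "creg (Suc k) 0 V f" for k using assms(3) by (simp del: creg.simps)
    then show ?thesis using Infty by simp
  next
    case Omega
    then show ?thesis using assms
      by (auto simp: differentiable_on_open_at intro: analytic_at_pt_pd)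
  qed
  then show "f differentiable_on V" "lreg (spred \<kappa>) \<alpha> V (pd i f)" by auto
qed

lemma lreg_spred:
  assumes "open V" "\<alpha> \<le> 1" "lreg \<kappa> \<alpha> V f"
  shows "lreg (spred \<kappa>) \<alpha> V f"
proof (cases \<kappa>)
  case (Fin k)
  then show ?thesis using assms(3) creg_Suc_imp[OF assms(1,2), of "k - 1" \<alpha> f] by (cases k) auto
qed (use assms in auto)

text \<open>Used to win back the derivative lost by working with gradients. For
  \<open>Fin (Suc k)\<close> it is the recursion of \<open>creg\<close>; where \<open>spred\<close>
  fixes the class, the first regularity premise carries the conclusion.\<close>

lemma lreg_gain:
  assumes "open V" "lreg (spred \<kappa>) \<alpha> V f" "f differentiable_on V" "\<And>i. lreg (spred \<kappa>) \<alpha> V (pd i f)"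
  shows "lreg \<kappa> \<alpha> V f"
proof (cases \<kappa>)
  case (Fin k)
  then show ?thesis using assms by (cases k) auto
qed (use assms in auto)

lemma lreg_C1:
  assumes "open V" "\<kappa> \<noteq> Fin 0" "lreg \<kappa> \<alpha> V f"
  shows "lreg (Fin 1) 0 V f"
proof -
  have "continuous_on V (pd i f)" for i
  proof (cases \<kappa>)
    case Omega
    then have "pd i f differentiable_on V"
      using lreg_pd[OF assms(1), of Omega] assms(3) by (auto simp: differentiable_on_open_at[OF assms(1)] intro: analytic_at_pt_pd(1))
    then show ?thesis by (rule differentiable_imp_continuous_on)
  qed (use lreg_pd(2)[OF assms, of i] in \<open>auto intro: creg_continuous\<close>)
  then show ?thesis using lreg_pd(1)[OF assms] by simp
qed

lemma lreg_loc_holder: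
  assumes "open V" "\<kappa> \<noteq> Fin 0" "lreg \<kappa> \<alpha> V f"
  shows "loc_holder 1 V f"
  using lreg_C1[OF assms] creg_Suc_holder[OF assms(1), of 0 0 f] by simp

lemma lreg_C2:
  assumes "open V" "\<kappa> \<noteq> Fin 0" "\<kappa> \<noteq> Fin 1" "lreg \<kappa> \<alpha> V f"
  shows "lreg (Fin 2) 0 V f"
proof -
  have "spred \<kappa> \<noteq> Fin 0" using assms(2,3) by (cases \<kappa>) auto
  then have "lreg (Fin 1) 0 V (pd i f)" for i
    using lreg_C1[OF assms(1)] lreg_pd(2)[OF assms(1,2,4)] by blast
  then show ?thesis using lreg_pd(1)[OF assms(1,2,4)] by (simp add: numeral_2_eq_2)
qed

text \<open>Every class other than \<open>Fin 0\<close> consists of C^1 functions, which supplies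
  the Lipschitz bound on the inner map that Hoelder composition relies on.\<close>

lemma lreg_compose:
  fixes F :: "real^'m \<Rightarrow> real^'n"
  assumes "open V" "open U" "\<alpha> \<le> 1" "\<kappa> \<noteq> Fin 0" "lreg \<kappa> \<alpha> V f" "\<And>i. lreg \<kappa> \<alpha> U (\<lambda>x. F x $ i)" "F ` U \<subseteq> V"
  shows "lreg \<kappa> \<alpha> U (\<lambda>x. f (F x))"
proof -
  have h: "loc_holder 1 U (\<lambda>x. F x $ i)" for i using lreg_loc_holder[OF assms(2,4,6)] .
  show ?thesis
  proof (cases \<kappa>)
    case (Fin k)
    then show ?thesis using creg_compose[OF assms(1,2,3) _ _ h assms(7)] assms(5,6) by simp
  next
    case Infty
    then show ?thesis using creg_compose[OF assms(1,2) zero_le_one _ _ h assms(7)] assms(5,6) by simp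
  next
    case Omega
    have "analytic_at_pt (\<lambda>x. f (F x)) x" if "x \<in> U" for x
      by (rule analytic_at_pt_compose) (use Omega assms that in auto)
    then show ?thesis using Omega by simp
  qed
qed

text \<open>Bootstrapping: \<open>DG = (DF \<circ> G)\<^sup>-\<^sup>1\<close>, expressed by Cramer's rule, gains one derivative of \<open>G\<close> at a time.\<close>
lemma creg_inverse_function:
  fixes F G :: "real^'n \<Rightarrow> real^'n"
  assumes U: "open U" and V: "open V" and a: "\<alpha> \<le> 1" and GV: "G ` V \<subseteq> U" and FG: "\<And>y. y \<in> V \<Longrightarrow> F (G y) = y"
    and F: "\<And>i. creg (Suc k) \<alpha> U (\<lambda>x. F x $ i)" and G: "\<And>i. creg 1 0 V (\<lambda>y. G y $ i)"
  shows "creg (Suc k) \<alpha> V (\<lambda>y. G y $ i)"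
proof -
  have h: "loc_holder 1 V (\<lambda>x. G x $ i)" for i using creg_Suc_holder[OF V, of 0 0] G by simp
  have dF: "(\<lambda>x. F x $ i) differentiable at (G y)" if "y \<in> V" for i y
    using F[of i] GV that U by (auto simp: differentiable_on_open_at)
  have dG: "(\<lambda>y. G y $ i) differentiable at y" if "y \<in> V" for i y
    using G[of i] that V by (auto simp: differentiable_on_open_at)
  define A where "A y = (\<chi> i l. pd l (\<lambda>x. F x $ i) (G y))" for y
  have chain: "(\<Sum>l\<in>UNIV. A y $ i $ l * pd m (\<lambda>y. G y $ l) y) = axis m 1 $ i" if y: "y \<in> V" for y i m
  proof -
    have "(\<Sum>l\<in>UNIV. A y $ i $ l * pd m (\<lambda>y. G y $ l) y) = pd m (\<lambda>y. F (G y) $ i) y"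
      using pd_compose[of "\<lambda>x. F x $ i" G y m, OF dF[OF y] dG[OF y]] by (simp add: A_def)
    also have "\<dots> = pd m (\<lambda>y. y $ i) y" using FG by (intro pd_cong[OF V _ y]) simp
    finally show ?thesis by simp
  qed
  have Amul: "A y *v (\<chi> l. pd m (\<lambda>y. G y $ l) y) = axis m 1" if "y \<in> V" for y m
    using chain[OF that] by (simp add: matrix_vector_mult_def vec_eq_iff)
  have det: "det (A y) \<noteq> 0" if y: "y \<in> V" for y
  proof -
    have "A y ** (\<chi> l m. pd m (\<lambda>y. G y $ l) y) = mat 1"
      using chain[OF y] by (simp add: matrix_matrix_mult_def vec_eq_iff mat_def axis_def)
    then have "det (A y) * det (\<chi> l m. pd m (\<lambda>y. G y $ l) y) = 1" by (metis det_mul det_I)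
    then show ?thesis by auto
  qed
  have cr: "pd m (\<lambda>y. G y $ l) y = det (\<chi> i j. if j = l then axis m 1 $ i else A y $ i $ j) * inverse (det (A y))"
    if "y \<in> V" for y m l
    using cramer[OF det[OF that], THEN iffD1, OF Amul[OF that, of m]] by (simp add: vec_eq_iff divide_inverse)
  have "j \<le> Suc k \<longrightarrow> (\<forall>i. creg j \<alpha> V (\<lambda>y. G y $ i))" for j
  proof (induction j)
    case 0
    show ?case using creg_Suc_imp[OF V a, of 0 0] G by auto
  next
    case (Suc j)
    show ?case
    proof (intro impI allI)
      fix l assume j: "Suc j \<le> Suc k"
      then have Gj: "creg j \<alpha> V (\<lambda>y. G y $ i)" for i using Suc by simp
      have "creg (Suc j) \<alpha> U (\<lambda>x. F x $ i)" for i
        using j F[of i]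
      proof (induction rule: inc_induct)
        case (step n) then show ?case using creg_Suc_imp[OF U a] by blast
      qed
      then have "creg j \<alpha> U (pd l (\<lambda>x. F x $ i))" for i l by simp
      then have "creg j \<alpha> V (\<lambda>y. pd l (\<lambda>x. F x $ i) (G y))" for i l
        using creg_compose[OF U V a _ Gj h GV] by blast
      then have A: "creg j \<alpha> V (\<lambda>y. A y $ i $ l)" for i l by (simp add: A_def)
      have E: "creg j \<alpha> V (\<lambda>y. (\<chi> i j. if j = l then axis m 1 $ i else A y $ i $ j) $ i $ j')" for m i j'
        using A by (cases "j' = l") (auto intro: creg_const)
      have "creg j \<alpha> V (pd m (\<lambda>y. G y $ l))" for m
        by (rule creg_cong[OF V _ creg_mult[OF V a creg_det[OF V a E[of m]] creg_inverse[OF V a creg_det[OF V a A] det]]])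
           (simp_all add: cr)
      then show "creg (Suc j) \<alpha> V (\<lambda>y. G y $ l)" using G[of l] by simp
    qed
  qed
  then show ?thesis by blast
qed

text \<open>This concerns a given inverse that is already C^1, so it can also upgrade a map that was
  constructed earlier in a weaker class.\<close>

lemma lreg_inverse_function:
  fixes F G :: "real^'n \<Rightarrow> real^'n"
  assumes U: "open U" and V: "open V" and a: "\<alpha> \<le> 1" and k: "\<kappa> \<noteq> Fin 0"
    and GV: "G ` V \<subseteq> U" and FG: "\<And>y. y \<in> V \<Longrightarrow> F (G y) = y"
    and F: "\<And>i. lreg \<kappa> \<alpha> U (\<lambda>x. F x $ i)" and G: "\<And>i. lreg (Fin 1) 0 V (\<lambda>y. G y $ i)"
  shows "lreg \<kappa> \<alpha> V (\<lambda>y. G y $ i)"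
proof (cases \<kappa>)
  case (Fin m)
  then obtain k where "m = Suc k" using k by (cases m) auto
  then show ?thesis using creg_inverse_function[OF U V a GV FG, of k] F G Fin by (simp del: creg.simps)
next
  case Infty
  have "creg (Suc k) 0 V (\<lambda>y. G y $ i)" for k
    using creg_inverse_function[OF U V zero_le_one GV FG, of k] F G Infty by (simp del: creg.simps)
  then have "creg k 0 V (\<lambda>y. G y $ i)" for k using creg_Suc_imp[OF V zero_le_one] by blast
  then show ?thesis using Infty by simp
next
  case Omega
  have "analytic_at_pt (\<lambda>y. G y $ i) y" if y: "y \<in> V" for y
  proof (rule analytic_at_pt_inverse[of V y F G, OF V y FG])
    show "analytic_at_pt (\<lambda>x. F x $ i) (G y)" for i using F Omega GV y by auto
    show "(\<lambda>y. G y $ i) differentiable at y" for i using G[of i] V y by (auto simp: differentiable_on_open_at)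
  qed auto
  then show ?thesis using Omega by simp
qed

lemma lreg_has_derivative_vec:
  fixes F :: "real^'m \<Rightarrow> real^'n"
  assumes "open U" "\<kappa> \<noteq> Fin 0" "\<And>i. lreg \<kappa> \<alpha> U (\<lambda>x. F x $ i)" "x \<in> U"
  shows "(F has_derivative (\<lambda>v. \<chi> i. grad (\<lambda>x. F x $ i) x \<bullet> v)) (at x)"
  using lreg_pd(1)[OF assms(1-3)] assms(1,4)
  by (intro has_derivative_vec_grad) (auto simp: differentiable_on_open_at)

text \<open>The inverse function theorem delivers the derivative of G only as the pointwise inverse
  of DF. Cramer's rule turns its entries into continuous expressions, which makes G a C^1 map and
  starts the bootstrapping.\<close>

lemma lreg_local_inverse:
  fixes F :: "real^'n \<Rightarrow> real^'n"
  assumes U: "open U" "x0 \<in> U" and a: "\<alpha> \<le> 1" and k: "\<kappa> \<noteq> Fin 0" and F: "\<And>i. lreg \<kappa> \<alpha> U (\<lambda>x. F x $ i)"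
    and inj: "\<And>v. (\<chi> i. grad (\<lambda>x. F x $ i) x0 \<bullet> v) = 0 \<Longrightarrow> v = 0"
  obtains U' V and G :: "real^'n \<Rightarrow> real^'n" where "open U'" "U' \<subseteq> U" "x0 \<in> U'" "open V" "F x0 \<in> V" "homeomorphism U' V F G"
    "\<And>i. lreg \<kappa> \<alpha> V (\<lambda>y. G y $ i)"
proof -
  define D where "D x v = (\<chi> i. grad (\<lambda>x. F x $ i) x \<bullet> v)" for x v
  have der: "(F has_derivative D x) (at x)" if "x \<in> U" for x
    unfolding D_def by (rule lreg_has_derivative_vec[OF U(1) k F that])
  have F1: "lreg (Fin 1) 0 U (\<lambda>x. F x $ i)" for i by (rule lreg_C1[OF U(1) k F])
  have cD: "continuous_on U (\<lambda>x. D x b)" for b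
    unfolding D_def grad_def inner_vec_def using F1
    by (intro continuous_on_vec_lambda continuous_on_sum continuous_on_inner continuous_on_const) auto
  have "\<exists>U' V G. open U' \<and> U' \<subseteq> U \<and> x0 \<in> U' \<and> open V \<and> F x0 \<in> V \<and> homeomorphism U' V F G \<and>
    (\<forall>y\<in>V. (G has_derivative inv (D (G y))) (at y)) \<and> (\<forall>y\<in>V. bij (D (G y)))"
  proof (rule inverse_function[of U x0 F D])
    fix U' V W
    assume "open U'" "U' \<subseteq> U" "x0 \<in> U'" "open V" "F x0 \<in> V" "homeomorphism U' V F W"
    "\<And>y. y \<in> V \<Longrightarrow> (W has_derivative inv (D (W y))) (at y)" "\<And>y. y \<in> V \<Longrightarrow> bij (D (W y))"
    then show ?thesis by blast
  qed (use U der cD inj in \<open>auto simp: D_def\<close>)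
  then obtain U' V G where G: "open U'" "U' \<subseteq> U" "x0 \<in> U'" "open V" "F x0 \<in> V" "homeomorphism U' V F G"
    and dG: "\<And>y. y \<in> V \<Longrightarrow> (G has_derivative inv (D (G y))) (at y)" and bij: "\<And>y. y \<in> V \<Longrightarrow> bij (D (G y))"
    by blast
  have GV: "G ` V \<subseteq> U" using G(2,6) by (auto simp: homeomorphism_def)
  have cG: "continuous_on V G" using G(6) by (simp add: homeomorphism_def)
  have FG: "F (G y) = y" if "y \<in> V" for y using G(6) that by (simp add: homeomorphism_def)
  define A where "A y = matrix (D (G y))" for y
  have lin: "linear (D (G y))" if "y \<in> V" for y
    using der[of "G y"] GV that by (auto intro: has_derivative_linear)
  have Aij: "A y $ i $ j = pd j (\<lambda>x. F x $ i) (G y)" for y i j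
    by (simp add: A_def matrix_def D_def inner_axis)
  have cA: "continuous_on V (\<lambda>y. A y $ i $ j)" for i j
    unfolding Aij using F1[of i] by (intro continuous_on_compose2[OF _ cG GV]) auto
  have det: "det (A y) \<noteq> 0" if "y \<in> V" for y
    using bij[OF that] lin[OF that] by (simp add: A_def det_nz_iff_inj bij_is_inj)
  have pdG: "pd m (\<lambda>y. G y $ l) y = det (\<chi> i j. if j = l then axis m 1 $ i else A y $ i $ j) * inverse (det (A y))"
    if y: "y \<in> V" for y m l
  proof -
    have "((\<lambda>y. G y $ l) has_derivative (\<lambda>v. inv (D (G y)) v $ l)) (at y)"
      by (rule bounded_linear.has_derivative[OF bounded_linear_vec_nth dG[OF y]])
    from pd_eqI[OF this] have 1: "pd m (\<lambda>y. G y $ l) y = inv (D (G y)) (axis m 1) $ l" .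
    have "A y *v inv (D (G y)) (axis m 1) = axis m 1"
      using lin[OF y] bij[OF y] by (simp add: A_def matrix_works surj_f_inv_f bij_is_surj)
    from cramer[OF det[OF y], THEN iffD1, OF this] show ?thesis
      unfolding 1 by (simp add: vec_eq_iff divide_inverse)
  qed
  have cdet: "continuous_on V (\<lambda>y. det (M y))" if "\<And>i j. continuous_on V (\<lambda>y. M y $ i $ j)" for M :: "real^'n \<Rightarrow> real^'n^'n"
    unfolding det_def by (intro continuous_on_sum continuous_on_mult continuous_on_prod continuous_on_const that)
  have "lreg (Fin 1) 0 V (\<lambda>y. G y $ l)" for l
  proof -
    have "(\<lambda>y. G y $ l) differentiable_on V"
      unfolding differentiable_on_open_at[OF G(4)] differentiable_def
      using bounded_linear.has_derivative[OF bounded_linear_vec_nth dG] by blast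
    moreover have "continuous_on V (pd m (\<lambda>y. G y $ l))" for m
    proof -
      have "continuous_on V (\<lambda>y. det (\<chi> i j. if j = l then axis m 1 $ i else A y $ i $ j) * inverse (det (A y)))"
      proof (intro continuous_on_mult continuous_on_inverse cdet)
        show "continuous_on V (\<lambda>y. (\<chi> i j. if j = l then axis m 1 $ i else A y $ i $ j) $ i $ j)" for i j
          using cA by (cases "j = l") (auto simp: continuous_on_const)
      qed (use cA det in auto)
      then show ?thesis by (simp add: pdG cong: continuous_on_cong)
    qed
    ultimately show ?thesis by simp
  qed
  from lreg_inverse_function[OF U(1) G(4) a k GV FG F this] G show ?thesis by (intro that[of U' V G]) auto
qed

section \<open>Comparison with the regularity classes in which boundaries are described\<close>

lemma Ck_alpha_on_Suc: "Ck_alpha_on (Suc k) \<alpha> V f \<longleftrightarrow> f differentiable_on V \<and> (\<forall>i. Ck_alpha_on k \<alpha> V (pd i f))"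
  unfolding Ck_alpha_on_def Ck_on_Suc partials_Suc_pd by blast

lemma Ck_alpha_on_0: "Ck_alpha_on 0 \<alpha> V f \<longleftrightarrow> continuous_on V f \<and> (\<alpha> > 0 \<longrightarrow> holder_on \<alpha> V f)"
  by (simp add: Ck_alpha_on_def Ck_on_def)

lemma holder_on_subset: "holder_on \<alpha> V f \<Longrightarrow> U \<subseteq> V \<Longrightarrow> holder_on \<alpha> U f"
  unfolding holder_on_def by (meson subsetD)

lemma Ck_alpha_on_subset: "Ck_alpha_on k \<alpha> V f \<Longrightarrow> U \<subseteq> V \<Longrightarrow> Ck_alpha_on k \<alpha> U f"
  by (induction k arbitrary: f)
     (auto simp: Ck_alpha_on_0 Ck_alpha_on_Suc intro: continuous_on_subset differentiable_on_subset holder_on_subset)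

lemma Ck_alpha_on_imp_creg: "Ck_alpha_on k \<alpha> V f \<Longrightarrow> creg k \<alpha> V f"
  by (induction k arbitrary: f)
     (auto simp: Ck_alpha_on_0 Ck_alpha_on_Suc loc_holder_def intro!: exI[of _ "1::real"] intro: holder_on_subset)

text \<open>Only finitely many partial derivatives carry a Hoelder bound, so one ball around x
  serves all of them; the neighborhood has to shrink because the constants of \<open>creg\<close>
  are local.\<close>

lemma creg_imp_Ck_alpha_on:
  assumes "open V" "x \<in> V" "creg k \<alpha> V f"
  shows "\<exists>d>0. ball x d \<subseteq> V \<and> Ck_alpha_on k \<alpha> (ball x d) f"
  using assms(3)
proof (induction k arbitrary: f)
  case 0
  obtain e where e: "e > 0" "ball x e \<subseteq> V" using assms open_contains_ball by blast
  show ?case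
  proof (cases "\<alpha> > 0")
    case True
    then obtain d where d: "d > 0" "holder_on \<alpha> (ball x d \<inter> V) f"
      using 0 assms(2) by (auto simp: loc_holder_def)
    have "holder_on \<alpha> (ball x (min d e)) f" by (rule holder_on_subset[OF d(2)]) (use e in auto)
    moreover have "continuous_on (ball x (min d e)) f"
      by (rule continuous_on_subset[of V f]) (use 0 e in auto)
    ultimately show ?thesis using d e by (intro exI[of _ "min d e"]) (auto simp: Ck_alpha_on_0)
  next
    case False
    then show ?thesis using 0 e by (intro exI[of _ e]) (auto simp: Ck_alpha_on_0 intro: continuous_on_subset)
  qed
next
  case (Suc k)
  have "\<forall>i. \<exists>d>0. ball x d \<subseteq> V \<and> Ck_alpha_on k \<alpha> (ball x d) (pd i f)" using Suc by simp
  then obtain d where d: "\<And>i. d i > 0" "\<And>i. ball x (d i) \<subseteq> V" "\<And>i. Ck_alpha_on k \<alpha> (ball x (d i)) (pd i f)"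
    by metis
  define e where "e = Min (range d)"
  have e: "e > 0" "\<And>i. e \<le> d i" using d(1) by (auto simp: e_def)
  have sub: "ball x e \<subseteq> ball x (d i)" for i using e(2)[of i] by auto
  then have "ball x e \<subseteq> V" using d(2) by blast
  moreover have "Ck_alpha_on k \<alpha> (ball x e) (pd i f)" for i by (rule Ck_alpha_on_subset[OF d(3) sub])
  moreover have "f differentiable_on ball x e"
    using Suc.prems calculation(1) by (auto intro: differentiable_on_subset)
  ultimately show ?case using e(1) by (intro exI[of _ e]) (auto simp: Ck_alpha_on_Suc)
qed

lemma Ck_on_imp_creg: "Ck_on k V f \<Longrightarrow> creg k 0 V f"
  using Ck_alpha_on_imp_creg[of k 0 V f] by (simp add: Ck_alpha_on_def)

lemma creg_imp_Ck_on: "creg k 0 V f \<Longrightarrow> Ck_on k V f"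
  by (induction k arbitrary: f) (auto simp: Ck_on_Suc, simp add: Ck_on_def)

lemma reg_on_imp_lreg: "reg_on \<kappa> \<alpha> V f \<Longrightarrow> lreg \<kappa> \<alpha> V f"
  by (cases \<kappa>) (auto intro: Ck_alpha_on_imp_creg Ck_on_imp_creg real_analytic_imp_analytic_at_pt)

lemma lreg_imp_reg_on:
  assumes "open V" "x \<in> V" "lreg \<kappa> \<alpha> V f"
  shows "\<exists>d>0. ball x d \<subseteq> V \<and> reg_on \<kappa> \<alpha> (ball x d) f"
proof (cases \<kappa>)
  case (Fin k)
  then show ?thesis using creg_imp_Ck_alpha_on[OF assms(1,2)] assms(3) by simp
next
  case Infty
  obtain e where e: "e > 0" "ball x e \<subseteq> V" using assms open_contains_ball by blast
  have "Ck_on k (ball x e) f" for k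
    using creg_imp_Ck_on[OF creg_subset[OF _ e(2)]] Infty assms(3) by simp
  then show ?thesis using e Infty by (intro exI[of _ e]) simp
next
  case Omega
  obtain e where e: "e > 0" "ball x e \<subseteq> V" using assms open_contains_ball by blast
  then show ?thesis using Omega assms(3) by (auto intro!: exI[of _ e] analytic_at_pt_imp_real_analytic)
qed

abbreviation vreg :: "smoothness \<Rightarrow> real \<Rightarrow> (real^'m) set \<Rightarrow> (real^'m \<Rightarrow> real^'n) \<Rightarrow> bool" where
  "vreg \<kappa> \<alpha> V F \<equiv> \<forall>i. lreg \<kappa> \<alpha> V (\<lambda>x. F x $ i)"

lemma lreg_vec_inner:
  fixes F :: "real^'m \<Rightarrow> real^'n"
  assumes "open V" "\<alpha> \<le> 1" "\<And>i. lreg \<kappa> \<alpha> V (\<lambda>x. F x $ i)"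
  shows "lreg \<kappa> \<alpha> V (\<lambda>x. F x \<bullet> u)"
  unfolding inner_vec_def inner_real_def by (intro lreg_sum lreg_mult lreg_const assms)

lemma lreg_inner: "open V \<Longrightarrow> \<alpha> \<le> 1 \<Longrightarrow> lreg \<kappa> \<alpha> V (\<lambda>x. x \<bullet> u)"
  by (intro lreg_vec_inner lreg_nth)

lemma lreg_grad:
  assumes "open U" "\<kappa> \<noteq> Fin 0" "lreg \<kappa> \<alpha> U f" "z \<in> U"
  shows "(f has_derivative (\<lambda>v. grad f z \<bullet> v)) (at z)"
  using lreg_pd(1)[OF assms(1-3)] assms(1,4) by (intro has_derivative_grad) (auto simp: differentiable_on_open_at)

lemma lreg_grad_continuous:
  assumes "open U" "\<kappa> \<noteq> Fin 0" "lreg \<kappa> \<alpha> U f"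
  shows "continuous_on U (grad f)"
  using lreg_C1[OF assms] unfolding grad_def by (intro continuous_on_vec_lambda) auto

section \<open>Hessians\<close>

definition hess :: "(real^'n \<Rightarrow> real) \<Rightarrow> real^'n \<Rightarrow> real^'n \<Rightarrow> real^'n" where
  "hess f z v = (\<chi> i. grad (pd i f) z \<bullet> v)"

lemma lreg_hess:
  assumes "open U" "\<kappa> \<noteq> Fin 0" "\<kappa> \<noteq> Fin 1" "lreg \<kappa> \<alpha> U f" "z \<in> U"
  shows "(grad f has_derivative hess f z) (at z)"
proof -
  have "(\<lambda>x. grad f x $ i) differentiable at z" for i
    using lreg_C2[OF assms(1-4)] assms(1,5) by (auto simp: numeral_2_eq_2 differentiable_on_open_at)
  from has_derivative_vec_grad[OF this] show ?thesis
    unfolding hess_def by simp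
qed

lemma linear_hess: "linear (hess f z)"
  by (rule linearI) (auto simp: hess_def vec_eq_iff inner_add_right)

lemma has_derivative_radial_mvt:
  fixes f :: "real^'n \<Rightarrow> real"
  assumes der: "\<And>z. z \<in> ball p d \<Longrightarrow> (f has_derivative (\<lambda>v. grad f z \<bullet> v)) (at z)"
    and x: "x \<in> ball p d" and y: "x + v \<in> ball p d"
  shows "\<exists>s. 0 < s \<and> s < 1 \<and> f (x + v) - f x = grad f (x + s *\<^sub>R v) \<bullet> v"
proof -
  have inb: "x + s *\<^sub>R v \<in> ball p d" if "0 \<le> s" "s \<le> 1" for s
  proof -
    have "x + s *\<^sub>R v = (1 - s) *\<^sub>R x + s *\<^sub>R (x + v)" by (simp add: algebra_simps)
    then show ?thesis using convexD[OF convex_ball x y, of "1 - s" s] that by simp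
  qed
  have der': "((\<lambda>s. f (x + s *\<^sub>R v)) has_derivative (\<lambda>h. grad f (x + s *\<^sub>R v) \<bullet> (h *\<^sub>R v))) (at s)"
    if "0 \<le> s" "s \<le> 1" for s
  proof -
    have "((\<lambda>s. x + s *\<^sub>R v) has_derivative (\<lambda>h. h *\<^sub>R v)) (at s)"
      by (auto intro!: derivative_eq_intros)
    from diff_chain_at[OF this der[OF inb[OF that]]] show ?thesis by (simp add: o_def)
  qed
  have "\<exists>s\<in>{0<..<1}. f (x + 1 *\<^sub>R v) - f (x + 0 *\<^sub>R v) = grad f (x + s *\<^sub>R v) \<bullet> ((1 - 0) *\<^sub>R v)"
  proof (rule mvt_simple)
    show "((\<lambda>s. f (x + s *\<^sub>R v)) has_derivative (\<lambda>h. grad f (x + s *\<^sub>R v) \<bullet> (h *\<^sub>R v))) (at s within {0..1})"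
      if "0 \<le> s" "s \<le> 1" for s using der'[OF that] by (rule has_derivative_at_withinI)
  qed auto
  then show ?thesis by auto
qed

lemma has_derivative_at_eps:
  assumes "(G has_derivative H) (at p)" "e > 0"
  obtains d where "d > 0" "\<And>y. norm y < d \<Longrightarrow> norm (G (p + y) - G p - H y) \<le> e * norm y"
proof -
  obtain d where "d > 0" "\<And>y. norm (y - p) < d \<Longrightarrow> norm (G y - G p - H (y - p)) \<le> e * norm (y - p)"
    using assms unfolding has_derivative_at_alt by blast
  then show ?thesis by (intro that[of d]) (metis add_diff_cancel_left')+
qed

text \<open>Schwarz: both \<open>H v \<bullet> w\<close> and \<open>H w \<bullet> v\<close> are the limit of the second difference quotient.\<close>
lemma hessian_symmetric:
  fixes f :: "real^'n \<Rightarrow> real"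
  assumes d: "d > 0" and der: "\<And>z. z \<in> ball p d \<Longrightarrow> (f has_derivative (\<lambda>v. grad f z \<bullet> v)) (at z)"
    and H: "(grad f has_derivative H) (at p)"
  shows "H v \<bullet> w = H w \<bullet> v"
proof -
  have lin: "linear H" using H by (rule has_derivative_linear)
  \<comment> \<open>The mean value theorem along v is applied to the difference of f at the two ends
    of t w, which leaves a difference of gradients at two points near p. Differentiability of the
    gradient at p then turns it into t H w up to the stated error.\<close>
  have key: "\<exists>c>0. \<forall>t. 0 < t \<and> t < c \<longrightarrow>
      \<bar>(f (p + t *\<^sub>R v + t *\<^sub>R w) - f (p + t *\<^sub>R v) - f (p + t *\<^sub>R w) + f p) - t^2 * (H w \<bullet> v)\<bar> \<le> t^2 * e * (2 * norm v + norm w) * norm v"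
    if e: "e > 0" for e v w
  proof -
    obtain r where r: "r > 0" "\<And>y. norm y < r \<Longrightarrow> norm (grad f (p + y) - grad f p - H y) \<le> e * norm y"
      using has_derivative_at_eps[OF H e] by blast
    \<comment> \<open>The summand 1 in \<open>?K\<close> keeps it positive when v and w are 0; for t
      below \<open>?m / ?K\<close> the whole parallelogram spanned by t v and t w stays in both
      balls.\<close>
    let ?m = "min d r" and ?K = "norm v + norm w + 1"
    show ?thesis
    proof (intro exI[of _ "?m / ?K"] conjI allI impI)
      show "0 < ?m / ?K" using d r by (intro divide_pos_pos) (auto simp: add_nonneg_pos)
      fix t :: real assume t: "0 < t \<and> t < ?m / ?K"
      have K: "0 < ?K" by (simp add: add_nonneg_pos)
      have tK: "t * ?K < ?m" using t K by (simp add: pos_less_divide_eq)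
      have small: "norm (s *\<^sub>R v + u *\<^sub>R w) < ?m" if "0 \<le> s" "s \<le> t" "0 \<le> u" "u \<le> t" for s u
      proof -
        have "norm (s *\<^sub>R v + u *\<^sub>R w) \<le> s * norm v + u * norm w"
          using norm_triangle_ineq[of "s *\<^sub>R v" "u *\<^sub>R w"] that by simp
        also have "\<dots> \<le> t * norm v + t * norm w" using that by (intro add_mono mult_right_mono) auto
        also have "\<dots> \<le> t * ?K" using t by (simp add: algebra_simps)
        finally show ?thesis using tK by simp
      qed
      have inb: "p + (s *\<^sub>R v + u *\<^sub>R w) \<in> ball p d" if "0 \<le> s" "s \<le> t" "0 \<le> u" "u \<le> t" for s u
        using small[OF that] unfolding mem_ball dist_commute[of p] by (simp add: dist_norm)
      have sc: "0 \<le> s * t" "s * t \<le> t" if "0 \<le> s" "s \<le> 1" for s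
        using that t by (auto intro: mult_left_le_one_le)
      let ?\<phi> = "\<lambda>s. f (p + ((s * t) *\<^sub>R v + t *\<^sub>R w)) - f (p + ((s * t) *\<^sub>R v + 0 *\<^sub>R w))"
      have der': "((\<lambda>s. f (p + ((s * t) *\<^sub>R v + u *\<^sub>R w))) has_derivative (\<lambda>h. grad f (p + ((s * t) *\<^sub>R v + u *\<^sub>R w)) \<bullet> ((h * t) *\<^sub>R v))) (at s)"
        if "0 \<le> s" "s \<le> 1" "0 \<le> u" "u \<le> t" for s u
      proof -
        have "((\<lambda>s. p + ((s * t) *\<^sub>R v + u *\<^sub>R w)) has_derivative (\<lambda>h. (h * t) *\<^sub>R v)) (at s)"
          by (auto intro!: derivative_eq_intros)
        from diff_chain_at[OF this der[OF inb]] that sc[OF that(1,2)] show ?thesis by (simp add: o_def)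
      qed
      have "\<exists>s\<in>{0<..<1}. ?\<phi> 1 - ?\<phi> 0 = grad f (p + ((s * t) *\<^sub>R v + t *\<^sub>R w)) \<bullet> (((1 - 0) * t) *\<^sub>R v)
          - grad f (p + ((s * t) *\<^sub>R v + 0 *\<^sub>R w)) \<bullet> (((1 - 0) * t) *\<^sub>R v)"
      proof (rule mvt_simple)
        show "(?\<phi> has_derivative (\<lambda>h. grad f (p + ((s * t) *\<^sub>R v + t *\<^sub>R w)) \<bullet> ((h * t) *\<^sub>R v)
            - grad f (p + ((s * t) *\<^sub>R v + 0 *\<^sub>R w)) \<bullet> ((h * t) *\<^sub>R v))) (at s within {0..1})"
          if "0 \<le> s" "s \<le> 1" for s
          using that t by (intro has_derivative_diff has_derivative_at_withinI[OF der']) auto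
      qed auto
      then obtain s where s: "0 < s" "s < 1" and eq: "?\<phi> 1 - ?\<phi> 0 =
          t * ((grad f (p + ((s * t) *\<^sub>R v + t *\<^sub>R w)) - grad f (p + (s * t) *\<^sub>R v)) \<bullet> v)"
        by (auto simp: inner_diff_left algebra_simps)
      let ?y1 = "(s * t) *\<^sub>R v + t *\<^sub>R w" and ?y2 = "(s * t) *\<^sub>R v + 0 *\<^sub>R w"
      have st: "0 \<le> s * t" "s * t \<le> t" using sc[of s] s by auto
      have n1: "norm ?y1 < r" "norm ?y2 < r" using small[OF st, of t] small[OF st, of 0] t by auto
      define R where "R = (grad f (p + ?y1) - grad f p - H ?y1) - (grad f (p + ?y2) - grad f p - H ?y2)"
      have y12: "norm ?y1 \<le> t * (norm v + norm w)" "norm ?y2 \<le> t * norm v"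
      proof -
        have "norm ?y1 \<le> (s * t) * norm v + t * norm w"
          using norm_triangle_ineq[of "(s * t) *\<^sub>R v" "t *\<^sub>R w"] st t by simp
        also have "\<dots> \<le> t * norm v + t * norm w" using st by (intro add_mono mult_right_mono) auto
        finally show "norm ?y1 \<le> t * (norm v + norm w)" by (simp add: algebra_simps)
        show "norm ?y2 \<le> t * norm v" using st by (simp add: mult_right_mono)
      qed
      have "norm R \<le> e * norm ?y1 + e * norm ?y2"
        unfolding R_def using r(2)[OF n1(1)] r(2)[OF n1(2)] by (intro norm_triangle_le_diff) linarith
      also have "\<dots> \<le> e * (t * (norm v + norm w)) + e * (t * norm v)"
        using y12 e by (intro add_mono mult_left_mono) auto
      finally have nR: "norm R \<le> t * e * (2 * norm v + norm w)" by (simp add: algebra_simps)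
      have "H ?y1 - H ?y2 = t *\<^sub>R H w"
        using lin by (simp add: linear_add linear_cmul)
      then have tw: "t *\<^sub>R H w = H ?y1 - H ?y2" by simp
      have "grad f (p + ?y1) - grad f (p + (s * t) *\<^sub>R v) = t *\<^sub>R H w + R" unfolding tw by (simp add: R_def)
      then have "?\<phi> 1 - ?\<phi> 0 - t^2 * (H w \<bullet> v) = t * (R \<bullet> v)"
        unfolding eq by (simp add: inner_add_left power2_eq_square algebra_simps)
      then have "\<bar>?\<phi> 1 - ?\<phi> 0 - t^2 * (H w \<bullet> v)\<bar> \<le> t * (norm R * norm v)"
        using t Cauchy_Schwarz_ineq2[of R v] by (simp add: abs_mult)
      also have "\<dots> \<le> t * ((t * e * (2 * norm v + norm w)) * norm v)"
        using t nR by (intro mult_left_mono mult_right_mono) auto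
      finally show "\<bar>(f (p + t *\<^sub>R v + t *\<^sub>R w) - f (p + t *\<^sub>R v) - f (p + t *\<^sub>R w) + f p) - t^2 * (H w \<bullet> v)\<bar>
          \<le> t^2 * e * (2 * norm v + norm w) * norm v"
        by (simp add: power2_eq_square algebra_simps)
    qed
  qed
  define K where "K = (2 * norm v + norm w) * norm v + (2 * norm w + norm v) * norm w"
  have bound: "\<bar>H w \<bullet> v - H v \<bullet> w\<bar> \<le> e * K" if e: "e > 0" for e
  proof -
    obtain c where c: "c > 0" "\<And>t. 0 < t \<and> t < c \<Longrightarrow>
      \<bar>(f (p + t *\<^sub>R v + t *\<^sub>R w) - f (p + t *\<^sub>R v) - f (p + t *\<^sub>R w) + f p) - t^2 * (H w \<bullet> v)\<bar> \<le> t^2 * e * (2 * norm v + norm w) * norm v"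
      using key[OF e, of v w] by blast
    obtain c' where c': "c' > 0" "\<And>t. 0 < t \<and> t < c' \<Longrightarrow>
      \<bar>(f (p + t *\<^sub>R w + t *\<^sub>R v) - f (p + t *\<^sub>R w) - f (p + t *\<^sub>R v) + f p) - t^2 * (H v \<bullet> w)\<bar> \<le> t^2 * e * (2 * norm w + norm v) * norm w"
      using key[OF e, of w v] by blast
    define t where "t = min c c' / 2"
    have t: "0 < t \<and> t < c" "0 < t \<and> t < c'" using c c' by (auto simp: t_def)
    let ?D = "f (p + t *\<^sub>R v + t *\<^sub>R w) - f (p + t *\<^sub>R v) - f (p + t *\<^sub>R w) + f p"
    have sw: "p + t *\<^sub>R w + t *\<^sub>R v = p + t *\<^sub>R v + t *\<^sub>R w" by simp
    have "\<bar>?D - t^2 * (H w \<bullet> v)\<bar> \<le> t^2 * e * (2 * norm v + norm w) * norm v" by (rule c(2)[OF t(1)])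
    moreover have "\<bar>?D - t^2 * (H v \<bullet> w)\<bar> \<le> t^2 * e * (2 * norm w + norm v) * norm w"
      using c'(2)[OF t(2)] unfolding sw by (simp add: algebra_simps)
    ultimately have "\<bar>t^2 * (H w \<bullet> v) - t^2 * (H v \<bullet> w)\<bar> \<le> t^2 * e * (2 * norm v + norm w) * norm v + t^2 * e * (2 * norm w + norm v) * norm w"
      by linarith
    also have "\<dots> = t^2 * (e * K)" by (simp add: K_def algebra_simps)
    finally have "t^2 * \<bar>H w \<bullet> v - H v \<bullet> w\<bar> \<le> t^2 * (e * K)"
      by (simp add: abs_mult flip: right_diff_distrib)
    then show ?thesis using t by simp
  qed
  have "\<bar>H w \<bullet> v - H v \<bullet> w\<bar> \<le> e" if "e > 0" for e
  proof -
    have K: "K \<ge> 0" by (simp add: K_def)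
    have "\<bar>H w \<bullet> v - H v \<bullet> w\<bar> \<le> e / (K + 1) * K" using bound[of "e / (K + 1)"] that K by simp
    also have "\<dots> \<le> e" using that K by (simp add: field_simps)
    finally show ?thesis .
  qed
  then have "\<bar>H w \<bullet> v - H v \<bullet> w\<bar> \<le> 0" by (rule field_le_epsilon[of _ 0, simplified])
  then show ?thesis by simp
qed

text \<open>The mean value theorem at a maximum finds a point on a short segment in direction v
  where the gradient has nonpositive product with v. Expanding the gradient at p to first order
  turns this into a bound e |v|^2 on the form for every e > 0.\<close>

lemma hessian_nonpos_local_max:
  fixes f :: "real^'n \<Rightarrow> real"
  assumes d: "d > 0" and der: "\<And>z. z \<in> ball p d \<Longrightarrow> (f has_derivative (\<lambda>v. grad f z \<bullet> v)) (at z)"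
    and H: "(grad f has_derivative H) (at p)" and 0: "grad f p = 0"
    and max: "\<And>z. z \<in> ball p d \<Longrightarrow> f z \<le> f p"
  shows "H v \<bullet> v \<le> 0"
proof -
  have lin: "linear H" using H by (rule has_derivative_linear)
  have bound: "H v \<bullet> v \<le> e * (norm v)^2" if e: "e > 0" for e
  proof -
    obtain r where r: "r > 0" "\<And>y. norm y < r \<Longrightarrow> norm (grad f (p + y) - grad f p - H y) \<le> e * norm y"
      using has_derivative_at_eps[OF H e] by blast
    define t where "t = min d r / (2 * (norm v + 1))"
    have n1: "0 < norm v + 1" by (simp add: add_nonneg_pos)
    have t: "t > 0" using d r n1 by (simp add: t_def)
    have "t * norm v \<le> t * (norm v + 1)" using t by simp
    also have "\<dots> = min d r / 2" using n1 by (simp add: t_def field_simps)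
    also have "\<dots> < min d r" using d r by (auto simp: min_def)
    finally have tv: "t * norm v < min d r" .
    have "p + t *\<^sub>R v \<in> ball p d" using tv t by (simp add: dist_norm)
    then obtain s where s: "0 < s" "s < 1" "f (p + t *\<^sub>R v) - f p = grad f (p + s *\<^sub>R t *\<^sub>R v) \<bullet> (t *\<^sub>R v)"
      using has_derivative_radial_mvt[OF der, of p d p "t *\<^sub>R v"] d by auto
    let ?y = "(s * t) *\<^sub>R v"
    have "t * (grad f (p + ?y) \<bullet> v) \<le> 0"
      using s(3) max[OF \<open>p + t *\<^sub>R v \<in> ball p d\<close>] by simp
    then have le: "grad f (p + ?y) \<bullet> v \<le> 0" using t by (simp add: mult_le_0_iff)
    have st: "0 < s * t" "s * t < t" using s t by auto
    have "norm ?y \<le> t * norm v" using st s t by (simp add: mult_left_le_one_le)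
    then have "norm (grad f (p + ?y) - H ?y) \<le> e * norm ?y" using r(2)[of ?y] tv 0 by simp
    then have "\<bar>(grad f (p + ?y) - H ?y) \<bullet> v\<bar> \<le> e * norm ?y * norm v"
      using Cauchy_Schwarz_ineq2[of "grad f (p + ?y) - H ?y" v] mult_right_mono[of _ _ "norm v"] by (meson norm_ge_zero order_trans)
    moreover have "H ?y = (s * t) *\<^sub>R H v" using lin by (simp add: linear_cmul)
    ultimately have "(s * t) * (H v \<bullet> v) \<le> e * norm ?y * norm v"
      using le by (simp add: inner_diff_left)
    also have "\<dots> = (s * t) * (e * (norm v)^2)" using st s t by (simp add: power2_eq_square abs_mult)
    finally show ?thesis using st by (simp add: mult_le_cancel_left)
  qed
  have "H v \<bullet> v \<le> 0 + e" if "e > 0" for e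
  proof -
    have "H v \<bullet> v \<le> e / ((norm v)^2 + 1) * (norm v)^2"
      using bound[of "e / ((norm v)^2 + 1)"] that by (simp add: add_nonneg_pos)
    also have "\<dots> = e * (norm v)^2 / ((norm v)^2 + 1)" by simp
    also have "\<dots> \<le> e" using that by (subst pos_divide_le_eq) (auto simp: add_pos_nonneg algebra_simps)
    finally show ?thesis by simp
  qed
  then show ?thesis by (rule field_le_epsilon)
qed

text \<open>Perturbing w in the direction H w turns the form into 2 t |H w|^2 - c t^2 with c >= 0,
  which would be positive for small t > 0 if H w were not 0.\<close>

lemma semidefinite_kernel:
  fixes H :: "'a::real_inner \<Rightarrow> 'a"
  assumes lin: "linear H" and sym: "\<And>v w. H v \<bullet> w = H w \<bullet> v" and neg: "\<And>v. H v \<bullet> v \<le> 0"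
    and w: "H w \<bullet> w = 0"
  shows "H w = 0"
proof -
  let ?v = "H w"
  have *: "2 * t * (H w \<bullet> ?v) + t^2 * (H ?v \<bullet> ?v) \<le> 0" for t
  proof -
    have "H (w + t *\<^sub>R ?v) \<bullet> (w + t *\<^sub>R ?v) = H w \<bullet> w + t * (H w \<bullet> ?v) + t * (H ?v \<bullet> w) + t^2 * (H ?v \<bullet> ?v)"
      using lin by (simp add: linear_add linear_cmul inner_add_left inner_add_right power2_eq_square algebra_simps)
    then show ?thesis using neg[of "w + t *\<^sub>R ?v"] w sym[of ?v w] by simp
  qed
  define c where "c = - (H ?v \<bullet> ?v)"
  have c: "c \<ge> 0" using neg by (simp add: c_def)
  have "H w \<bullet> ?v \<le> 0"
  proof (rule ccontr)
    assume "\<not> H w \<bullet> ?v \<le> 0"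
    then have q: "H w \<bullet> ?v > 0" by (simp only: not_le)
    \<comment> \<open>Since t c is then at most |H w|^2, the first-order term wins; the summand 1
      covers c = 0.\<close>
    define t where "t = (H w \<bullet> ?v) / (c + 1)"
    have t: "t > 0" using q c by (simp add: t_def)
    have "2 * t * (H w \<bullet> ?v) \<le> t^2 * c" using *[of t] by (simp add: c_def)
    then have "2 * (H w \<bullet> ?v) \<le> t * c" using t by (simp add: power2_eq_square mult_ac)
    also have "\<dots> \<le> t * (c + 1)" using t by simp
    also have "\<dots> = H w \<bullet> ?v" using c by (simp add: t_def)
    finally show False using q by simp
  qed
  then show ?thesis by (metis inner_gt_zero_iff not_less)
qed

section \<open>Graph representations of boundaries\<close>

definition supports :: "(real^'n) set \<Rightarrow> real^'n \<Rightarrow> real^'n \<Rightarrow> bool" where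
  "supports C p \<nu> \<longleftrightarrow> (\<forall>x\<in>C. (x - p) \<bullet> \<nu> \<le> 0)"

text \<open>Near \<open>p\<close>, \<open>S\<close> is the graph of \<open>f\<close> over the hyperplane orthogonal to \<open>N\<close>. The function \<open>f\<close> is taken on a
  full-dimensional ball around \<open>p\<close> itself and is constant along \<open>N\<close>, so that calculus in \<open>\<real>\<^sup>n\<close> applies.\<close>
definition graph_rep :: "(real^'n) set \<Rightarrow> real^'n \<Rightarrow> real^'n \<Rightarrow> smoothness \<Rightarrow> real \<Rightarrow> (real^'n \<Rightarrow> real) \<Rightarrow> real \<Rightarrow> bool" where
  "graph_rep S p N \<kappa> \<alpha> f \<delta> \<longleftrightarrow> \<delta> > 0 \<and> lreg \<kappa> \<alpha> (ball p \<delta>) f \<and>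
     (\<forall>z\<in>ball p \<delta>. \<forall>t. z + t *\<^sub>R N \<in> ball p \<delta> \<longrightarrow> f (z + t *\<^sub>R N) = f z) \<and>
     (\<forall>z\<in>ball p \<delta>. z \<in> S \<longleftrightarrow> z \<bullet> N = f z)"

lemma graph_repD:
  assumes "graph_rep S p N \<kappa> \<alpha> f \<delta>"
  shows "\<delta> > 0" "lreg \<kappa> \<alpha> (ball p \<delta>) f"
    "\<And>z t. z \<in> ball p \<delta> \<Longrightarrow> z + t *\<^sub>R N \<in> ball p \<delta> \<Longrightarrow> f (z + t *\<^sub>R N) = f z"
    "\<And>z. z \<in> ball p \<delta> \<Longrightarrow> z \<in> S \<longleftrightarrow> z \<bullet> N = f z"
  using assms unfolding graph_rep_def by blast+

lemma graph_rep_smaller: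
  assumes "graph_rep S p N \<kappa> \<alpha> f \<delta>" "0 < \<epsilon>" "\<epsilon> \<le> \<delta>"
  shows "graph_rep S p N \<kappa> \<alpha> f \<epsilon>"
proof -
  have sub: "ball p \<epsilon> \<subseteq> ball p \<delta>" using assms(3) by auto
  show ?thesis
    using graph_repD[OF assms(1)] assms(2) sub lreg_subset[OF graph_repD(2)[OF assms(1)] sub]
    unfolding graph_rep_def by blast
qed

lemma graph_rep_regular:
  assumes "graph_rep S p N \<kappa> \<alpha> f \<delta>" "lreg \<kappa>' \<beta> (ball p \<delta>) f"
  shows "graph_rep S p N \<kappa>' \<beta> f \<delta>"
  using assms unfolding graph_rep_def by blast

lemma isCont_eventually_in:
  assumes "isCont f x" "open U" "f x \<in> U"
  shows "\<forall>\<^sub>F y in nhds x. f y \<in> U"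
  using assms unfolding isCont_def tendsto_at_iff_tendsto_nhds by (rule topological_tendstoD)

lemma norm_proj_le:
  fixes z N :: "'a::real_inner"
  assumes "norm N = 1"
  shows "norm (z - (z \<bullet> N) *\<^sub>R N) \<le> norm z"
proof -
  have NN: "N \<bullet> N = 1" using assms by (simp add: dot_square_norm)
  have "(norm (z - (z \<bullet> N) *\<^sub>R N))^2 = (norm z)^2 - (z \<bullet> N)^2"
    unfolding power2_norm_eq_inner by (simp add: inner_diff_left inner_diff_right NN inner_commute power2_eq_square)
  then have "(norm (z - (z \<bullet> N) *\<^sub>R N))^2 \<le> (norm z)^2" by simp
  then show ?thesis by (rule power2_le_imp_le) simp
qed

lemma vreg_proj:
  fixes N :: "real^'n"
  assumes "open V" "\<alpha> \<le> 1"
  shows "vreg \<kappa> \<alpha> V (\<lambda>x. x - (x \<bullet> N) *\<^sub>R N + c)"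
  using assms by (auto intro!: lreg_add lreg_diff lreg_mult lreg_inner lreg_nth lreg_const)

lemma hypersurface_imp_graph_rep:
  fixes S :: "(real^'n) set"
  assumes h: "hypersurface_near S p \<kappa> \<alpha>" and p: "p \<in> S" and k: "\<kappa> \<noteq> Fin 0" and a: "\<alpha> \<le> 1"
  obtains u f \<delta> where "norm u = 1" "graph_rep S p u \<kappa> \<alpha> f \<delta>"
proof -
  obtain u r V f where u: "norm u = 1" and r: "r > 0" and V: "open V" and f: "reg_on \<kappa> \<alpha> V f"
    and S: "S \<inter> ball p r = {x + f x *\<^sub>R u | x. x \<in> V \<and> x \<bullet> u = 0} \<inter> ball p r"
    using h unfolding hypersurface_near_def by - (elim exE conjE, rule that)
  have uu: "u \<bullet> u = 1" using u by (simp add: dot_square_norm)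
  \<comment> \<open>Orthogonal projection to the hyperplane; the summand 0 fits the shape of
    \<open>vreg_proj\<close>.\<close>
  define P where "P z = z - (z \<bullet> u) *\<^sub>R u + 0" for z
  have graph: "x = P z \<and> z \<bullet> u = f x" if "z = x + f x *\<^sub>R u" "x \<bullet> u = 0" for x z
    using that by (simp add: P_def inner_add_left uu)
  have "p \<in> S \<inter> ball p r" using p r by simp
  then have "p \<in> {x + f x *\<^sub>R u | x. x \<in> V \<and> x \<bullet> u = 0}" unfolding S by (rule IntD1)
  then obtain x where x: "p = x + f x *\<^sub>R u" "x \<bullet> u = 0" "x \<in> V" by blast
  then have pV: "P p \<in> V" using graph[OF x(1,2)] by simp
  then obtain e where e: "e > 0" "ball (P p) e \<subseteq> V" using V open_contains_ball by blast
  define \<delta> where "\<delta> = min r e"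
  have \<delta>: "\<delta> > 0" "\<delta> \<le> r" "\<delta> \<le> e" using r e by (auto simp: \<delta>_def)
  have PV: "P z \<in> V" if "z \<in> ball p \<delta>" for z
  proof -
    have "P p - P z = (p - z) - ((p - z) \<bullet> u) *\<^sub>R u" by (simp add: P_def algebra_simps inner_diff_left)
    then have "dist (P p) (P z) \<le> dist p z" unfolding dist_norm using norm_proj_le[OF u] by metis
    then show ?thesis using that e \<delta> by auto
  qed
  show ?thesis
  proof (rule that[OF u], unfold graph_rep_def, intro conjI ballI allI impI)
    show "lreg \<kappa> \<alpha> (ball p \<delta>) (\<lambda>z. f (P z))"
    proof (rule lreg_compose[OF V open_ball a k reg_on_imp_lreg[OF f]])
      show "lreg \<kappa> \<alpha> (ball p \<delta>) (\<lambda>x. P x $ i)" for i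
        using vreg_proj[OF open_ball a] unfolding P_def by blast
    qed (use PV in blast)
    show "f (P (z + t *\<^sub>R u)) = f (P z)" for z t by (simp add: P_def inner_add_left uu algebra_simps)
    fix z assume z: "z \<in> ball p \<delta>"
    then have zr: "z \<in> ball p r" using \<delta> by auto
    show "z \<in> S \<longleftrightarrow> z \<bullet> u = f (P z)"
    proof
      assume "z \<in> S"
      then have "z \<in> S \<inter> ball p r" using zr by simp
      then have "z \<in> {x + f x *\<^sub>R u | x. x \<in> V \<and> x \<bullet> u = 0}" unfolding S by (rule IntD1)
      then obtain x where x: "z = x + f x *\<^sub>R u" "x \<bullet> u = 0" by blast
      then show "z \<bullet> u = f (P z)" using graph[OF x] by simp
    next
      assume eq: "z \<bullet> u = f (P z)"
      have "z = P z + f (P z) *\<^sub>R u" using eq by (simp add: P_def)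
      moreover have "P z \<bullet> u = 0" by (simp add: P_def inner_diff_left uu)
      ultimately have "z \<in> {x + f x *\<^sub>R u | x. x \<in> V \<and> x \<bullet> u = 0}" using PV[OF z] by blast
      then have "z \<in> {x + f x *\<^sub>R u | x. x \<in> V \<and> x \<bullet> u = 0} \<inter> ball p r" using zr by (rule IntI)
      then show "z \<in> S" unfolding S[symmetric] by (rule IntD1)
    qed
  qed (use \<delta> in auto)
qed

text \<open>The premise \<open>mono\<close> separates the class in which the projection is composed
  from the class delivered, so that a C^2 representation can also yield a class as low as
  \<open>Fin 0\<close>, to which \<open>lreg_compose\<close> does not apply.\<close>

lemma graph_rep_imp_hypersurface:
  fixes S :: "(real^'n) set"
  assumes g: "graph_rep S p N \<kappa> \<alpha> f \<delta>" and N: "norm N = 1" and k: "\<kappa> \<noteq> Fin 0" and a: "\<alpha> \<le> 1"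
    and mono: "\<And>V g. open V \<Longrightarrow> lreg \<kappa> \<alpha> V g \<Longrightarrow> lreg \<kappa>' \<beta> V (g :: real^'n \<Rightarrow> real)"
  shows "hypersurface_near S p \<kappa>' \<beta>"
proof -
  note g' = graph_repD[OF g]
  have NN: "N \<bullet> N = 1" using N by (simp add: dot_square_norm)
  define P where "P z = z - (z \<bullet> N) *\<^sub>R N" for z
  \<comment> \<open>\<open>hypersurface_near\<close> puts the base points into the hyperplane
    through the origin while f lives around p; the shift by (p \<bullet> N) N moves between the
    two.\<close>
  define h where "h x = f (x - (x \<bullet> N) *\<^sub>R N + (p \<bullet> N) *\<^sub>R N)" for x
  have PN: "P z \<bullet> N = 0" for z by (simp add: P_def inner_diff_left NN)
  have dP: "dist (P y) (P z) \<le> dist y z" for y z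
  proof -
    have "P y - P z = (y - z) - ((y - z) \<bullet> N) *\<^sub>R N" by (simp add: P_def algebra_simps inner_diff_left)
    then show ?thesis unfolding dist_norm using norm_proj_le[OF N] by metis
  qed
  have Ph: "P x + (p \<bullet> N) *\<^sub>R N \<in> ball p \<delta>" if "dist (P p) (P x) < \<delta>" for x
  proof -
    have eq: "p - (P x + (p \<bullet> N) *\<^sub>R N) = P p - P x" by (simp add: P_def[of p])
    show ?thesis using that unfolding mem_ball dist_norm eq .
  qed
  have "lreg \<kappa> \<alpha> (ball (P p) \<delta>) h"
    unfolding h_def
  proof (rule lreg_compose[OF open_ball open_ball a k g'(2)])
    show "lreg \<kappa> \<alpha> (ball (P p) \<delta>) (\<lambda>x. (x - (x \<bullet> N) *\<^sub>R N + (p \<bullet> N) *\<^sub>R N) $ i)" for i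
      using vreg_proj[OF open_ball a] by blast
    show "(\<lambda>x. x - (x \<bullet> N) *\<^sub>R N + (p \<bullet> N) *\<^sub>R N) ` ball (P p) \<delta> \<subseteq> ball p \<delta>"
    proof safe
      fix x assume "x \<in> ball (P p) \<delta>"
      moreover have "P (P p) = P p" by (simp add: P_def[of "P p"] PN)
      ultimately have "dist (P p) (P x) < \<delta>" using dP[of "P p" x] by (metis le_less_trans mem_ball)
      from Ph[OF this] show "x - (x \<bullet> N) *\<^sub>R N + (p \<bullet> N) *\<^sub>R N \<in> ball p \<delta>" by (simp add: P_def)
    qed
  qed
  then have "lreg \<kappa>' \<beta> (ball (P p) \<delta>) h" by (rule mono[OF open_ball])
  then obtain e where e: "e > 0" "ball (P p) e \<subseteq> ball (P p) \<delta>" "reg_on \<kappa>' \<beta> (ball (P p) e) h"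
    using lreg_imp_reg_on[OF open_ball centre_in_ball[THEN iffD2, OF g'(1)]] by blast
  define r where "r = min e \<delta>"
  have r: "r > 0" "r \<le> e" "r \<le> \<delta>" using e g'(1) by (auto simp: r_def)
  have hz: "h (P z) = f z" if z: "z \<in> ball p \<delta>" for z
  proof -
    have 1: "P z + (p \<bullet> N) *\<^sub>R N = z + (p \<bullet> N - z \<bullet> N) *\<^sub>R N" by (simp add: P_def algebra_simps)
    have "P z + (p \<bullet> N) *\<^sub>R N \<in> ball p \<delta>" using z dP[of p z] by (intro Ph) simp
    then have "f (P z + (p \<bullet> N) *\<^sub>R N) = f z" using g'(3)[OF z] unfolding 1 by blast
    then show ?thesis by (simp add: h_def PN)
  qed
  have eq: "S \<inter> ball p r = {x + h x *\<^sub>R N | x. x \<in> ball (P p) e \<and> x \<bullet> N = 0} \<inter> ball p r"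
  proof (intro set_eqI iffI)
    fix z assume "z \<in> S \<inter> ball p r"
    then have z: "z \<in> S" "z \<in> ball p r" "z \<in> ball p \<delta>" using r by auto
    have "z \<bullet> N = h (P z)" using g'(4)[OF z(3)] z(1) hz[OF z(3)] by simp
    then have "z = P z + h (P z) *\<^sub>R N" by (simp add: P_def)
    moreover have "P z \<in> ball (P p) e" using dP[of p z] z(2) r by auto
    ultimately show "z \<in> {x + h x *\<^sub>R N | x. x \<in> ball (P p) e \<and> x \<bullet> N = 0} \<inter> ball p r"
      using PN z(2) by blast
  next
    fix z assume "z \<in> {x + h x *\<^sub>R N | x. x \<in> ball (P p) e \<and> x \<bullet> N = 0} \<inter> ball p r"
    then obtain x where x: "z = x + h x *\<^sub>R N" "x \<bullet> N = 0" and zr: "z \<in> ball p r" by blast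
    have zd: "z \<in> ball p \<delta>" using zr r by auto
    have "P z = x" "z \<bullet> N = h x" using x by (auto simp: P_def inner_add_left NN)
    then have "z \<bullet> N = f z" using hz[OF zd] by simp
    then show "z \<in> S \<inter> ball p r" using g'(4)[OF zd] zr by simp
  qed
  show ?thesis unfolding hypersurface_near_def
    by (intro exI conjI, rule N, rule r(1), rule open_ball, rule e(3), rule eq)
qed

section \<open>Tangent curves, gradients and normals of a graph\<close>

context
  fixes S :: "(real^'n) set" and p N \<kappa> \<alpha> f \<delta>
  assumes g: "graph_rep S p N \<kappa> \<alpha> f \<delta>" and k: "\<kappa> \<noteq> Fin 0" and N: "norm N = 1"
begin

lemma inner_normal_self: "N \<bullet> N = 1" using N by (simp add: dot_square_norm)

lemma graph_rep_der:
  assumes "z \<in> ball p \<delta>"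
  shows "(f has_derivative (\<lambda>v. grad f z \<bullet> v)) (at z)"
  by (rule lreg_grad[OF open_ball k graph_repD(2)[OF g] assms])

lemma graph_rep_grad_orth:
  assumes z: "z \<in> ball p \<delta>"
  shows "grad f z \<bullet> N = 0"
proof -
  obtain e where e: "e > 0" "ball z e \<subseteq> ball p \<delta>" using z open_contains_ball open_ball by blast
  have "((\<lambda>t. z + t *\<^sub>R N) has_derivative (\<lambda>h. h *\<^sub>R N)) (at 0)"
    by (auto intro!: derivative_eq_intros)
  from diff_chain_at[OF this, of f "\<lambda>v. grad f z \<bullet> v"] graph_rep_der[OF z]
  have "((\<lambda>t. f (z + t *\<^sub>R N)) has_derivative (\<lambda>h. h * (grad f z \<bullet> N))) (at 0)"
    by (simp add: o_def)
  then have "((\<lambda>t::real. f z) has_derivative (\<lambda>h. h * (grad f z \<bullet> N))) (at 0)"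
  proof (rule has_derivative_transform_within_open[OF _ open_ball])
    show "(0::real) \<in> ball 0 e" using e by simp
    fix t :: real assume "t \<in> ball 0 e"
    then have "z + t *\<^sub>R N \<in> ball z e" using N by (simp add: dist_norm)
    then show "f (z + t *\<^sub>R N) = f z" using graph_repD(3)[OF g z] e by blast
  qed
  from has_derivative_unique[OF this has_derivative_const]
  have "1 * (grad f z \<bullet> N) = 0" by (rule fun_cong)
  then show ?thesis by simp
qed

lemma graph_rep_grad_shift:
  assumes z: "z \<in> ball p \<delta>" and zt: "z + t *\<^sub>R N \<in> ball p \<delta>"
  shows "grad f (z + t *\<^sub>R N) = grad f z"
proof -
  let ?U = "ball p \<delta> \<inter> (\<lambda>y. y + t *\<^sub>R N) -` ball p \<delta>"
  have U: "open ?U" by (intro open_Int open_ball open_vimage continuous_intros)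
  have "((\<lambda>y. y + t *\<^sub>R N) has_derivative (\<lambda>v. v)) (at z)"
    by (auto intro!: derivative_eq_intros)
  from diff_chain_at[OF this graph_rep_der[OF zt]]
  have "((\<lambda>y. f (y + t *\<^sub>R N)) has_derivative (\<lambda>v. grad f (z + t *\<^sub>R N) \<bullet> v)) (at z)"
    by (simp add: o_def)
  then have "(f has_derivative (\<lambda>v. grad f (z + t *\<^sub>R N) \<bullet> v)) (at z)"
    by (rule has_derivative_transform_within_open[OF _ U]) (use z zt graph_repD(3)[OF g] in auto)
  then show ?thesis by (metis grad_eqI)
qed

text \<open>The line z + t v is moved along N onto the graph. As f is constant along N, the
  correction term leaves the value of f unchanged, and the curve remains in S for small t.\<close>

lemma graph_rep_curve:
  assumes z: "z \<in> ball p \<delta>" "z \<in> S"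
  obtains e where "e > 0" "\<And>t. \<bar>t\<bar> < e \<Longrightarrow> z + t *\<^sub>R v + (f (z + t *\<^sub>R v) - z \<bullet> N - t * (v \<bullet> N)) *\<^sub>R N \<in> S \<inter> ball p \<delta>"
    "((\<lambda>t. z + t *\<^sub>R v + (f (z + t *\<^sub>R v) - z \<bullet> N - t * (v \<bullet> N)) *\<^sub>R N) has_derivative
      (\<lambda>h. h *\<^sub>R (v + (grad f z \<bullet> v - v \<bullet> N) *\<^sub>R N))) (at 0)"
proof -
  let ?c = "\<lambda>t. z + t *\<^sub>R v + (f (z + t *\<^sub>R v) - z \<bullet> N - t * (v \<bullet> N)) *\<^sub>R N"
  have fz: "f z = z \<bullet> N" using graph_repD(4)[OF g z(1)] z(2) by simp
  have "((\<lambda>t. z + t *\<^sub>R v) has_derivative (\<lambda>h. h *\<^sub>R v)) (at 0)"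
    by (auto intro!: derivative_eq_intros)
  from diff_chain_at[OF this, of f "\<lambda>v. grad f z \<bullet> v"] graph_rep_der[OF z(1)]
  have df: "((\<lambda>t. f (z + t *\<^sub>R v)) has_derivative (\<lambda>h. h * (grad f z \<bullet> v))) (at 0)"
    by (simp add: o_def)
  have dc: "(?c has_derivative (\<lambda>h. h *\<^sub>R (v + (grad f z \<bullet> v - v \<bullet> N) *\<^sub>R N))) (at 0)"
    by (auto intro!: derivative_eq_intros df simp: algebra_simps)
  have "isCont ?c 0" using dc has_derivative_continuous by blast
  moreover have "?c 0 \<in> ball p \<delta>" using z fz by simp
  ultimately have "\<forall>\<^sub>F t in nhds 0. ?c t \<in> ball p \<delta>"
    by (rule isCont_eventually_in[OF _ open_ball])
  moreover have "\<forall>\<^sub>F t in nhds 0. z + t *\<^sub>R v \<in> ball p \<delta>"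
  proof -
    have "isCont (\<lambda>t. z + t *\<^sub>R v) 0" by (intro continuous_intros)
    then show ?thesis by (rule isCont_eventually_in[OF _ open_ball]) (use z(1) in simp)
  qed
  ultimately have "\<forall>\<^sub>F t in nhds 0. ?c t \<in> ball p \<delta> \<and> z + t *\<^sub>R v \<in> ball p \<delta>" by (rule eventually_conj)
  then obtain e where e: "e > 0" "\<And>t. dist t 0 < e \<Longrightarrow> ?c t \<in> ball p \<delta> \<and> z + t *\<^sub>R v \<in> ball p \<delta>"
    unfolding eventually_nhds_metric by blast
  show ?thesis
  proof (rule that[OF e(1) _ dc])
    fix t :: real assume "\<bar>t\<bar> < e"
    then have b: "?c t \<in> ball p \<delta>" "z + t *\<^sub>R v \<in> ball p \<delta>" using e(2)[of t] by auto
    have "f (?c t) = f (z + t *\<^sub>R v)" using graph_repD(3)[OF g b(2)] b(1) by blast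
    moreover have "?c t \<bullet> N = f (z + t *\<^sub>R v)" by (simp add: inner_add_left inner_normal_self)
    ultimately show "?c t \<in> S \<inter> ball p \<delta>" using graph_repD(4)[OF g b(1)] b(1) by simp
  qed
qed

text \<open>A supporting vector annihilates all velocities of curves in \<open>S\<close>.\<close>
lemma graph_rep_normal:
  assumes z: "z \<in> ball p \<delta>" "z \<in> S" and SC: "S \<subseteq> C" and \<nu>: "supports C z \<nu>"
  shows "\<nu> = (\<nu> \<bullet> N) *\<^sub>R (N - grad f z)"
proof -
  have tangent: "(v + (grad f z \<bullet> v - v \<bullet> N) *\<^sub>R N) \<bullet> \<nu> = 0" for v
  proof -
    obtain e where e: "e > 0" "\<And>t. \<bar>t\<bar> < e \<Longrightarrow> z + t *\<^sub>R v + (f (z + t *\<^sub>R v) - z \<bullet> N - t * (v \<bullet> N)) *\<^sub>R N \<in> S \<inter> ball p \<delta>"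
      and d: "((\<lambda>t. z + t *\<^sub>R v + (f (z + t *\<^sub>R v) - z \<bullet> N - t * (v \<bullet> N)) *\<^sub>R N) has_derivative
        (\<lambda>h. h *\<^sub>R (v + (grad f z \<bullet> v - v \<bullet> N) *\<^sub>R N))) (at 0)"
      using graph_rep_curve[OF z, of v] by blast
    let ?c = "\<lambda>t. z + t *\<^sub>R v + (f (z + t *\<^sub>R v) - z \<bullet> N - t * (v \<bullet> N)) *\<^sub>R N"
    have fz: "f z = z \<bullet> N" using graph_repD(4)[OF g z(1)] z(2) by simp
    have "((\<lambda>t. (?c t - z) \<bullet> \<nu>) has_derivative (\<lambda>h. (h *\<^sub>R (v + (grad f z \<bullet> v - v \<bullet> N) *\<^sub>R N)) \<bullet> \<nu>)) (at 0)"
      using has_derivative_inner_left[OF has_derivative_diff[OF d has_derivative_const[of z]]] by simp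
    then have "((\<lambda>t. (?c t - z) \<bullet> \<nu>) has_field_derivative ((v + (grad f z \<bullet> v - v \<bullet> N) *\<^sub>R N) \<bullet> \<nu>)) (at 0)"
      by (simp add: has_field_derivative_def mult_commute_abs)
    then show ?thesis
    proof (rule DERIV_local_max[OF _ e(1)], intro allI impI)
      fix t :: real assume "\<bar>0 - t\<bar> < e"
      then have "?c t \<in> C" using e(2)[of t] SC by auto
      then have "(?c t - z) \<bullet> \<nu> \<le> 0" using \<nu> unfolding supports_def by blast
      moreover have "(?c 0 - z) \<bullet> \<nu> = 0" using fz by simp
      ultimately show "(?c t - z) \<bullet> \<nu> \<le> (?c 0 - z) \<bullet> \<nu>" by linarith
    qed
  qed
  have "v \<bullet> (\<nu> - (\<nu> \<bullet> N) *\<^sub>R (N - grad f z)) = 0" for v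
    using tangent[of v]
    by (simp add: inner_add_left inner_diff_right inner_commute[of N] inner_commute[of "grad f z"] algebra_simps)
  from this[of "\<nu> - (\<nu> \<bullet> N) *\<^sub>R (N - grad f z)"] show ?thesis by simp
qed

lemma graph_rep_grad_zero:
  assumes "p \<in> S" "S \<subseteq> C" "supports C p N"
  shows "grad f p = 0"
proof -
  have "p \<in> ball p \<delta>" using graph_repD(1)[OF g] by simp
  from graph_rep_normal[OF this assms] show ?thesis by (simp add: inner_normal_self)
qed

end

lemma lreg_local_inverse_derivative:
  fixes F :: "real^'n \<Rightarrow> real^'n"
  assumes U: "open U" "x0 \<in> U" and a: "\<alpha> \<le> 1" and k: "\<kappa> \<noteq> Fin 0" and F: "vreg \<kappa> \<alpha> U F"
    and D: "(F has_derivative D) (at x0)" and inj: "\<And>v. D v = 0 \<Longrightarrow> v = 0"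
  shows "\<exists>U' V G. open U' \<and> U' \<subseteq> U \<and> x0 \<in> U' \<and> open V \<and> F x0 \<in> V \<and> homeomorphism U' V F G \<and> vreg \<kappa> \<alpha> V G"
proof -
  have "D = (\<lambda>v. \<chi> i. grad (\<lambda>x. F x $ i) x0 \<bullet> v)"
    by (rule has_derivative_unique[OF D lreg_has_derivative_vec[OF U(1) k _ U(2)]]) (use F in blast)
  then have inj': "v = 0" if "(\<chi> i. grad (\<lambda>x. F x $ i) x0 \<bullet> v) = 0" for v using inj that by simp
  show ?thesis
  proof (rule lreg_local_inverse[of U x0 \<alpha> \<kappa> F])
    show "open U" "x0 \<in> U" "\<alpha> \<le> 1" "\<kappa> \<noteq> Fin 0" by fact+
    show "lreg \<kappa> \<alpha> U (\<lambda>x. F x $ i)" for i using F by blast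
    show "v = 0" if "(\<chi> i. grad (\<lambda>x. F x $ i) x0 \<bullet> v) = 0" for v using inj'[OF that] .
    fix U' V and G :: "real^'n \<Rightarrow> real^'n"
    assume "open U'" "U' \<subseteq> U" "x0 \<in> U'" "open V" "F x0 \<in> V" "homeomorphism U' V F G"
      "\<And>i. lreg \<kappa> \<alpha> V (\<lambda>y. G y $ i)"
    then show ?thesis by blast
  qed
qed

text \<open>S is the zero set of F, and N is a multiple of the gradient of F at p. The map \<Psi>
  flattens S: it keeps the part orthogonal to N and replaces the N-coordinate by F. Its local
  inverse, evaluated on the hyperplane, parametrizes S, and the new graph function is the
  N-coordinate of that.\<close>

lemma graph_rep_change_direction:
  fixes S :: "(real^'n) set"
  assumes g: "graph_rep S p u \<kappa> \<alpha> f \<delta>" and u: "norm u = 1" and k: "\<kappa> \<noteq> Fin 0" and a: "\<alpha> \<le> 1" and p: "p \<in> S"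
    and N: "N = c *\<^sub>R (u - grad f p)" "norm N = 1"
  shows "\<exists>h \<epsilon>. graph_rep S p N \<kappa> \<alpha> h \<epsilon>"
proof -
  note g' = graph_repD[OF g]
  have NN: "N \<bullet> N = 1" using N(2) by (simp add: dot_square_norm)
  have c: "c \<noteq> 0" using N by auto
  have pb: "p \<in> ball p \<delta>" using g'(1) by simp
  define F where "F z = z \<bullet> u - f z" for z
  define Q where "Q z = z - (z \<bullet> N) *\<^sub>R N + 0" for z
  define \<Psi> where "\<Psi> z = Q z + F z *\<^sub>R N" for z
  have F0: "F p = 0" using g'(4)[OF pb] p by (simp add: F_def)
  have QN: "Q z \<bullet> N = 0" for z by (simp add: Q_def inner_diff_left NN)
  have "lreg \<kappa> \<alpha> (ball p \<delta>) F"
    unfolding F_def by (rule lreg_diff[OF open_ball a lreg_inner[OF open_ball a] g'(2)])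
  moreover have Qreg: "vreg \<kappa> \<alpha> U Q" if "open U" for U
    unfolding Q_def by (rule vreg_proj[OF that a])
  ultimately have "lreg \<kappa> \<alpha> (ball p \<delta>) (\<lambda>z. Q z $ i + F z * N $ i)" for i
    using Qreg[OF open_ball] by (intro lreg_add lreg_mult lreg_const open_ball a) auto
  then have \<Psi>reg: "vreg \<kappa> \<alpha> (ball p \<delta>) \<Psi>" by (simp add: \<Psi>_def)
  have "(\<Psi> has_derivative (\<lambda>v. v - (v \<bullet> N) *\<^sub>R N + (v \<bullet> u - grad f p \<bullet> v) *\<^sub>R N)) (at p)"
    unfolding \<Psi>_def Q_def F_def
    by (auto intro!: derivative_eq_intros graph_rep_der[OF g k u pb])
  \<comment> \<open>The derivative of F at p is the product with u - grad f p, that is N / c, so it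
    only rescales the N-coordinate.\<close>
  also have "(\<lambda>v. v - (v \<bullet> N) *\<^sub>R N + (v \<bullet> u - grad f p \<bullet> v) *\<^sub>R N) = (\<lambda>v. v - (v \<bullet> N) *\<^sub>R N + ((v \<bullet> N) / c) *\<^sub>R N)"
    using c by (simp add: N(1) inner_diff_right inner_commute)
  finally have D: "(\<Psi> has_derivative (\<lambda>v. v - (v \<bullet> N) *\<^sub>R N + ((v \<bullet> N) / c) *\<^sub>R N)) (at p)" .
  have inj: "v = 0" if v: "v - (v \<bullet> N) *\<^sub>R N + ((v \<bullet> N) / c) *\<^sub>R N = 0" for v
  proof -
    have "(v - (v \<bullet> N) *\<^sub>R N + ((v \<bullet> N) / c) *\<^sub>R N) \<bullet> N = (v \<bullet> N) / c"
      by (simp add: inner_add_left inner_diff_left NN)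
    then have "v \<bullet> N = 0" using v c by simp
    then show ?thesis using v by simp
  qed
  obtain U V \<Phi> where U: "open U" "U \<subseteq> ball p \<delta>" "p \<in> U" and V: "open V" "\<Psi> p \<in> V"
    and hom: "homeomorphism U V \<Psi> \<Phi>" and \<Phi>: "vreg \<kappa> \<alpha> V \<Phi>"
    using lreg_local_inverse_derivative[OF open_ball pb a k \<Psi>reg D inj] by blast
  have "isCont Q p" unfolding Q_def by (intro continuous_intros)
  moreover have "Q p \<in> V" using V(2) F0 by (simp add: \<Psi>_def)
  ultimately have "\<forall>\<^sub>F z in nhds p. Q z \<in> V" using isCont_eventually_in V(1) by blast
  moreover have "\<forall>\<^sub>F z in nhds p. z \<in> U" by (rule eventually_nhds_in_open[OF U(1,3)])
  ultimately have "\<forall>\<^sub>F z in nhds p. Q z \<in> V \<and> z \<in> U" by (rule eventually_conj)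
  then obtain \<epsilon> where \<epsilon>: "\<epsilon> > 0" "\<And>z. z \<in> ball p \<epsilon> \<Longrightarrow> Q z \<in> V \<and> z \<in> U"
    unfolding eventually_nhds_metric by (auto simp: dist_commute)
  have "graph_rep S p N \<kappa> \<alpha> (\<lambda>z. \<Phi> (Q z) \<bullet> N) \<epsilon>"
    unfolding graph_rep_def
  proof (intro conjI ballI allI impI)
    have "lreg \<kappa> \<alpha> (ball p \<epsilon>) (\<lambda>z. \<Phi> (Q z) $ i)" for i
    proof (rule lreg_compose[of V _ \<alpha> \<kappa> "\<lambda>z. \<Phi> z $ i" Q, OF V(1) open_ball a k])
      show "lreg \<kappa> \<alpha> V (\<lambda>z. \<Phi> z $ i)" using \<Phi> by blast
      show "lreg \<kappa> \<alpha> (ball p \<epsilon>) (\<lambda>z. Q z $ j)" for j using Qreg[OF open_ball] by blast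
    qed (use \<epsilon>(2) in blast)
    then show "lreg \<kappa> \<alpha> (ball p \<epsilon>) (\<lambda>z. \<Phi> (Q z) \<bullet> N)" by (intro lreg_vec_inner open_ball a)
    fix z assume z: "z \<in> ball p \<epsilon>"
    have "Q (z + t *\<^sub>R N) = Q z" for t by (simp add: Q_def inner_add_left NN algebra_simps)
    then show "\<Phi> (Q (z + t *\<^sub>R N)) \<bullet> N = \<Phi> (Q z) \<bullet> N" for t by simp
    have zU: "z \<in> U" "Q z \<in> V" using \<epsilon>(2)[OF z] by auto
    then have zb: "z \<in> ball p \<delta>" using U(2) by blast
    show "z \<in> S \<longleftrightarrow> z \<bullet> N = \<Phi> (Q z) \<bullet> N"
    proof
      assume "z \<in> S"
      then have "F z = 0" using g'(4)[OF zb] by (simp add: F_def)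
      then have "\<Phi> (Q z) = z" using hom zU(1) homeomorphism_apply1[OF hom zU(1)] by (simp add: \<Psi>_def)
      then show "z \<bullet> N = \<Phi> (Q z) \<bullet> N" by simp
    next
      assume eq: "z \<bullet> N = \<Phi> (Q z) \<bullet> N"
      let ?y = "\<Phi> (Q z)"
      have y: "\<Psi> ?y = Q z" by (rule homeomorphism_apply2[OF hom zU(2)])
      then have "\<Psi> ?y \<bullet> N = 0" by (simp add: QN)
      then have Fy: "F ?y = 0" by (simp add: \<Psi>_def inner_add_left QN NN)
      then have "Q ?y = Q z" using y by (simp add: \<Psi>_def)
      have cancel: "y = x" if "Q y = Q x" "x \<bullet> N = y \<bullet> N" for x y using that by (simp add: Q_def)
      have "?y = z" by (rule cancel[OF \<open>Q ?y = Q z\<close> eq])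
      then show "z \<in> S" using Fy g'(4)[OF zb] by (simp add: F_def)
    qed
  qed (rule \<epsilon>)
  then show ?thesis by blast
qed

section \<open>Normals and curvature of convex bodies\<close>

lemma supports_interior_neg:
  assumes c: "c \<in> interior C" and \<nu>: "supports C z \<nu>" "\<nu> \<noteq> 0"
  shows "(c - z) \<bullet> \<nu> < 0"
proof -
  obtain e where e: "e > 0" "ball c e \<subseteq> C" using c mem_interior by blast
  define t where "t = e / (2 * norm \<nu>)"
  have t: "t > 0" using e \<nu> by (simp add: t_def)
  have "norm (t *\<^sub>R \<nu>) < e" using e \<nu> by (simp add: t_def)
  then have "c + t *\<^sub>R \<nu> \<in> C" using e by (auto simp: dist_norm)
  then have "(c + t *\<^sub>R \<nu> - z) \<bullet> \<nu> \<le> 0" using \<nu>(1) unfolding supports_def by blast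
  then have "(c - z) \<bullet> \<nu> + t * (\<nu> \<bullet> \<nu>) \<le> 0" by (simp add: inner_diff_left inner_add_left)
  moreover have "t * (\<nu> \<bullet> \<nu>) > 0" using t \<nu> by simp
  ultimately show ?thesis by linarith
qed

lemma supports_imp_frontier:
  assumes "x \<in> C" "supports C x \<nu>" "\<nu> \<noteq> 0"
  shows "x \<in> frontier C"
  using supports_interior_neg[of x C x \<nu>] assms closure_subset[of C] by (auto simp: frontier_def)

lemma convex_body_facts:
  assumes "convex_body C"
  shows "closed C" "convex C" "compact C" "interior C \<noteq> {}" "frontier C \<subseteq> C"
  using assms by (auto simp: convex_body_def compact_imp_closed frontier_def closure_closed)

lemma supports_exists:
  assumes C: "convex_body C" and z: "z \<in> frontier C"
  obtains \<nu> where "norm \<nu> = 1" "supports C z \<nu>"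
proof -
  note C' = convex_body_facts[OF C]
  have "z \<in> closure C" "z \<notin> rel_interior C"
    using z C'(4) by (auto simp: frontier_def rel_interior_nonempty_interior)
  then obtain a where a: "a \<noteq> 0" "\<And>y. y \<in> closure C \<Longrightarrow> a \<bullet> z \<le> a \<bullet> y"
    using supporting_hyperplane_relative_frontier[OF C'(2)] by metis
  show ?thesis
  proof (rule that[of "- sgn a"])
    show "norm (- sgn a) = 1" using a by (simp add: norm_sgn)
    show "supports C z (- sgn a)" unfolding supports_def
    proof
      fix x assume "x \<in> C"
      then have "a \<bullet> z \<le> a \<bullet> x" using a(2) closure_subset by blast
      then have "0 \<le> a \<bullet> (x - z)" by (simp add: inner_diff_right)
      then have "0 \<le> (x - z) \<bullet> a" by (simp only: inner_commute)
      then have "0 \<le> (x - z) \<bullet> a / norm a" by simp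
      then show "(x - z) \<bullet> (- sgn a) \<le> 0" by (simp add: sgn_div_norm divide_inverse mult.commute)
    qed
  qed
qed

lemma body_graph_rep:
  assumes C: "convex_body C" and p: "p \<in> frontier C" and N: "supports C p N" "norm N = 1"
    and r: "body_reg_near C p \<kappa> \<alpha>" and k: "\<kappa> \<noteq> Fin 0" and a: "\<alpha> \<le> 1"
  obtains f \<delta> where "graph_rep (frontier C) p N \<kappa> \<alpha> f \<delta>"
proof -
  obtain u f \<delta> where u: "norm u = 1" and g: "graph_rep (frontier C) p u \<kappa> \<alpha> f \<delta>"
    using hypersurface_imp_graph_rep[OF r[unfolded body_reg_near_def] p k a] by blast
  have "p \<in> ball p \<delta>" using graph_repD(1)[OF g] by simp
  from graph_rep_normal[OF g k u this p convex_body_facts(5)[OF C] N(1)]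
  have "N = (N \<bullet> u) *\<^sub>R (u - grad f p)" .
  from graph_rep_change_direction[OF g u k a p this N(2)] that show ?thesis by blast
qed

text \<open>Being parallel to N - grad f z leaves the sign of a unit normal open. An interior point
  c decides it: (c - z) \<bullet> (N - grad f z) is negative at p and, by continuity, near p, and
  every nonzero supporting vector has negative product with c - z.\<close>

lemma graph_rep_outer_normal:
  assumes C: "convex_body C" and p: "p \<in> frontier C" and N: "supports C p N" "norm N = 1"
    and g: "graph_rep (frontier C) p N \<kappa> \<alpha> f \<delta>" and k: "\<kappa> \<noteq> Fin 0"
  obtains \<epsilon> where "0 < \<epsilon>" "\<epsilon> \<le> \<delta>"
    "\<And>z \<nu>. z \<in> ball p \<epsilon> \<Longrightarrow> z \<in> frontier C \<Longrightarrow> norm \<nu> = 1 \<Longrightarrow> supports C z \<nu> \<longleftrightarrow> \<nu> = sgn (N - grad f z)"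
    "\<And>z. z \<in> ball p \<epsilon> \<Longrightarrow> z \<in> frontier C \<Longrightarrow> outer_normal C z = sgn (N - grad f z)"
proof -
  note g' = graph_repD[OF g] and C' = convex_body_facts[OF C]
  obtain c where c: "c \<in> interior C" using C'(4) by blast
  have pb: "p \<in> ball p \<delta>" using g'(1) by simp
  have 0: "grad f p = 0" by (rule graph_rep_grad_zero[OF g k N(2) p C'(5) N(1)])
  have N0: "N \<noteq> 0" using N(2) by auto
  have "isCont (grad f) p"
    using lreg_grad_continuous[OF open_ball k g'(2)] pb open_ball continuous_on_eq_continuous_at by blast
  then have "isCont (\<lambda>z. (c - z) \<bullet> (N - grad f z)) p" by (intro continuous_intros)
  moreover have "(c - p) \<bullet> (N - grad f p) \<in> {..<0}"
    using supports_interior_neg[OF c N(1) N0] 0 by simp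
  ultimately have "\<forall>\<^sub>F z in nhds p. (c - z) \<bullet> (N - grad f z) \<in> {..<0}"
    using isCont_eventually_in open_lessThan by blast
  then obtain d where d: "d > 0" "\<And>z. dist z p < d \<Longrightarrow> (c - z) \<bullet> (N - grad f z) < 0"
    unfolding eventually_nhds_metric by auto
  define \<epsilon> where "\<epsilon> = min \<delta> d"
  have dir: "\<nu> = sgn (N - grad f z)" if z: "z \<in> ball p \<epsilon>" "z \<in> frontier C" and \<nu>: "norm \<nu> = 1" "supports C z \<nu>" for z \<nu>
  proof -
    have zb: "z \<in> ball p \<delta>" and neg: "(c - z) \<bullet> (N - grad f z) < 0"
      using z d(2)[of z] by (auto simp: \<epsilon>_def dist_commute)
    have eq: "\<nu> = (\<nu> \<bullet> N) *\<^sub>R (N - grad f z)"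
      by (rule graph_rep_normal[OF g k N(2) zb z(2) C'(5) \<nu>(2)])
    have "\<nu> \<noteq> 0" using \<nu>(1) by auto
    then have "(c - z) \<bullet> \<nu> < 0" by (rule supports_interior_neg[OF c \<nu>(2)])
    also have "(c - z) \<bullet> \<nu> = (\<nu> \<bullet> N) * ((c - z) \<bullet> (N - grad f z))" by (subst eq) simp
    finally have "\<nu> \<bullet> N > 0" using neg by (simp add: mult_less_0_iff)
    moreover have "\<nu> = sgn \<nu>" using \<nu>(1) by (simp add: sgn_div_norm)
    ultimately show ?thesis using arg_cong[OF eq, of sgn] by (simp add: sgn_scaleR)
  qed
  have iff: "supports C z \<nu> \<longleftrightarrow> \<nu> = sgn (N - grad f z)"
    if z: "z \<in> ball p \<epsilon>" "z \<in> frontier C" and \<nu>: "norm \<nu> = 1" for z \<nu>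
  proof
    assume "\<nu> = sgn (N - grad f z)"
    moreover obtain \<mu> where "norm \<mu> = 1" "supports C z \<mu>" using supports_exists[OF C z(2)] .
    ultimately show "supports C z \<nu>" using dir[OF z] by metis
  qed (use dir[OF z \<nu>] in blast)
  show ?thesis
  proof (rule that[of \<epsilon>])
    fix z assume z: "z \<in> ball p \<epsilon>" "z \<in> frontier C"
    obtain \<mu> where \<mu>: "norm \<mu> = 1" "supports C z \<mu>" using supports_exists[OF C z(2)] .
    have "outer_normal C z = \<mu>"
      unfolding outer_normal_def supports_def[symmetric]
    proof (rule the_equality)
      fix \<nu> assume "norm \<nu> = 1 \<and> supports C z \<nu>"
      then show "\<nu> = \<mu>" using dir[OF z, of \<nu>] dir[OF z \<mu>] by simp
    qed (use \<mu> in blast)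
    then show "outer_normal C z = sgn (N - grad f z)" using dir[OF z \<mu>] by simp
  qed (use g' d iff in \<open>auto simp: \<epsilon>_def\<close>)
qed

text \<open>At p the gradient of f vanishes, so the normalizing factor of N - grad f has derivative
  0 and the differential of the Gauss map on the tangent hyperplane is minus the Hessian.\<close>

lemma gauss_curvature_nonzero_iff:
  assumes C: "convex_body C" and p: "p \<in> frontier C" and N: "supports C p N" "norm N = 1"
    and g: "graph_rep (frontier C) p N \<kappa> \<alpha> f \<delta>" and k: "\<kappa> \<noteq> Fin 0" and k1: "\<kappa> \<noteq> Fin 1"
  shows "gauss_curvature C p \<noteq> 0 \<longleftrightarrow> (\<forall>v. v \<bullet> N = 0 \<and> hess f p v = 0 \<longrightarrow> v = 0)"
proof -
  note g' = graph_repD[OF g] and C' = convex_body_facts[OF C]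
  have NN: "N \<bullet> N = 1" using N(2) by (simp add: dot_square_norm)
  have pb: "p \<in> ball p \<delta>" using g'(1) by simp
  have 0: "grad f p = 0" by (rule graph_rep_grad_zero[OF g k N(2) p C'(5) N(1)])
  let ?H = "hess f p"
  have H: "(grad f has_derivative ?H) (at p)" by (rule lreg_hess[OF open_ball k k1 g'(2) pb])
  have HN: "?H v \<bullet> N = 0" for v
  proof -
    have "((\<lambda>z. grad f z \<bullet> N) has_derivative (\<lambda>v. ?H v \<bullet> N)) (at p)"
      by (rule has_derivative_inner_left[OF H])
    then have "((\<lambda>z. 0) has_derivative (\<lambda>v. ?H v \<bullet> N)) (at p)"
      by (rule has_derivative_transform_within_open[OF _ open_ball pb])
         (rule graph_rep_grad_orth[OF g k N(2)])
    from has_derivative_unique[OF this has_derivative_const] show ?thesis by (rule fun_cong)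
  qed
  obtain \<epsilon> where \<epsilon>: "0 < \<epsilon>" "\<epsilon> \<le> \<delta>"
    "\<And>z. z \<in> ball p \<epsilon> \<Longrightarrow> z \<in> frontier C \<Longrightarrow> outer_normal C z = sgn (N - grad f z)"
    using graph_rep_outer_normal[OF C p N g k] by metis
  have n: "sgn (N - grad f z) = inverse (sqrt (1 + grad f z \<bullet> grad f z)) *\<^sub>R (N - grad f z)" if "z \<in> ball p \<delta>" for z
  proof -
    have "N \<bullet> grad f z = 0" using graph_rep_grad_orth[OF g k N(2) that] by (simp add: inner_commute)
    then have "(N - grad f z) \<bullet> (N - grad f z) = 1 + grad f z \<bullet> grad f z"
      by (simp add: inner_diff_left inner_diff_right NN inner_commute)
    then show ?thesis by (simp add: sgn_div_norm norm_eq_sqrt_inner)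
  qed
  have "((\<lambda>z. 1 + grad f z \<bullet> grad f z) has_derivative (\<lambda>v. 0 + (grad f p \<bullet> ?H v + ?H v \<bullet> grad f p))) (at p)"
    by (intro has_derivative_add has_derivative_const has_derivative_inner H)
  from has_derivative_real_sqrt[OF _ this]
  have "((\<lambda>z. sqrt (1 + grad f z \<bullet> grad f z)) has_derivative (\<lambda>v. 0)) (at p)" by (simp add: 0)
  from Deriv.has_derivative_inverse[OF _ this]
  have "((\<lambda>z. inverse (sqrt (1 + grad f z \<bullet> grad f z))) has_derivative (\<lambda>v. 0)) (at p)" by (simp add: 0)
  from has_derivative_scaleR[OF this has_derivative_diff[OF has_derivative_const[of N] H]]
  have dn: "((\<lambda>z. inverse (sqrt (1 + grad f z \<bullet> grad f z)) *\<^sub>R (N - grad f z)) has_derivative (\<lambda>v. - ?H v)) (at p)"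
    by (simp add: 0)
  have dO: "(outer_normal C has_derivative (\<lambda>v. - ?H v)) (at p within frontier C)"
  proof (rule has_derivative_transform_within[OF has_derivative_at_withinI[OF dn] \<epsilon>(1) p])
    fix z assume z: "z \<in> frontier C" "dist z p < \<epsilon>"
    then have "z \<in> ball p \<epsilon>" "z \<in> ball p \<delta>" using \<epsilon>(2) by (auto simp: dist_commute)
    then show "inverse (sqrt (1 + grad f z \<bullet> grad f z)) *\<^sub>R (N - grad f z) = outer_normal C z"
      using \<epsilon>(3) n z(1) by simp
  qed
  have oN: "outer_normal C p = N" using \<epsilon>(1,3) p 0 N(2) by (simp add: sgn_div_norm)
  define L where "L = (SOME L. (outer_normal C has_derivative L) (at p within frontier C))"
  have L: "(outer_normal C has_derivative L) (at p within frontier C)"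
    unfolding L_def by (rule someI[of _ "\<lambda>v. - ?H v"]) (rule dO)
  \<comment> \<open>A derivative within the boundary is determined only on tangent vectors, so the
    chosen L and minus the Hessian are compared along a boundary curve with velocity v.\<close>
  have Lv: "L v = - ?H v" if v: "v \<bullet> N = 0" for v
  proof -
    obtain e where e: "e > 0" "\<And>t. \<bar>t\<bar> < e \<Longrightarrow> p + t *\<^sub>R v + (f (p + t *\<^sub>R v) - p \<bullet> N - t * (v \<bullet> N)) *\<^sub>R N \<in> frontier C \<inter> ball p \<delta>"
      and d: "((\<lambda>t. p + t *\<^sub>R v + (f (p + t *\<^sub>R v) - p \<bullet> N - t * (v \<bullet> N)) *\<^sub>R N) has_derivative
        (\<lambda>h. h *\<^sub>R (v + (grad f p \<bullet> v - v \<bullet> N) *\<^sub>R N))) (at 0)"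
      using graph_rep_curve[OF g k N(2) pb p, of v] by blast
    let ?c = "\<lambda>t. p + t *\<^sub>R v + (f (p + t *\<^sub>R v) - p \<bullet> N - t * (v \<bullet> N)) *\<^sub>R N"
    have c0: "?c 0 = p" using g'(4)[OF pb] p by simp
    have d': "(?c has_derivative (\<lambda>h. h *\<^sub>R v)) (at 0)" using d v 0 by simp
    have chain: "((\<lambda>t. outer_normal C (?c t)) has_derivative (\<lambda>h. M (h *\<^sub>R v))) (at 0)"
      if M: "(outer_normal C has_derivative M) (at p within frontier C)" for M
    proof -
      have sub: "?c ` ball 0 e \<subseteq> frontier C" using e(2) by (auto simp: dist_norm)
      have "(outer_normal C has_derivative M) (at (?c 0) within ?c ` ball 0 e)"
        unfolding c0 by (rule has_derivative_subset[OF M sub])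
      from diff_chain_within[OF has_derivative_at_withinI[OF d'] this]
      have "((\<lambda>t. outer_normal C (?c t)) has_derivative (\<lambda>h. M (h *\<^sub>R v))) (at 0 within ball 0 e)"
        by (simp add: o_def)
      then show ?thesis using e(1) by (simp add: at_within_open[OF centre_in_ball[THEN iffD2] open_ball])
    qed
    have "(\<lambda>h. L (h *\<^sub>R v)) = (\<lambda>h. - ?H (h *\<^sub>R v))"
      by (rule has_derivative_unique[OF chain[OF L] chain[OF dO]])
    from fun_cong[OF this, of 1] show ?thesis by simp
  qed
  define M where "M v = - ?H (v - (v \<bullet> N) *\<^sub>R N) + (v \<bullet> N) *\<^sub>R N" for v
  have proj: "(v - (v \<bullet> N) *\<^sub>R N) \<bullet> N = 0" for v by (simp add: inner_diff_left NN)
  have "gauss_curvature C p = det (matrix M)"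
    unfolding gauss_curvature_def Let_def oN L_def[symmetric] M_def by (simp add: Lv[OF proj])
  moreover have linM: "linear M"
    unfolding M_def
    by (rule linearI) (auto simp: linear_add[OF linear_hess] linear_diff[OF linear_hess] linear_cmul[OF linear_hess]
        inner_add_left algebra_simps)
  ultimately have "gauss_curvature C p \<noteq> 0 \<longleftrightarrow> (\<forall>v. M v = 0 \<longrightarrow> v = 0)"
    by (simp add: det_nz_iff_inj linear_injective_0)
  also have "\<dots> \<longleftrightarrow> (\<forall>v. v \<bullet> N = 0 \<and> ?H v = 0 \<longrightarrow> v = 0)"
  proof (intro iffI allI impI)
    fix v assume *: "\<forall>v. M v = 0 \<longrightarrow> v = 0" and "v \<bullet> N = 0 \<and> ?H v = 0"
    then have "M v = 0" by (simp add: M_def)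
    then show "v = 0" using * by blast
  next
    fix v assume *: "\<forall>v. v \<bullet> N = 0 \<and> ?H v = 0 \<longrightarrow> v = 0" and v: "M v = 0"
    have "M v \<bullet> N = v \<bullet> N" by (simp add: M_def inner_add_left inner_diff_left NN HN)
    then have "v \<bullet> N = 0" using v by simp
    moreover have "?H v = 0" using v calculation by (simp add: M_def)
    ultimately show "v = 0" using * by blast
  qed
  finally show ?thesis .
qed

section \<open>Symmetry, sign and kernel of the Hessian of a boundary graph\<close>

lemma vreg_grad:
  assumes "open U" "\<kappa> \<noteq> Fin 0" "lreg \<kappa> \<alpha> U f"
  shows "vreg (spred \<kappa>) \<alpha> U (grad f)"
  using lreg_pd(2)[OF assms] by simp

lemma graph_rep_hess_symmetric:
  assumes g: "graph_rep S p N \<kappa> \<alpha> f \<delta>" and k: "\<kappa> \<noteq> Fin 0" "\<kappa> \<noteq> Fin 1" and N: "norm N = 1"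
  shows "hess f p v \<bullet> w = hess f p w \<bullet> v"
proof (rule hessian_symmetric[OF graph_repD(1)[OF g] graph_rep_der[OF g k(1) N]])
  show "(grad f has_derivative hess f p) (at p)"
    using graph_repD(1)[OF g] by (intro lreg_hess[OF open_ball k graph_repD(2)[OF g]]) simp
qed

text \<open>The graph function has a local maximum at \<open>p\<close>, so its Hessian is negative semidefinite.\<close>
lemma graph_rep_hess_nonpos:
  assumes g: "graph_rep S p N \<kappa> \<alpha> f \<delta>" and k: "\<kappa> \<noteq> Fin 0" "\<kappa> \<noteq> Fin 1" and N: "norm N = 1"
    and p: "p \<in> S" "S \<subseteq> C" "supports C p N"
  shows "hess f p v \<bullet> v \<le> 0"
proof -
  note g' = graph_repD[OF g]
  have NN: "N \<bullet> N = 1" using N by (simp add: dot_square_norm)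
  have pb: "p \<in> ball p \<delta>" using g'(1) by simp
  have fp: "f p = p \<bullet> N" using g'(4)[OF pb] p(1) by simp
  have "isCont f p" using graph_rep_der[OF g k(1) N pb] has_derivative_continuous by blast
  \<comment> \<open>\<open>supports\<close> controls only points of the body, so f z is compared
    with f p through the point of S on the line through z in direction N.\<close>
  then have "isCont (\<lambda>z. z + (f z - z \<bullet> N) *\<^sub>R N) p" by (intro continuous_intros)
  then have "\<forall>\<^sub>F z in nhds p. z + (f z - z \<bullet> N) *\<^sub>R N \<in> ball p \<delta>"
    by (rule isCont_eventually_in[OF _ open_ball]) (use fp g'(1) in simp)
  then obtain d where d: "d > 0" "\<And>z. dist z p < d \<Longrightarrow> z + (f z - z \<bullet> N) *\<^sub>R N \<in> ball p \<delta>"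
    unfolding eventually_nhds_metric by blast
  let ?d = "min d \<delta>"
  show ?thesis
  proof (rule hessian_nonpos_local_max[of ?d p f])
    show "?d > 0" using d g'(1) by simp
    show "(f has_derivative (\<lambda>v. grad f z \<bullet> v)) (at z)" if "z \<in> ball p ?d" for z
      using that by (intro graph_rep_der[OF g k(1) N]) simp
    show "(grad f has_derivative hess f p) (at p)" by (rule lreg_hess[OF open_ball k g'(2) pb])
    show "grad f p = 0" by (rule graph_rep_grad_zero[OF g k(1) N p])
    fix z assume "z \<in> ball p ?d"
    then have z: "z \<in> ball p \<delta>" "z + (f z - z \<bullet> N) *\<^sub>R N \<in> ball p \<delta>" using d(2)[of z] by (auto simp: dist_commute)
    let ?z = "z + (f z - z \<bullet> N) *\<^sub>R N"
    have "?z \<bullet> N = f z" by (simp add: inner_add_left NN)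
    then have "?z \<in> S" using g'(3)[OF z] g'(4)[OF z(2)] by simp
    then have "(?z - p) \<bullet> N \<le> 0" using p unfolding supports_def by blast
    then show "f z \<le> f p" using \<open>?z \<bullet> N = f z\<close> fp by (simp add: inner_diff_left)
  qed
qed

lemma graph_rep_hess_orth:
  assumes g: "graph_rep S p N \<kappa> \<alpha> f \<delta>" and k: "\<kappa> \<noteq> Fin 0" "\<kappa> \<noteq> Fin 1" and N: "norm N = 1"
  shows "hess f p v \<bullet> N = 0"
proof -
  have pb: "p \<in> ball p \<delta>" using graph_repD(1)[OF g] by simp
  have "((\<lambda>z. grad f z \<bullet> N) has_derivative (\<lambda>v. hess f p v \<bullet> N)) (at p)"
    by (rule has_derivative_inner_left[OF lreg_hess[OF open_ball k graph_repD(2)[OF g] pb]])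
  then have "((\<lambda>z. 0) has_derivative (\<lambda>v. hess f p v \<bullet> N)) (at p)"
    by (rule has_derivative_transform_within_open[OF _ open_ball pb])
       (rule graph_rep_grad_orth[OF g k(1) N])
  from has_derivative_unique[OF this has_derivative_const] show ?thesis by (rule fun_cong)
qed

lemma graph_rep_hess_definite:
  assumes g: "graph_rep S p N \<kappa> \<alpha> f \<delta>" and k: "\<kappa> \<noteq> Fin 0" "\<kappa> \<noteq> Fin 1" and N: "norm N = 1"
    and p: "p \<in> S" "S \<subseteq> C" "supports C p N"
    and inj: "\<And>v. v \<bullet> N = 0 \<Longrightarrow> hess f p v = 0 \<Longrightarrow> v = 0" and w: "w \<bullet> N = 0" "hess f p w \<bullet> w = 0"
  shows "w = 0"
  by (rule inj[OF w(1) semidefinite_kernel[OF linear_hess graph_rep_hess_symmetric[OF g k N]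
        graph_rep_hess_nonpos[OF g k N p] w(2)]])

text \<open>By strict concavity at \<open>a\<close>, the face of \<open>A\<close> with normal \<open>N\<close> is \<open>{a}\<close>; hence by compactness every
  decomposition of a point near \<open>a + b\<close> has its first component near \<open>a\<close>.\<close>
lemma decomposition_near:
  assumes A: "convex_body A" and B: "compact B" and a: "a \<in> frontier A" "supports A a N" and b: "supports B b N"
    and N: "norm N = 1" and g: "graph_rep (frontier A) a N \<kappa> \<alpha> f \<delta>" and k: "\<kappa> \<noteq> Fin 0" "\<kappa> \<noteq> Fin 1"
    and inj: "\<And>v. v \<bullet> N = 0 \<Longrightarrow> hess f a v = 0 \<Longrightarrow> v = 0" and e: "e > 0"
  shows "\<exists>d>0. \<forall>x\<in>A. \<forall>y\<in>B. dist (x + y) (a + b) < d \<longrightarrow> dist x a < e"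
proof (rule ccontr)
  note A' = convex_body_facts[OF A] and g' = graph_repD[OF g]
  have ab: "a \<in> ball a \<delta>" using g'(1) by simp
  have N0: "N \<noteq> 0" using N by auto
  assume neg: "\<not> ?thesis"
  have "\<exists>x y. x \<in> A \<and> y \<in> B \<and> dist (x + y) (a + b) < 1 / real (Suc n) \<and> \<not> dist x a < e" for n
    using neg by (metis of_nat_0_less_iff zero_less_Suc zero_less_divide_1_iff)
  then obtain x y where xy: "\<And>n. x n \<in> A" "\<And>n. y n \<in> B" "\<And>n. dist (x n + y n) (a + b) < 1 / real (Suc n)" "\<And>n. \<not> dist (x n) a < e"
    by metis
  obtain x' r where x': "x' \<in> A" and r: "strict_mono r" "(x \<circ> r) \<longlonglongrightarrow> x'"
    using A'(3) xy(1) unfolding compact_def by blast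
  have "(\<lambda>n. x n + y n) \<longlonglongrightarrow> a + b"
  proof (rule metric_LIMSEQ_I)
    fix \<epsilon> :: real assume "\<epsilon> > 0"
    then obtain m where m: "1 / real (Suc m) < \<epsilon>" using nat_approx_posE by blast
    have "dist (x n + y n) (a + b) < \<epsilon>" if "n \<ge> m" for n
    proof -
      have "1 / real (Suc n) \<le> 1 / real (Suc m)" using that by (simp add: frac_le)
      then show ?thesis using xy(3)[of n] m by linarith
    qed
    then show "\<exists>m. \<forall>n\<ge>m. dist (x n + y n) (a + b) < \<epsilon>" by blast
  qed
  from LIMSEQ_subseq_LIMSEQ[OF this r(1)]
  have "(\<lambda>n. x (r n) + y (r n)) \<longlonglongrightarrow> a + b" unfolding o_def .
  from tendsto_diff[OF this r(2)[unfolded o_def]]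
  have "(\<lambda>n. y (r n)) \<longlonglongrightarrow> a + b - x'" by simp
  then have y': "a + b - x' \<in> B" by (rule closed_sequentially[OF compact_imp_closed[OF B] xy(2)])
  have "(x' - a) \<bullet> N \<le> 0" using x' a(2) unfolding supports_def by blast
  moreover have "(a + b - x' - b) \<bullet> N \<le> 0" using y' b unfolding supports_def by blast
  \<comment> \<open>The N-heights of x' - a and of (a + b - x') - b are opposite and both at most 0,
    so both vanish: the limit lies in the face of A with normal N.\<close>
  ultimately have xN: "(x' - a) \<bullet> N = 0" by (simp add: inner_diff_left algebra_simps)
  have "(\<lambda>n. dist (x (r n)) a) \<longlonglongrightarrow> dist x' a" using r(2)[unfolded o_def] by (intro tendsto_intros)
  then have "e \<le> dist x' a"
    by (rule LIMSEQ_le_const) (use xy(4) in \<open>auto simp: not_less\<close>)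
  then have w0: "x' - a \<noteq> 0" using e by auto
  define w where "w = x' - a"
  have "isCont (\<lambda>t. a + t *\<^sub>R w) 0" by (intro continuous_intros)
  then have "\<forall>\<^sub>F t in nhds 0. a + t *\<^sub>R w \<in> ball a \<delta>"
    by (rule isCont_eventually_in[OF _ open_ball]) (use ab in simp)
  then obtain s where s: "s > 0" "\<And>t. \<bar>t\<bar> < s \<Longrightarrow> a + t *\<^sub>R w \<in> ball a \<delta>"
    unfolding eventually_nhds_metric by (auto simp: dist_norm)
  define c where "c = min s 1"
  have c: "c > 0" "c \<le> s" "c \<le> 1" using s by (auto simp: c_def)
  \<comment> \<open>The segment from a to x' lies in that face, hence in the boundary, so f is
    constant along it near a; this will force the Hessian form to vanish in direction w.\<close>
  have fc: "f (a + t *\<^sub>R w) = a \<bullet> N" if t: "0 \<le> t" "t < c" for t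
  proof -
    have "a + t *\<^sub>R w = (1 - t) *\<^sub>R a + t *\<^sub>R x'" by (simp add: w_def algebra_simps)
    moreover have "a \<in> A" using a(1) A'(5) by blast
    ultimately have inA: "a + t *\<^sub>R w \<in> A" using convexD[OF A'(2) \<open>a \<in> A\<close> x', of "1 - t" t] t c by simp
    have wN: "(a + t *\<^sub>R w) \<bullet> N = a \<bullet> N" using xN by (simp add: inner_add_left w_def)
    have "supports A (a + t *\<^sub>R w) N"
      using a(2) wN unfolding supports_def by (simp add: inner_diff_left)
    then have "a + t *\<^sub>R w \<in> frontier A" by (rule supports_imp_frontier[OF inA _ N0])
    moreover have "a + t *\<^sub>R w \<in> ball a \<delta>" using s(2)[of t] t c by simp
    ultimately show ?thesis using g'(4) wN by metis
  qed
  have gr: "grad f (a + t *\<^sub>R w) \<bullet> w = 0" if t: "0 < t" "t < c" for t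
  proof -
    have tb: "a + t *\<^sub>R w \<in> ball a \<delta>" using s(2)[of t] t c by simp
    have "((\<lambda>t. a + t *\<^sub>R w) has_derivative (\<lambda>h. h *\<^sub>R w)) (at t)"
      by (auto intro!: derivative_eq_intros)
    from diff_chain_at[OF this graph_rep_der[OF g k(1) N tb]]
    have "((\<lambda>t. f (a + t *\<^sub>R w)) has_derivative (\<lambda>h. h * (grad f (a + t *\<^sub>R w) \<bullet> w))) (at t)"
      by (simp add: o_def)
    then have "((\<lambda>t. a \<bullet> N) has_derivative (\<lambda>h. h * (grad f (a + t *\<^sub>R w) \<bullet> w))) (at t)"
      by (rule has_derivative_transform_within_open[OF _ open_greaterThanLessThan[of 0 c]]) (use t fc in auto)
    from has_derivative_unique[OF this has_derivative_const]
    have "1 * (grad f (a + t *\<^sub>R w) \<bullet> w) = 0" by (rule fun_cong)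
    then show ?thesis by simp
  qed
  have g0: "grad f a = 0" by (rule graph_rep_grad_zero[OF g k(1) N a(1) A'(5) a(2)])
  have ww: "w \<bullet> w > 0" using w0 by (simp add: w_def)
  have "\<bar>hess f a w \<bullet> w\<bar> \<le> 0 + \<epsilon>" if \<epsilon>: "\<epsilon> > 0" for \<epsilon>
  proof -
    obtain d where d: "d > 0" "\<And>y. norm y < d \<Longrightarrow> norm (grad f (a + y) - grad f a - hess f a y) \<le> (\<epsilon> / (w \<bullet> w)) * norm y"
      using has_derivative_at_eps[OF lreg_hess[OF open_ball k g'(2) ab], of "\<epsilon> / (w \<bullet> w)"] \<epsilon> ww by auto
    define t where "t = min c (d / norm w) / 2"
    have nw: "norm w > 0" using ww by auto
    have t: "0 < t" "t < c" using c d nw by (auto simp: t_def min_def)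
    have "t \<le> d / norm w / 2" unfolding t_def by (rule divide_right_mono) auto
    also have "\<dots> < d / norm w" using d(1) nw half_gt_zero[of "d / norm w"] field_sum_of_halves[of "d / norm w"]
      by (smt (verit) divide_pos_pos)
    finally have "t < d / norm w" .
    then have "norm (t *\<^sub>R w) < d" using t nw by (simp add: pos_less_divide_eq)
    from d(2)[OF this] have "norm (grad f (a + t *\<^sub>R w) - t *\<^sub>R hess f a w) \<le> (\<epsilon> / (w \<bullet> w)) * (t * norm w)"
      using t by (simp add: g0 linear_cmul[OF linear_hess])
    then have "norm (grad f (a + t *\<^sub>R w) - t *\<^sub>R hess f a w) * norm w \<le> (\<epsilon> / (w \<bullet> w)) * (t * norm w) * norm w"
      by (rule mult_right_mono) simp
    also have "\<dots> = t * \<epsilon>" using ww nw by (simp add: dot_square_norm power2_eq_square)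
    finally have "\<bar>(grad f (a + t *\<^sub>R w) - t *\<^sub>R hess f a w) \<bullet> w\<bar> \<le> t * \<epsilon>"
      using Cauchy_Schwarz_ineq2 order_trans by blast
    then have "t * \<bar>hess f a w \<bullet> w\<bar> \<le> t * \<epsilon>"
      using gr[OF t] t by (simp add: inner_diff_left abs_mult)
    then show ?thesis using t by simp
  qed
  then have "\<bar>hess f a w \<bullet> w\<bar> \<le> 0" by (rule field_le_epsilon)
  then have "hess f a w \<bullet> w = 0" by simp
  moreover have "w \<bullet> N = 0" using xN by (simp add: w_def)
  ultimately have "w = 0"
    using graph_rep_hess_definite[OF g k N a(1) A'(5) a(2) inj, of w] by blast
  then show False using w0 by (simp add: w_def)
qed

section \<open>Minkowski sums\<close>

lemma spred_nonzero: "\<kappa> \<noteq> Fin 0 \<Longrightarrow> \<kappa> \<noteq> Fin 1 \<Longrightarrow> spred \<kappa> \<noteq> Fin 0"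
  by (cases \<kappa>) auto

lemma convex_body_minkowski_sum:
  assumes A: "convex_body A" and B: "convex_body B"
  shows "convex_body (minkowski_sum A B)"
proof -
  note A' = convex_body_facts[OF A] and B' = convex_body_facts[OF B]
  have eq: "minkowski_sum A B = (\<Union>x\<in>A. \<Union>y\<in>B. {x + y})" by (auto simp: minkowski_sum_def)
  have "compact (minkowski_sum A B)"
    unfolding minkowski_sum_def by (rule compact_sums[OF A'(3) B'(3)])
  moreover have "convex (minkowski_sum A B)" unfolding eq by (rule convex_sums[OF A'(2) B'(2)])
  moreover have "interior (minkowski_sum A B) \<noteq> {}"
  proof -
    obtain y where y: "y \<in> B" using B'(4) interior_subset by blast
    have "(+) y ` interior A \<subseteq> interior (minkowski_sum A B)"
    proof (rule interior_maximal)
      show "(+) y ` interior A \<subseteq> minkowski_sum A B"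
        using y interior_subset by (force simp: minkowski_sum_def add.commute)
    qed (simp add: open_translation)
    then show ?thesis using A'(4) by blast
  qed
  ultimately show ?thesis by (simp add: convex_body_def)
qed

lemma supports_minkowski_sum:
  assumes "x \<in> A" "y \<in> B"
  shows "supports (minkowski_sum A B) (x + y) \<nu> \<longleftrightarrow> supports A x \<nu> \<and> supports B y \<nu>"
proof
  assume s: "supports (minkowski_sum A B) (x + y) \<nu>"
  have "(u - x) \<bullet> \<nu> \<le> 0" if "u \<in> A" for u
  proof -
    have "u + y \<in> minkowski_sum A B" using that assms by (auto simp: minkowski_sum_def)
    then have "(u + y - (x + y)) \<bullet> \<nu> \<le> 0" using s unfolding supports_def by blast
    then show ?thesis by simp
  qed
  moreover have "(v - y) \<bullet> \<nu> \<le> 0" if "v \<in> B" for v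
  proof -
    have "x + v \<in> minkowski_sum A B" using that assms by (auto simp: minkowski_sum_def)
    then have "(x + v - (x + y)) \<bullet> \<nu> \<le> 0" using s unfolding supports_def by blast
    then show ?thesis by simp
  qed
  ultimately show "supports A x \<nu> \<and> supports B y \<nu>" by (simp add: supports_def)
next
  assume s: "supports A x \<nu> \<and> supports B y \<nu>"
  show "supports (minkowski_sum A B) (x + y) \<nu>" unfolding supports_def
  proof
    fix w assume "w \<in> minkowski_sum A B"
    then obtain u v where w: "w = u + v" "u \<in> A" "v \<in> B" by (auto simp: minkowski_sum_def)
    then have "(u - x) \<bullet> \<nu> \<le> 0" "(v - y) \<bullet> \<nu> \<le> 0" using s unfolding supports_def by blast+
    then show "(w - (x + y)) \<bullet> \<nu> \<le> 0" by (simp add: w inner_diff_left inner_add_left)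
  qed
qed

text \<open>Both vectors have N-coordinate 1, so being positive multiples of each other they
  coincide. This turns a common unit normal of two graphs into equal gradients.\<close>

lemma sgn_orth_eq:
  fixes N G1 G2 :: "'a::real_inner"
  assumes N: "norm N = 1" and G: "G1 \<bullet> N = 0" "G2 \<bullet> N = 0" and eq: "sgn (N - G1) = sgn (N - G2)"
  shows "G1 = G2"
proof -
  have NN: "N \<bullet> N = 1" using N by (simp add: dot_square_norm)
  have d: "(N - G1) \<bullet> N = 1" "(N - G2) \<bullet> N = 1" using G NN by (auto simp: inner_diff_left)
  then have nz: "N - G1 \<noteq> 0" "N - G2 \<noteq> 0" by auto
  define r where "r = norm (N - G1) / norm (N - G2)"
  have "N - G1 = norm (N - G1) *\<^sub>R sgn (N - G1)" using nz by (simp add: sgn_div_norm)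
  then have e: "N - G1 = r *\<^sub>R (N - G2)" using nz unfolding eq by (simp add: sgn_div_norm r_def divide_inverse)
  then have "r = 1" using arg_cong[OF e, of "\<lambda>v. v \<bullet> N"] d by simp
  then show ?thesis using e by simp
qed

text \<open>The class \<kappa> excludes \<open>Fin 0\<close> and \<open>Fin 1\<close>, so gradients
  are at least C^1; \<open>inj\<close> expresses the nonvanishing curvature of A through the
  particular f. One locale serves both C^2 and the class at hand, so it is interpreted several times
  with different data.\<close>

locale minkowski_local =
  fixes A B :: "(real^'n) set" and a b N :: "real^'n" and \<kappa> \<alpha> f \<delta> g \<rho>
  assumes A: "convex_body A" and B: "convex_body B"
    and a: "a \<in> frontier A" "supports A a N" and b: "b \<in> frontier B" "supports B b N"
    and N: "norm N = 1" and k: "\<kappa> \<noteq> Fin 0" "\<kappa> \<noteq> Fin 1" and al: "\<alpha> \<le> 1"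
    and f: "graph_rep (frontier A) a N \<kappa> \<alpha> f \<delta>" and g: "graph_rep (frontier B) b N \<kappa> \<alpha> g \<rho>"
    and inj: "\<And>v. v \<bullet> N = 0 \<Longrightarrow> hess f a v = 0 \<Longrightarrow> v = 0"
begin

text \<open>The gradient of \<open>f - ((x - a) \<bullet> N)\<^sup>2 / 2\<close>: the quadratic term removes the degeneracy along \<open>N\<close>.\<close>
definition Theta :: "real^'n \<Rightarrow> real^'n" where
  "Theta x = grad f x - (x \<bullet> N - a \<bullet> N) *\<^sub>R N"

lemma NN: "N \<bullet> N = 1" using N by (simp add: dot_square_norm)

lemma a_ball: "a \<in> ball a \<delta>" and b_ball: "b \<in> ball b \<rho>"
  using graph_repD(1)[OF f] graph_repD(1)[OF g] by auto

lemma grad_fa: "grad f a = 0"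
  by (rule graph_rep_grad_zero[OF f k(1) N a(1) convex_body_facts(5)[OF A] a(2)])

lemma grad_gb: "grad g b = 0"
  by (rule graph_rep_grad_zero[OF g k(1) N b(1) convex_body_facts(5)[OF B] b(2)])

lemma f_a: "f a = a \<bullet> N" and g_b: "g b = b \<bullet> N"
  using graph_repD(4)[OF f a_ball] graph_repD(4)[OF g b_ball] a b by auto

lemma k': "spred \<kappa> \<noteq> Fin 0"
  by (rule spred_nonzero[OF k])

lemma Theta_a: "Theta a = 0" by (simp add: Theta_def grad_fa)

lemma vreg_Theta: "vreg (spred \<kappa>) \<alpha> (ball a \<delta>) Theta"
  unfolding Theta_def using vreg_grad[OF open_ball k(1) graph_repD(2)[OF f]]
  by (auto intro!: lreg_diff lreg_mult lreg_inner lreg_const al)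

lemma Theta_derivative: "(Theta has_derivative (\<lambda>v. hess f a v - (v \<bullet> N) *\<^sub>R N)) (at a)"
  unfolding Theta_def
  by (auto intro!: derivative_eq_intros lreg_hess[OF open_ball k graph_repD(2)[OF f] a_ball])

lemma hess_f_orth: "hess f a v \<bullet> N = 0"
  by (rule graph_rep_hess_orth[OF f k N])

lemma Theta_derivative_inj:
  assumes "hess f a v - (v \<bullet> N) *\<^sub>R N = 0"
  shows "v = 0"
proof -
  have "(hess f a v - (v \<bullet> N) *\<^sub>R N) \<bullet> N = - (v \<bullet> N)" by (simp add: inner_diff_left hess_f_orth NN)
  then have vN: "v \<bullet> N = 0" using assms by simp
  then show ?thesis using inj[OF vN] assms by simp
qed

text \<open>Pairing the equation with v gives a sum of three nonpositive terms, so each vanishes.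
  The square puts v into the hyperplane orthogonal to N, where the form of f is definite. Only the
  sign of the form of g enters, so B may be flat at b.\<close>

lemma sum_derivative_inj:
  assumes "hess f a v - (v \<bullet> N) *\<^sub>R N + hess g b v = 0"
  shows "v = 0"
proof -
  have 1: "hess f a v \<bullet> v \<le> 0"
    by (rule graph_rep_hess_nonpos[OF f k N a(1) convex_body_facts(5)[OF A] a(2)])
  have 2: "hess g b v \<bullet> v \<le> 0"
    by (rule graph_rep_hess_nonpos[OF g k N b(1) convex_body_facts(5)[OF B] b(2)])
  have "(hess f a v - (v \<bullet> N) *\<^sub>R N + hess g b v) \<bullet> v = hess f a v \<bullet> v - (v \<bullet> N)^2 + hess g b v \<bullet> v"
    by (simp add: inner_diff_left inner_add_left inner_commute[of N v] power2_eq_square)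
  then have "hess f a v \<bullet> v - (v \<bullet> N)^2 + hess g b v \<bullet> v = 0" using assms by simp
  moreover have "(v \<bullet> N)^2 \<ge> 0" by simp
  ultimately have "hess f a v \<bullet> v = 0" "(v \<bullet> N)^2 = 0" using 1 2 by linarith+
  then show ?thesis
    using graph_rep_hess_definite[OF f k N a(1) convex_body_facts(5)[OF A] a(2) inj, of v] by auto
qed

text \<open>The derivative of Z at b is I + D\<phi> Hess g with D\<phi> a right inverse of the
  derivative of \<open>Theta\<close>. Applying the latter to a kernel vector gives the equation
  excluded by \<open>sum_derivative_inj\<close>.\<close>

lemma local_inverses:
  "\<exists>U W \<phi> V V' Y. open U \<and> U \<subseteq> ball a \<delta> \<and> a \<in> U \<and> open W \<and> homeomorphism U W Theta \<phi> \<and> vreg (spred \<kappa>) \<alpha> W \<phi> \<and>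
     open V \<and> V \<subseteq> ball b \<rho> \<and> b \<in> V \<and> grad g ` V \<subseteq> W \<and> open V' \<and> a + b \<in> V' \<and> \<phi> 0 = a \<and>
     homeomorphism V V' (\<lambda>y. y + \<phi> (grad g y)) Y \<and> vreg (spred \<kappa>) \<alpha> V (\<lambda>y. y + \<phi> (grad g y)) \<and> vreg (spred \<kappa>) \<alpha> V' Y"
proof -
  obtain U W \<phi> where U: "open U" "U \<subseteq> ball a \<delta>" "a \<in> U" and W: "open W" "0 \<in> W"
    and hom: "homeomorphism U W Theta \<phi>" and \<phi>: "vreg (spred \<kappa>) \<alpha> W \<phi>"
    using lreg_local_inverse_derivative[OF open_ball a_ball al k' vreg_Theta Theta_derivative Theta_derivative_inj]
    unfolding Theta_a by blast
  have \<phi>0: "\<phi> 0 = a" using homeomorphism_apply1[OF hom U(3)] by (simp add: Theta_a)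
  let ?T = "ball b \<rho> \<inter> grad g -` W"
  have T: "open ?T"
    by (rule continuous_open_preimage[OF lreg_grad_continuous[OF open_ball k(1) graph_repD(2)[OF g]] open_ball W(1)])
  have bT: "b \<in> ?T" using b_ball W(2) by (simp add: grad_gb)
  let ?Z = "\<lambda>y. y + \<phi> (grad g y)"
  have gT: "vreg (spred \<kappa>) \<alpha> ?T (grad g)"
    using vreg_grad[OF open_ball k(1) graph_repD(2)[OF g]] by (blast intro: lreg_subset)
  have "lreg (spred \<kappa>) \<alpha> ?T (\<lambda>y. \<phi> (grad g y) $ i)" for i
  proof (rule lreg_compose[of W _ \<alpha> _ "\<lambda>x. \<phi> x $ i" "grad g", OF W(1) T al k'])
    show "lreg (spred \<kappa>) \<alpha> W (\<lambda>x. \<phi> x $ i)" using \<phi> by blast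
    show "lreg (spred \<kappa>) \<alpha> ?T (\<lambda>x. grad g x $ i)" for i using gT by blast
  qed auto
  then have Z: "vreg (spred \<kappa>) \<alpha> ?T ?Z"
    using lreg_add[OF T lreg_nth[OF al]] by (simp del: lreg_simps)
  obtain D\<phi> where D\<phi>: "(\<phi> has_derivative D\<phi>) (at 0)"
    using lreg_has_derivative_vec[OF W(1) k' _ W(2), of \<alpha> \<phi>] \<phi> by blast
  have Hg: "(grad g has_derivative hess g b) (at b)"
    by (rule lreg_hess[OF open_ball k graph_repD(2)[OF g] b_ball])
  have DZ: "(?Z has_derivative (\<lambda>v. v + D\<phi> (hess g b v))) (at b)"
    using has_derivative_add[OF has_derivative_ident diff_chain_at[OF Hg, of \<phi> D\<phi>]] D\<phi>
    by (simp add: o_def grad_gb)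
  have "(Theta \<circ> \<phi> has_derivative (\<lambda>v. hess f a v - (v \<bullet> N) *\<^sub>R N) \<circ> D\<phi>) (at 0)"
    by (rule diff_chain_at[OF D\<phi>]) (unfold \<phi>0, rule Theta_derivative)
  then have "((\<lambda>w. w) has_derivative (\<lambda>v. hess f a v - (v \<bullet> N) *\<^sub>R N) \<circ> D\<phi>) (at 0)"
    by (rule has_derivative_transform_within_open[OF _ W]) (simp add: homeomorphism_apply2[OF hom])
  note comp = has_derivative_unique[OF this has_derivative_ident]
  have right_inv: "hess f a (D\<phi> w) - (D\<phi> w \<bullet> N) *\<^sub>R N = w" for w
    using fun_cong[OF comp, of w] by (simp add: o_def)
  have "v = 0" if v: "v + D\<phi> (hess g b v) = 0" for v
  proof -
    have "D\<phi> (hess g b v) = - v" using v by (simp add: add_eq_0_iff)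
    from right_inv[of "hess g b v", unfolded this]
    have "hess f a v - (v \<bullet> N) *\<^sub>R N + hess g b v = 0"
      by (simp add: linear_neg[OF linear_hess] algebra_simps)
    then show ?thesis by (rule sum_derivative_inj)
  qed
  then obtain V V' Y where V: "open V" "V \<subseteq> ?T" "b \<in> V" "open V'" "?Z b \<in> V'" "homeomorphism V V' ?Z Y" "vreg (spred \<kappa>) \<alpha> V' Y"
    using lreg_local_inverse_derivative[OF T bT al k' Z DZ] by blast
  have ab: "a + b \<in> V'" using V(5) by (simp add: grad_gb \<phi>0 add.commute)
  have ZV: "vreg (spred \<kappa>) \<alpha> V ?Z" using Z V(2) by (blast intro: lreg_subset)
  have "grad g ` V \<subseteq> W" "V \<subseteq> ball b \<rho>" using V(2) by auto
  with U W(1) hom \<phi> \<phi>0 V(1,3,4,6,7) ab ZV show ?thesis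
    by (intro exI[of _ U] exI[of _ W] exI[of _ \<phi>] exI[of _ V] exI[of _ V'] exI[of _ Y] conjI)
qed

end

context minkowski_local
begin

text \<open>\<open>h\<close> is the local supremal convolution of \<open>f\<close> and \<open>g\<close>; at the optimal decomposition \<open>z = x + y\<close> all three
  gradients agree.\<close>
proposition sum_graph_rep:
  "\<exists>h \<epsilon> U W \<phi> V V' Y. graph_rep (frontier (minkowski_sum A B)) (a + b) N \<kappa> \<alpha> h \<epsilon> \<and>
     open U \<and> U \<subseteq> ball a \<delta> \<and> open W \<and> homeomorphism U W Theta \<phi> \<and> vreg (spred \<kappa>) \<alpha> W \<phi> \<and>
     open V \<and> V \<subseteq> ball b \<rho> \<and> b \<in> V \<and> grad g ` V \<subseteq> W \<and> open V' \<and> a + b \<in> V' \<and> b + \<phi> (grad g b) = a + b \<and>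
     homeomorphism V V' (\<lambda>y. y + \<phi> (grad g y)) Y \<and>
     vreg (spred \<kappa>) \<alpha> V (\<lambda>y. y + \<phi> (grad g y)) \<and> vreg (spred \<kappa>) \<alpha> V' Y \<and>
     (\<forall>y\<in>V. \<phi> (grad g y) \<bullet> N = a \<bullet> N) \<and>
     (\<forall>y\<in>V. h (y + \<phi> (grad g y)) = f (\<phi> (grad g y)) + g y \<and> grad h (y + \<phi> (grad g y)) = grad g y)"
proof -
  let ?S = "frontier (minkowski_sum A B)" and ?c = "a + b"
  note A' = convex_body_facts[OF A] and B' = convex_body_facts[OF B]
  have AB: "convex_body (minkowski_sum A B)" by (rule convex_body_minkowski_sum[OF A B])
  note AB' = convex_body_facts[OF AB]
  obtain U W \<phi> V V' Y where U: "open U" "U \<subseteq> ball a \<delta>" "a \<in> U" and W: "open W"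
    and homU: "homeomorphism U W Theta \<phi>" and \<phi>: "vreg (spred \<kappa>) \<alpha> W \<phi>"
    and V: "open V" "V \<subseteq> ball b \<rho>" "b \<in> V" "grad g ` V \<subseteq> W" and V': "open V'" "?c \<in> V'" and \<phi>0: "\<phi> 0 = a"
    and homV: "homeomorphism V V' (\<lambda>y. y + \<phi> (grad g y)) Y"
    and Zr: "vreg (spred \<kappa>) \<alpha> V (\<lambda>y. y + \<phi> (grad g y))" and Yr: "vreg (spred \<kappa>) \<alpha> V' Y"
    using local_inverses by (elim exE conjE) (rule that)
  let ?Z = "\<lambda>y. y + \<phi> (grad g y)"
  define h where "h z = f (z - Y z) + g (Y z)" for z
  define X where "X z = z - Y z" for z
  have YV: "Y z \<in> V" "?Z (Y z) = z" if "z \<in> V'" for z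
    using homV that by (auto simp: homeomorphism_def)
  have X\<phi>: "X z = \<phi> (grad g (Y z))" if "z \<in> V'" for z
    using YV(2)[OF that] unfolding X_def by (metis add_diff_cancel_left')
  have \<phi>U: "\<phi> (grad g y) \<in> U" "Theta (\<phi> (grad g y)) = grad g y" if "y \<in> V" for y
    using homU V(4) that by (auto simp: homeomorphism_def)
  have ggN: "grad g y \<bullet> N = 0" if "y \<in> ball b \<rho>" for y
    by (rule graph_rep_grad_orth[OF g k(1) N that])
  have gfN: "grad f x \<bullet> N = 0" if "x \<in> ball a \<delta>" for x
    by (rule graph_rep_grad_orth[OF f k(1) N that])
  \<comment> \<open>Gradients of f and g are orthogonal to N, so the N-part of the equation
    \<open>Theta x = grad g y\<close> says that x has the same N-coordinate as a; there
    \<open>Theta\<close> is grad f.\<close>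
  have \<phi>N: "\<phi> (grad g y) \<bullet> N = a \<bullet> N" if "y \<in> V" for y
  proof -
    let ?x = "\<phi> (grad g y)"
    have "Theta ?x \<bullet> N = 0" using \<phi>U(2)[OF that] ggN V(2) that by auto
    moreover have "grad f ?x \<bullet> N = 0" using \<phi>U(1)[OF that] U(2) gfN by blast
    ultimately show ?thesis by (simp add: Theta_def inner_diff_left NN)
  qed
  have \<phi>g: "grad f (\<phi> (grad g y)) = grad g y" if "y \<in> V" for y
    using \<phi>U(2)[OF that] \<phi>N[OF that] by (simp add: Theta_def)
  have Yc: "Y ?c = b"
    using homeomorphism_apply1[OF homV V(3)] by (simp add: grad_gb \<phi>0 add.commute)
  have Xc: "X ?c = a" by (simp add: X_def Yc)
  have XU: "X z \<in> U" if "z \<in> V'" for z using \<phi>U(1)[OF YV(1)[OF that]] X\<phi>[OF that] by simp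
  have Xr: "vreg (spred \<kappa>) \<alpha> V' X"
    unfolding X_def using lreg_diff[OF V'(1) al lreg_nth[OF al]] Yr by (simp del: lreg_simps)
  define DY where "DY z v = (\<chi> i. grad (\<lambda>x. Y x $ i) z \<bullet> v)" for z v
  have DY: "(Y has_derivative DY z) (at z)" if "z \<in> V'" for z
    unfolding DY_def by (rule lreg_has_derivative_vec[OF V'(1) k' _ that]) (use Yr in blast)
  \<comment> \<open>Envelope principle: the terms with the derivative of Y cancel because grad f at
    X z equals grad g at Y z.\<close>
  have hder: "(h has_derivative (\<lambda>v. grad g (Y z) \<bullet> v)) (at z)" if z: "z \<in> V'" for z
  proof -
    have Xb: "X z \<in> ball a \<delta>" and Yb: "Y z \<in> ball b \<rho>" using XU[OF z] YV(1)[OF z] U(2) V(2) by auto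
    have "(X has_derivative (\<lambda>v. v - DY z v)) (at z)"
      unfolding X_def by (intro has_derivative_diff has_derivative_ident DY z)
    from has_derivative_add[OF diff_chain_at[OF this graph_rep_der[OF f k(1) N Xb]]
        diff_chain_at[OF DY[OF z] graph_rep_der[OF g k(1) N Yb]]]
    have "(h has_derivative (\<lambda>v. grad f (X z) \<bullet> (v - DY z v) + grad g (Y z) \<bullet> DY z v)) (at z)"
      by (simp add: o_def h_def[abs_def] X_def)
    also have "grad f (X z) = grad g (Y z)" using \<phi>g[OF YV(1)[OF z]] X\<phi>[OF z] by simp
    finally show ?thesis by (simp add: inner_diff_right)
  qed
  have gradh: "grad h z = grad g (Y z)" if "z \<in> V'" for z by (rule grad_eqI[OF hder[OF that]])
  \<comment> \<open>As a composite h is only seen to be of class \<open>spred\<close> \<kappa>, like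
    Y; but its gradient, grad g after Y, is of that class too, which gives one derivative
    more.\<close>
  have hreg: "lreg \<kappa> \<alpha> V' h"
  proof (rule lreg_gain[OF V'(1)])
    have "lreg (spred \<kappa>) \<alpha> V' (\<lambda>z. f (X z))"
    proof (rule lreg_compose[of U V' \<alpha> "spred \<kappa>" f X, OF U(1) V'(1) al k'])
      show "lreg (spred \<kappa>) \<alpha> U f"
        by (rule lreg_subset[OF lreg_spred[OF open_ball al graph_repD(2)[OF f]] U(2)])
      show "lreg (spred \<kappa>) \<alpha> V' (\<lambda>x. X x $ i)" for i using Xr by blast
    qed (use XU in blast)
    moreover have "lreg (spred \<kappa>) \<alpha> V' (\<lambda>z. g (Y z))"
    proof (rule lreg_compose[of V V' \<alpha> "spred \<kappa>" g Y, OF V(1) V'(1) al k'])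
      show "lreg (spred \<kappa>) \<alpha> V g"
        by (rule lreg_subset[OF lreg_spred[OF open_ball al graph_repD(2)[OF g]] V(2)])
      show "lreg (spred \<kappa>) \<alpha> V' (\<lambda>x. Y x $ i)" for i using Yr by blast
    qed (use YV(1) in blast)
    ultimately show "lreg (spred \<kappa>) \<alpha> V' h"
      unfolding h_def X_def by (rule lreg_add[OF V'(1)])
    show "h differentiable_on V'"
      unfolding differentiable_on_open_at[OF V'(1)] differentiable_def using hder by blast
    fix i
    have "lreg (spred \<kappa>) \<alpha> V' (\<lambda>z. pd i g (Y z))"
    proof (rule lreg_compose[of V V' \<alpha> "spred \<kappa>" "pd i g" Y, OF V(1) V'(1) al k'])
      show "lreg (spred \<kappa>) \<alpha> V (pd i g)"
        by (rule lreg_subset[OF lreg_pd(2)[OF open_ball k(1) graph_repD(2)[OF g]] V(2)])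
      show "lreg (spred \<kappa>) \<alpha> V' (\<lambda>x. Y x $ i)" for i using Yr by blast
    qed (use YV(1) in blast)
    then show "lreg (spred \<kappa>) \<alpha> V' (pd i h)"
    proof (rule lreg_cong[OF V'(1), rotated])
      fix z assume "z \<in> V'"
      from arg_cong[OF gradh[OF this], of "\<lambda>v. v $ i"] show "pd i g (Y z) = pd i h z" by simp
    qed
  qed
  obtain r where r: "r > 0" "ball ?c r \<subseteq> V'" using V' open_contains_ball by blast
  have hinv: "h (z + t *\<^sub>R N) = h z" if z: "z \<in> ball ?c r" "z + t *\<^sub>R N \<in> ball ?c r" for z t
  proof -
    have "\<exists>s. 0 < s \<and> s < 1 \<and> h (z + t *\<^sub>R N) - h z = grad h (z + s *\<^sub>R t *\<^sub>R N) \<bullet> (t *\<^sub>R N)"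
    proof (rule has_derivative_radial_mvt[OF _ z])
      fix y assume "y \<in> ball ?c r"
      then have "y \<in> V'" using r by blast
      then show "(h has_derivative (\<lambda>v. grad h y \<bullet> v)) (at y)" using hder gradh by simp
    qed
    then obtain s where s: "0 < s" "s < 1" and eq: "h (z + t *\<^sub>R N) - h z = grad h (z + s *\<^sub>R t *\<^sub>R N) \<bullet> (t *\<^sub>R N)"
      by blast
    have "z + s *\<^sub>R t *\<^sub>R N = (1 - s) *\<^sub>R z + s *\<^sub>R (z + t *\<^sub>R N)" by (simp add: algebra_simps)
    then have "z + s *\<^sub>R t *\<^sub>R N \<in> ball ?c r" using convexD[OF convex_ball z, of "1 - s" s] s by simp
    then have "z + s *\<^sub>R t *\<^sub>R N \<in> V'" using r by blast
    then have "grad h (z + s *\<^sub>R t *\<^sub>R N) \<bullet> N = 0"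
      using gradh ggN[OF subsetD[OF V(2) YV(1)]] by simp
    then show ?thesis using eq by simp
  qed
  obtain eA where eA: "0 < eA" "eA \<le> \<delta>"
    "\<And>z \<nu>. z \<in> ball a eA \<Longrightarrow> z \<in> frontier A \<Longrightarrow> norm \<nu> = 1 \<Longrightarrow> supports A z \<nu> \<longleftrightarrow> \<nu> = sgn (N - grad f z)"
    by (rule graph_rep_outer_normal[OF A a N f k(1)]) (rule that)
  obtain eB where eB: "0 < eB" "eB \<le> \<rho>"
    "\<And>z \<nu>. z \<in> ball b eB \<Longrightarrow> z \<in> frontier B \<Longrightarrow> norm \<nu> = 1 \<Longrightarrow> supports B z \<nu> \<longleftrightarrow> \<nu> = sgn (N - grad g z)"
    by (rule graph_rep_outer_normal[OF B b N g k(1)]) (rule that)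
  obtain eU where eU: "0 < eU" "ball a eU \<subseteq> U" using U open_contains_ball by blast
  obtain eV where eV: "0 < eV" "ball b eV \<subseteq> V" using V open_contains_ball by blast
  \<comment> \<open>The choices fit together as follows: x stays within e / 2 of a and z within e /
    2 of a + b, so y is within e of b, and y + x0 is within 3 e / 2 of a + b, which is less than
    r.\<close>
  define e where "e = Min {eA, eB, eU, eV, r / 2}"
  have e: "e > 0" "e \<le> eA" "e \<le> eB" "e \<le> eU" "e \<le> eV" "e \<le> r / 2"
    using eA eB eU eV r by (auto simp: e_def)
  have "e / 2 > 0" using e by simp
  from decomposition_near[OF A B'(3) a b(2) N f k inj this]
  obtain d where d: "d > 0" "\<And>x y. x \<in> A \<Longrightarrow> y \<in> B \<Longrightarrow> dist (x + y) ?c < d \<Longrightarrow> dist x a < e / 2"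
    by blast
  have cX: "isCont X ?c" and cY: "isCont Y ?c"
    using DY[OF V'(2)] has_derivative_continuous[OF DY[OF V'(2)]] unfolding X_def by (auto intro!: continuous_intros)
  have "isCont f a" using graph_rep_der[OF f k(1) N a_ball] has_derivative_continuous by blast
  then have "isCont (\<lambda>z. f (X z)) ?c" using isCont_o2[OF cX] Xc by simp
  then have "isCont (\<lambda>z. X z + (f (X z) - a \<bullet> N) *\<^sub>R N) ?c" using cX by (intro continuous_intros)
  then have ev1: "\<forall>\<^sub>F z in nhds ?c. X z + (f (X z) - a \<bullet> N) *\<^sub>R N \<in> ball a eA"
    by (rule isCont_eventually_in[OF _ open_ball]) (use eA Xc f_a in simp)
  have "isCont g b" using graph_rep_der[OF g k(1) N b_ball] has_derivative_continuous by blast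
  then have "isCont (\<lambda>z. g (Y z)) ?c" using isCont_o2[OF cY] Yc by simp
  then have "isCont (\<lambda>z. Y z + (g (Y z) - Y z \<bullet> N) *\<^sub>R N) ?c" using cY by (intro continuous_intros)
  then have ev2: "\<forall>\<^sub>F z in nhds ?c. Y z + (g (Y z) - Y z \<bullet> N) *\<^sub>R N \<in> ball b eB"
    by (rule isCont_eventually_in[OF _ open_ball]) (use eB Yc g_b in simp)
  obtain d' where d': "d' > 0" "\<And>z. dist z ?c < d' \<Longrightarrow> X z + (f (X z) - a \<bullet> N) *\<^sub>R N \<in> ball a eA \<and>
      Y z + (g (Y z) - Y z \<bullet> N) *\<^sub>R N \<in> ball b eB"
    using eventually_conj[OF ev1 ev2] unfolding eventually_nhds_metric by blast
  define \<epsilon> where "\<epsilon> = Min {d, d', e / 2}"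
  have \<epsilon>: "\<epsilon> > 0" "\<epsilon> \<le> d" "\<epsilon> \<le> d'" "\<epsilon> \<le> e / 2" using d d' e by (auto simp: \<epsilon>_def)
  have \<epsilon>r: "ball ?c \<epsilon> \<subseteq> ball ?c r" using \<epsilon> e by auto
  have "graph_rep ?S ?c N \<kappa> \<alpha> h \<epsilon>"
    unfolding graph_rep_def
  proof (intro conjI ballI allI impI)
    show "lreg \<kappa> \<alpha> (ball ?c \<epsilon>) h" by (rule lreg_subset[OF hreg]) (use r \<epsilon>r in blast)
    show "h (z + t *\<^sub>R N) = h z" if "z \<in> ball ?c \<epsilon>" "z + t *\<^sub>R N \<in> ball ?c \<epsilon>" for z t
      using that \<epsilon>r by (intro hinv) auto
    fix z assume z: "z \<in> ball ?c \<epsilon>"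
    then have zr: "z \<in> ball ?c r" and zV: "z \<in> V'" using \<epsilon>r r by auto
    show "z \<in> ?S \<longleftrightarrow> z \<bullet> N = h z"
    proof
      \<comment> \<open>A supporting vector of the sum at z supports A at x and B at y, so both are
        boundary points with a common normal; as they lie near a and b, their gradients
        agree.\<close>
      assume zS: "z \<in> ?S"
      then obtain x y where xy: "x \<in> A" "y \<in> B" "z = x + y"
        using AB'(5) by (auto simp: minkowski_sum_def)
      obtain \<nu> where \<nu>: "norm \<nu> = 1" "supports (minkowski_sum A B) z \<nu>"
        using supports_exists[OF AB zS] .
      have \<nu>0: "\<nu> \<noteq> 0" using \<nu> by auto
      have sx: "supports A x \<nu>" and sy: "supports B y \<nu>"
        using \<nu>(2) supports_minkowski_sum[OF xy(1,2)] by (auto simp: xy(3))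
      have fx: "x \<in> frontier A" and fy: "y \<in> frontier B"
        by (rule supports_imp_frontier[OF xy(1) sx \<nu>0], rule supports_imp_frontier[OF xy(2) sy \<nu>0])
      have dx: "dist x a < e / 2"
        using d(2)[OF xy(1,2)] z \<epsilon>(2) by (simp add: xy(3) dist_commute)
      have "y - b = (z - ?c) - (x - a)" by (simp add: xy(3))
      then have "dist y b \<le> dist z ?c + dist x a" unfolding dist_norm by (metis norm_triangle_ineq4)
      then have dy: "dist y b < e" using dx z \<epsilon>(4) by (simp add: dist_commute)
      have xA: "x \<in> ball a eA" "x \<in> ball a \<delta>" using dx e eA(2) by (auto simp: dist_commute)
      have yB: "y \<in> ball b eB" "y \<in> ball b \<rho>" "y \<in> V" using dy e eB(2) eV(2) by (auto simp: dist_commute subset_eq)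
      have "sgn (N - grad f x) = sgn (N - grad g y)"
        using eA(3)[OF xA(1) fx \<nu>(1)] eB(3)[OF yB(1) fy \<nu>(1)] sx sy by simp
      then have grads: "grad f x = grad g y"
        by (rule sgn_orth_eq[OF N gfN[OF xA(2)] ggN[OF yB(2)]])
      define t where "t = (x - a) \<bullet> N"
      \<comment> \<open>The component x need not have the N-coordinate of a, whereas values of
        \<phi> on gradients of g do. Moving x along N to that height changes neither f nor its
        gradient.\<close>
      define x0 where "x0 = x + (- t) *\<^sub>R N"
      have "x0 - a = (x - a) - ((x - a) \<bullet> N) *\<^sub>R N" by (simp add: x0_def t_def)
      then have "dist x0 a \<le> dist x a" unfolding dist_norm using norm_proj_le[OF N] by metis
      then have d0: "dist x0 a < e / 2" using dx by simp
      then have x0: "x0 \<in> ball a \<delta>" "x0 \<in> U" using e eA(2) eU(2) by (auto simp: dist_commute subset_eq)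
      have "grad f x0 = grad g y"
        using graph_rep_grad_shift[OF f k(1) N xA(2), of "- t"] x0(1) grads unfolding x0_def by simp
      moreover have "x0 \<bullet> N = a \<bullet> N" by (simp add: x0_def t_def inner_add_left inner_diff_left NN)
      ultimately have "Theta x0 = grad g y" by (simp add: Theta_def)
      then have \<phi>x: "\<phi> (grad g y) = x0" using homeomorphism_apply1[OF homU x0(2)] by simp
      have Yz: "Y (y + x0) = y" using homeomorphism_apply1[OF homV yB(3)] by (simp add: \<phi>x)
      have z': "y + x0 \<in> ball ?c r"
      proof -
        have "(y + x0) - ?c = (y - b) + (x0 - a)" by simp
        then have "dist (y + x0) ?c \<le> dist y b + dist x0 a" unfolding dist_norm by (metis norm_triangle_ineq)
        then have "dist (y + x0) ?c < r" using dy d0 e(6) r(1) by linarith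
        then show ?thesis by (simp add: dist_commute)
      qed
      have "z = (y + x0) + t *\<^sub>R N" by (simp add: xy(3) x0_def)
      then have "h z = h (y + x0)" using hinv[OF z'] zr by simp
      also have "\<dots> = f x0 + g y" by (simp add: h_def Yz)
      also have "f x0 = f x" using graph_repD(3)[OF f xA(2)] x0(1) unfolding x0_def by blast
      also have "f x = x \<bullet> N" using graph_repD(4)[OF f xA(2)] fx by simp
      also have "g y = y \<bullet> N" using graph_repD(4)[OF g yB(2)] fy by simp
      finally show "z \<bullet> N = h z" by (simp add: xy(3) inner_add_left)
    next
      assume eq: "z \<bullet> N = h z"
      \<comment> \<open>Conversely X z and Y z are moved along N onto the two boundaries. Since z
        has height h z, the two corrections cancel and the boundary points still add up to z; equal
        gradients give them a common normal, which supports the sum.\<close>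
      let ?x = "X z + (f (X z) - a \<bullet> N) *\<^sub>R N" and ?y = "Y z + (g (Y z) - Y z \<bullet> N) *\<^sub>R N"
      have xb: "?x \<in> ball a eA" and yb: "?y \<in> ball b eB"
        using d'(2)[of z] z \<epsilon>(3) by (auto simp: dist_commute)
      then have xd: "?x \<in> ball a \<delta>" and yr: "?y \<in> ball b \<rho>" using eA(2) eB(2) by auto
      have Xd: "X z \<in> ball a \<delta>" and Yd: "Y z \<in> ball b \<rho>" using XU[OF zV] YV(1)[OF zV] U(2) V(2) by auto
      have XN: "X z \<bullet> N = a \<bullet> N" using \<phi>N[OF YV(1)[OF zV]] X\<phi>[OF zV] by simp
      have "f ?x = f (X z)" by (rule graph_repD(3)[OF f Xd xd])
      moreover have "?x \<bullet> N = f (X z)" by (simp add: inner_add_left NN XN)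
      ultimately have fx: "?x \<in> frontier A" using graph_repD(4)[OF f xd] by simp
      have "g ?y = g (Y z)" by (rule graph_repD(3)[OF g Yd yr])
      moreover have "?y \<bullet> N = g (Y z)" by (simp add: inner_add_left NN)
      ultimately have fy: "?y \<in> frontier B" using graph_repD(4)[OF g yr] by simp
      have zXY: "z = X z + Y z" by (simp add: X_def)
      have "z \<bullet> N = a \<bullet> N + Y z \<bullet> N" using arg_cong[OF zXY, of "\<lambda>v. v \<bullet> N"] XN by (simp add: inner_add_left)
      moreover have "h z = f (X z) + g (Y z)" by (simp add: h_def X_def)
      ultimately have "(f (X z) - a \<bullet> N) + (g (Y z) - Y z \<bullet> N) = 0" using eq by simp
      then have "(f (X z) - a \<bullet> N) *\<^sub>R N + (g (Y z) - Y z \<bullet> N) *\<^sub>R N = 0" by (metis scaleR_left_distrib scaleR_zero_left)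
      moreover have "?x + ?y = (X z + Y z) + ((f (X z) - a \<bullet> N) *\<^sub>R N + (g (Y z) - Y z \<bullet> N) *\<^sub>R N)"
        by (simp only: add_ac)
      ultimately have sum: "?x + ?y = z" using zXY by simp
      have "grad f ?x = grad f (X z)" by (rule graph_rep_grad_shift[OF f k(1) N Xd xd])
      also have "\<dots> = grad g (Y z)" using \<phi>g[OF YV(1)[OF zV]] X\<phi>[OF zV] by simp
      also have "\<dots> = grad g ?y" by (rule graph_rep_grad_shift[OF g k(1) N Yd yr, symmetric])
      finally have grads: "grad f ?x = grad g ?y" .
      let ?\<nu> = "sgn (N - grad f ?x)"
      have "(N - grad f ?x) \<bullet> N = 1" using gfN[OF xd] by (simp add: inner_diff_left NN)
      then have nz: "N - grad f ?x \<noteq> 0" by (metis inner_zero_left zero_neq_one)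
      then have n1: "norm ?\<nu> = 1" by (simp add: norm_sgn)
      have "supports A ?x ?\<nu>" using eA(3)[OF xb fx n1] by simp
      moreover have "supports B ?y ?\<nu>" using eB(3)[OF yb fy n1] grads by simp
      moreover have inAB: "?x \<in> A" "?y \<in> B" using fx fy A'(5) B'(5) by blast+
      ultimately have "supports (minkowski_sum A B) z ?\<nu>"
        using supports_minkowski_sum[OF inAB] sum by simp
      moreover have "z \<in> minkowski_sum A B" unfolding minkowski_sum_def mem_Collect_eq
        by (rule exI[of _ ?x], rule exI[of _ ?y]) (use inAB sum in simp)
      ultimately show "z \<in> ?S" using supports_imp_frontier n1 by (metis norm_zero zero_neq_one)
    qed
  qed (rule \<epsilon>(1))
  moreover have "b + \<phi> (grad g b) = a + b" by (simp add: grad_gb \<phi>0)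
  moreover have "\<forall>y\<in>V. h (?Z y) = f (\<phi> (grad g y)) + g y \<and> grad h (?Z y) = grad g y"
  proof
    fix y assume y: "y \<in> V"
    have "?Z y \<in> V'" "Y (?Z y) = y" using homV y by (auto simp: homeomorphism_def)
    then show "h (?Z y) = f (\<phi> (grad g y)) + g y \<and> grad h (?Z y) = grad g y"
      using gradh[of "?Z y"] by (simp add: h_def)
  qed
  moreover have "\<forall>y\<in>V. \<phi> (grad g y) \<bullet> N = a \<bullet> N" using \<phi>N by blast
  ultimately show ?thesis using U(1,2) W homU \<phi> V V' homV Zr Yr
    by (intro exI[of _ h] exI[of _ \<epsilon>] exI[of _ U] exI[of _ W] exI[of _ \<phi>] exI[of _ V] exI[of _ V'] exI[of _ Y] conjI)
qed

end

text \<open>Moving z along N to height f' z gives a point of S, to which the other representation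
  applies as well; both functions are constant along N, so they agree at z.\<close>

lemma graph_rep_unique:
  assumes f: "graph_rep S p N \<kappa> \<alpha> f \<delta>" and f': "graph_rep S p N \<kappa>' \<beta> f' \<delta>'" and N: "norm N = 1"
    and k': "\<kappa>' \<noteq> Fin 0" and p: "p \<in> S"
  shows "\<exists>r>0. r \<le> \<delta> \<and> r \<le> \<delta>' \<and> (\<forall>z\<in>ball p r. f' z = f z)"
proof -
  have NN: "N \<bullet> N = 1" using N by (simp add: dot_square_norm)
  let ?m = "min \<delta> \<delta>'"
  have m: "?m > 0" using graph_repD(1)[OF f] graph_repD(1)[OF f'] by simp
  have pb: "p \<in> ball p \<delta>'" using graph_repD(1)[OF f'] by simp
  have fp: "f' p = p \<bullet> N" using graph_repD(4)[OF f' pb] p by simp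
  have "isCont f' p" using graph_rep_der[OF f' k' N pb] has_derivative_continuous by blast
  then have "isCont (\<lambda>z. z + (f' z - z \<bullet> N) *\<^sub>R N) p" by (intro continuous_intros)
  then have "\<forall>\<^sub>F z in nhds p. z + (f' z - z \<bullet> N) *\<^sub>R N \<in> ball p ?m"
    by (rule isCont_eventually_in[OF _ open_ball]) (use fp m in simp)
  then obtain d where d: "d > 0" "\<And>z. dist z p < d \<Longrightarrow> z + (f' z - z \<bullet> N) *\<^sub>R N \<in> ball p ?m"
    unfolding eventually_nhds_metric by blast
  show ?thesis
  proof (rule exI[of _ "min d ?m"], intro conjI ballI)
    fix z assume "z \<in> ball p (min d ?m)"
    then have z: "z \<in> ball p \<delta>" "z \<in> ball p \<delta>'" "z + (f' z - z \<bullet> N) *\<^sub>R N \<in> ball p ?m"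
      using d(2)[of z] by (auto simp: dist_commute)
    let ?z = "z + (f' z - z \<bullet> N) *\<^sub>R N"
    have zb: "?z \<in> ball p \<delta>" "?z \<in> ball p \<delta>'" using z(3) by auto
    have zN: "?z \<bullet> N = f' z" by (simp add: inner_add_left NN)
    have "f' ?z = f' z" by (rule graph_repD(3)[OF f' z(2) zb(2)])
    then have "?z \<in> S" using graph_repD(4)[OF f' zb(2)] zN by simp
    then have "?z \<bullet> N = f ?z" using graph_repD(4)[OF f zb(1)] by simp
    also have "f ?z = f z" by (rule graph_repD(3)[OF f z(1) zb(1)])
    finally show "f' z = f z" using zN by simp
  qed (use d m in auto)
qed

section \<open>Curvature of the sum and regularity of the second summand\<close>

context minkowski_local
begin

lemma sum_frontier: "a + b \<in> frontier (minkowski_sum A B)" and sum_supports: "supports (minkowski_sum A B) (a + b) N"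
proof -
  have ab: "a \<in> A" "b \<in> B" using a b convex_body_facts(5)[OF A] convex_body_facts(5)[OF B] by auto
  show s: "supports (minkowski_sum A B) (a + b) N" using supports_minkowski_sum[OF ab] a b by simp
  have "a + b \<in> minkowski_sum A B" using ab unfolding minkowski_sum_def by blast
  then show "a + b \<in> frontier (minkowski_sum A B)"
    by (rule supports_imp_frontier[OF _ s]) (use N in auto)
qed

text \<open>Differentiating grad h (Z y) = grad g y at b gives Hess h DZ = Hess g. As DZ is
  invertible and preserves N-coordinates, it maps the kernel of Hess g in the tangent hyperplane
  onto that of Hess h.\<close>

lemma sum_gauss_curvature:
  "gauss_curvature B b \<noteq> 0 \<longleftrightarrow> gauss_curvature (minkowski_sum A B) (a + b) \<noteq> 0"
proof -
  obtain h \<epsilon> U W \<phi> V V' Y where h: "graph_rep (frontier (minkowski_sum A B)) (a + b) N \<kappa> \<alpha> h \<epsilon>"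
    and "open U" "U \<subseteq> ball a \<delta>" "open W" "homeomorphism U W Theta \<phi>" "vreg (spred \<kappa>) \<alpha> W \<phi>"
    and V: "open V" "V \<subseteq> ball b \<rho>" "b \<in> V" and "grad g ` V \<subseteq> W" and V': "open V'" "a + b \<in> V'" and Zb: "b + \<phi> (grad g b) = a + b"
    and hom: "homeomorphism V V' (\<lambda>y. y + \<phi> (grad g y)) Y"
    and Z: "vreg (spred \<kappa>) \<alpha> V (\<lambda>y. y + \<phi> (grad g y))" and Y: "vreg (spred \<kappa>) \<alpha> V' Y"
    and \<phi>N: "\<forall>y\<in>V. \<phi> (grad g y) \<bullet> N = a \<bullet> N"
    and hZ: "\<forall>y\<in>V. h (y + \<phi> (grad g y)) = f (\<phi> (grad g y)) + g y \<and> grad h (y + \<phi> (grad g y)) = grad g y"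
    using sum_graph_rep by (elim exE conjE) (rule that)
  let ?c = "a + b" and ?Z = "\<lambda>y. y + \<phi> (grad g y)"
  obtain DZ where DZ: "(?Z has_derivative DZ) (at b)"
    using lreg_has_derivative_vec[of V "spred \<kappa>" \<alpha> ?Z b, OF V(1) k' _ V(3)] Z by blast
  obtain DY where DY: "(Y has_derivative DY) (at ?c)"
    using lreg_has_derivative_vec[of V' "spred \<kappa>" \<alpha> Y ?c, OF V'(1) k' _ V'(2)] Y by blast
  have Yc: "Y ?c = b" using homeomorphism_apply1[OF hom V(3)] Zb by simp
  have "(Y \<circ> ?Z has_derivative DY \<circ> DZ) (at b)" by (rule diff_chain_at[OF DZ]) (unfold Zb, rule DY)
  then have "((\<lambda>y. y) has_derivative DY \<circ> DZ) (at b)"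
    by (rule has_derivative_transform_within_open[OF _ V(1,3)]) (use homeomorphism_apply1[OF hom] in simp)
  from has_derivative_unique[OF this has_derivative_ident] have YZ: "DY (DZ v) = v" for v
    by (auto simp: fun_eq_iff)
  have "(?Z \<circ> Y has_derivative DZ \<circ> DY) (at ?c)" by (rule diff_chain_at[OF DY]) (use DZ Yc in simp)
  then have "((\<lambda>y. y) has_derivative DZ \<circ> DY) (at ?c)"
    by (rule has_derivative_transform_within_open[OF _ V']) (use homeomorphism_apply2[OF hom] in simp)
  from has_derivative_unique[OF this has_derivative_ident] have ZY: "DZ (DY v) = v" for v
    by (auto simp: fun_eq_iff)
  have "((\<lambda>y. ?Z y \<bullet> N) has_derivative (\<lambda>v. DZ v \<bullet> N)) (at b)" by (rule has_derivative_inner_left[OF DZ])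
  then have 1: "((\<lambda>y. y \<bullet> N + a \<bullet> N) has_derivative (\<lambda>v. DZ v \<bullet> N)) (at b)"
    by (rule has_derivative_transform_within_open[OF _ V(1,3)]) (use \<phi>N in \<open>simp add: inner_add_left\<close>)
  have 2: "((\<lambda>y. y \<bullet> N + a \<bullet> N) has_derivative (\<lambda>v. v \<bullet> N)) (at b)"
    by (auto intro!: derivative_eq_intros)
  have ZN: "DZ v \<bullet> N = v \<bullet> N" for v using fun_cong[OF has_derivative_unique[OF 1 2]] .
  have cb: "?c \<in> ball ?c \<epsilon>" using graph_repD(1)[OF h] by simp
  have Hh: "(grad h has_derivative hess h ?c) (at ?c)" by (rule lreg_hess[OF open_ball k graph_repD(2)[OF h] cb])
  have Hg: "(grad g has_derivative hess g b) (at b)" by (rule lreg_hess[OF open_ball k graph_repD(2)[OF g] b_ball])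
  have "(grad h \<circ> ?Z has_derivative hess h ?c \<circ> DZ) (at b)" by (rule diff_chain_at[OF DZ]) (unfold Zb, rule Hh)
  then have "(grad g has_derivative hess h ?c \<circ> DZ) (at b)"
    by (rule has_derivative_transform_within_open[OF _ V(1,3)]) (use hZ in simp)
  from has_derivative_unique[OF this Hg] have HH: "hess h ?c (DZ v) = hess g b v" for v
    by (auto simp: fun_eq_iff)
  have "gauss_curvature B b \<noteq> 0 \<longleftrightarrow> (\<forall>v. v \<bullet> N = 0 \<and> hess g b v = 0 \<longrightarrow> v = 0)"
    by (rule gauss_curvature_nonzero_iff[OF B b N g k])
  also have "\<dots> \<longleftrightarrow> (\<forall>v. v \<bullet> N = 0 \<and> hess h ?c v = 0 \<longrightarrow> v = 0)"
  proof (intro iffI allI impI)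
    fix v assume *: "\<forall>v. v \<bullet> N = 0 \<and> hess g b v = 0 \<longrightarrow> v = 0" and v: "v \<bullet> N = 0 \<and> hess h ?c v = 0"
    then have "DY v \<bullet> N = 0 \<and> hess g b (DY v) = 0" using ZN[of "DY v"] HH[of "DY v"] by (simp add: ZY)
    then have "DY v = 0" using * by blast
    moreover have "DZ 0 = 0" using linear_0[OF has_derivative_linear[OF DZ]] .
    ultimately show "v = 0" using ZY[of v] by simp
  next
    fix v assume *: "\<forall>v. v \<bullet> N = 0 \<and> hess h ?c v = 0 \<longrightarrow> v = 0" and v: "v \<bullet> N = 0 \<and> hess g b v = 0"
    then have "DZ v \<bullet> N = 0 \<and> hess h ?c (DZ v) = 0" by (simp add: ZN HH)
    then have "DZ v = 0" using * by blast
    moreover have "DY 0 = 0" using linear_0[OF has_derivative_linear[OF DY]] .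
    ultimately show "v = 0" using YZ[of v] by simp
  qed
  also have "\<dots> \<longleftrightarrow> gauss_curvature (minkowski_sum A B) ?c \<noteq> 0"
    by (rule gauss_curvature_nonzero_iff[OF convex_body_minkowski_sum[OF A B] sum_frontier sum_supports N h k, symmetric])
  finally show ?thesis .
qed

text \<open>The map \<open>z \<mapsto> z - \<phi> (\<nabla>h z)\<close> recovers the \<open>B\<close>-component of \<open>z\<close>; it is as regular as \<open>\<nabla>h\<close>, hence so is
  its inverse \<open>Z\<close>, and \<open>\<nabla>g = \<nabla>h \<circ> Z\<close>.\<close>
lemma summand_regular:
  assumes k2: "\<kappa>' \<noteq> Fin 0" "\<kappa>' \<noteq> Fin 1" and be: "\<beta> \<le> 1" and fr: "lreg \<kappa>' \<beta> (ball a \<delta>) f"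
    and h': "graph_rep (frontier (minkowski_sum A B)) (a + b) N \<kappa>' \<beta> h' \<epsilon>'"
  shows "\<exists>\<rho>'. graph_rep (frontier B) b N \<kappa>' \<beta> g \<rho>'"
proof -
  obtain h \<epsilon> U W \<phi> V V' Y where h: "graph_rep (frontier (minkowski_sum A B)) (a + b) N \<kappa> \<alpha> h \<epsilon>"
    and U: "open U" "U \<subseteq> ball a \<delta>" and W: "open W" and homU: "homeomorphism U W Theta \<phi>" and \<phi>: "vreg (spred \<kappa>) \<alpha> W \<phi>"
    and V: "open V" "V \<subseteq> ball b \<rho>" "b \<in> V" and VW: "grad g ` V \<subseteq> W" and "open V'" "a + b \<in> V'" and Zb: "b + \<phi> (grad g b) = a + b"
    and "homeomorphism V V' (\<lambda>y. y + \<phi> (grad g y)) Y"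
    and Z: "vreg (spred \<kappa>) \<alpha> V (\<lambda>y. y + \<phi> (grad g y))" and "vreg (spred \<kappa>) \<alpha> V' Y"
    and "\<forall>y\<in>V. \<phi> (grad g y) \<bullet> N = a \<bullet> N"
    and hZ: "\<forall>y\<in>V. h (y + \<phi> (grad g y)) = f (\<phi> (grad g y)) + g y \<and> grad h (y + \<phi> (grad g y)) = grad g y"
    using sum_graph_rep by (elim exE conjE) (rule that)
  let ?c = "a + b"
  define Z where "Z y = y + \<phi> (grad g y)" for y
  have sk: "spred \<kappa>' \<noteq> Fin 0" by (rule spred_nonzero[OF k2])
  \<comment> \<open>From its construction Z is known only in the class of gradients of the given g;
    of this just the C^1 part is kept as a starting point.\<close>
  have Z1: "lreg (Fin 1) 0 V (\<lambda>y. Z y $ i)" for i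
    unfolding Z_def by (rule lreg_C1[OF V(1) k']) (use Z in blast)
  have cZ: "continuous_on V Z"
  proof (rule continuous_at_imp_continuous_on, rule ballI)
    fix y assume "y \<in> V"
    from lreg_has_derivative_vec[OF V(1) _ Z1 this] show "isCont Z y" using has_derivative_continuous by simp
  qed
  obtain r where r: "r > 0" "r \<le> \<epsilon>" "r \<le> \<epsilon>'" and heq: "\<And>z. z \<in> ball ?c r \<Longrightarrow> h' z = h z"
    using graph_rep_unique[OF h h' N k2(1) sum_frontier] by blast
  have "lreg \<kappa>' \<beta> (ball ?c r) h'" by (rule lreg_subset[OF graph_repD(2)[OF h']]) (use r in auto)
  then have hr: "lreg \<kappa>' \<beta> (ball ?c r) h" by (rule lreg_cong[OF open_ball, rotated]) (rule heq)
  have "vreg (spred \<kappa>') \<beta> (ball a \<delta>) Theta"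
    unfolding Theta_def using vreg_grad[OF open_ball k2(1) fr]
    by (auto intro!: lreg_diff lreg_mult lreg_inner lreg_const be)
  then have Th: "lreg (spred \<kappa>') \<beta> U (\<lambda>x. Theta x $ i)" for i by (blast intro: lreg_subset[OF _ U(2)])
  \<comment> \<open>The map \<phi> came with the class of the locale; \<open>Theta\<close> is as
    regular as f allows, and its C^1 inverse inherits that.\<close>
  have \<phi>r: "lreg (spred \<kappa>') \<beta> W (\<lambda>y. \<phi> y $ i)" for i
  proof (rule lreg_inverse_function[OF U(1) W be sk _ _ Th])
    show "\<phi> ` W \<subseteq> U" "\<And>y. y \<in> W \<Longrightarrow> Theta (\<phi> y) = y" using homU by (auto simp: homeomorphism_def)
    show "lreg (Fin 1) 0 W (\<lambda>y. \<phi> y $ i)" for i by (rule lreg_C1[OF W k']) (use \<phi> in blast)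
  qed
  define D where "D = ball ?c r \<inter> grad h -` W"
  have D: "open D"
    unfolding D_def by (rule continuous_open_preimage[OF lreg_grad_continuous[OF open_ball k2(1) hr] open_ball W])
  define V0 where "V0 = V \<inter> Z -` ball ?c r"
  have V0: "open V0" "b \<in> V0" "V0 \<subseteq> V"
    unfolding V0_def using continuous_open_preimage[OF cZ V(1) open_ball] V(3) Zb[folded Z_def] r by auto
  have ZD: "Z ` V0 \<subseteq> D"
    using hZ VW by (auto simp: D_def V0_def Z_def)
  define P where "P z = z - \<phi> (grad h z)" for z
  have ghr: "lreg (spred \<kappa>') \<beta> D (\<lambda>z. grad h z $ i)" for i
    by (rule lreg_subset[of _ _ "ball ?c r"]) (use vreg_grad[OF open_ball k2(1) hr] in \<open>auto simp: D_def\<close>)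
  have "lreg (spred \<kappa>') \<beta> D (\<lambda>z. \<phi> (grad h z) $ i)" for i
    by (rule lreg_compose[of W D \<beta> _ "\<lambda>x. \<phi> x $ i" "grad h", OF W D be sk \<phi>r ghr]) (auto simp: D_def)
  then have Pr: "lreg (spred \<kappa>') \<beta> D (\<lambda>z. P z $ i)" for i
    unfolding P_def vector_minus_component by (rule lreg_diff[OF D be lreg_nth[OF be]])
  have Zr: "lreg (spred \<kappa>') \<beta> V0 (\<lambda>y. Z y $ i)" for i
  proof (rule lreg_inverse_function[OF D V0(1) be sk ZD _ Pr])
    show "P (Z y) = y" if "y \<in> V0" for y
      using hZ that V0(3) by (auto simp: P_def Z_def)
    show "lreg (Fin 1) 0 V0 (\<lambda>y. Z y $ i)" for i by (rule lreg_subset[OF Z1 V0(3)])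
  qed
  have hD: "lreg \<kappa>' \<beta> D h" by (rule lreg_subset[OF hr]) (auto simp: D_def)
  have "lreg \<kappa>' \<beta> V0 g"
  proof (rule lreg_gain[OF V0(1)])
    have 1: "lreg (spred \<kappa>') \<beta> V0 (\<lambda>y. h (Z y))"
      by (rule lreg_compose[of D V0 \<beta> _ h Z, OF D V0(1) be sk lreg_spred[OF D be hD] Zr ZD])
    \<comment> \<open>The argument Z y - y is \<phi> (grad g y), so g y = h (Z y) - f (Z y - y)
      expresses g itself in the class of gradients.\<close>
    have 2: "lreg (spred \<kappa>') \<beta> V0 (\<lambda>y. f (Z y - y))"
    proof (rule lreg_compose[of "ball a \<delta>" V0 \<beta> _ f "\<lambda>y. Z y - y", OF open_ball V0(1) be sk lreg_spred[OF open_ball be fr]])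
      show "lreg (spred \<kappa>') \<beta> V0 (\<lambda>y. (Z y - y) $ i)" for i
        unfolding vector_minus_component by (rule lreg_diff[OF V0(1) be Zr lreg_nth[OF be]])
      have "\<phi> (grad g y) \<in> U" if "y \<in> V0" for y
        using homeomorphism_image2[OF homU] VW V0(3) that by blast
      then show "(\<lambda>y. Z y - y) ` V0 \<subseteq> ball a \<delta>" using U(2) by (auto simp: Z_def)
    qed
    show "lreg (spred \<kappa>') \<beta> V0 g"
      by (rule lreg_cong[OF V0(1) _ lreg_diff[OF V0(1) be 1 2]]) (use hZ V0(3) in \<open>auto simp: Z_def\<close>)
    show "g differentiable_on V0"
      using lreg_pd(1)[OF open_ball k(1) graph_repD(2)[OF g]] V0(3) V(2) by (blast intro: differentiable_on_subset)
    fix i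
    have "lreg (spred \<kappa>') \<beta> V0 (\<lambda>y. pd i h (Z y))"
      by (rule lreg_compose[of D V0 \<beta> _ "pd i h" Z, OF D V0(1) be sk lreg_pd(2)[OF D k2(1) hD] Zr ZD])
    then show "lreg (spred \<kappa>') \<beta> V0 (pd i g)"
    proof (rule lreg_cong[OF V0(1), rotated])
      fix y assume "y \<in> V0"
      then have "grad h (Z y) = grad g y" using hZ V0(3) by (auto simp: Z_def)
      from arg_cong[OF this, of "\<lambda>v. v $ i"] show "pd i h (Z y) = pd i g y" by simp
    qed
  qed
  moreover obtain e where e: "e > 0" "ball b e \<subseteq> V0" using V0 open_contains_ball by blast
  ultimately have "lreg \<kappa>' \<beta> (ball b e) g" by (blast intro: lreg_subset)
  then have "lreg \<kappa>' \<beta> (ball b (min e \<rho>)) g" by (rule lreg_subset) auto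
  moreover have "graph_rep (frontier B) b N \<kappa> \<alpha> g (min e \<rho>)"
    using graph_rep_smaller[OF g] e graph_repD(1)[OF g] by simp
  ultimately show ?thesis using graph_rep_regular by blast
qed

end

text \<open>One derivative to spare gives local Lipschitz bounds, so C^2 implies C^{1,\<alpha>} and
  C^{0,\<alpha>} locally for all \<alpha> \<le> 1; this settles the classes below the reach of the
  gradient argument.\<close>

lemma C2_imp_low_regularity:
  fixes g :: "real^'n \<Rightarrow> real"
  assumes "\<kappa> = Fin 0 \<or> \<kappa> = Fin 1" "\<alpha> \<le> 1" "open V" "lreg (Fin 2) 0 V g"
  shows "lreg \<kappa> \<alpha> V g"
proof -
  have "creg (Suc (Suc 0)) 0 V g" using assms(4) by (simp add: numeral_2_eq_2)
  then have 1: "creg (Suc 0) \<alpha> V g" by (rule creg_Suc_imp[OF assms(3,2)])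
  then have "creg 0 \<alpha> V g" by (rule creg_Suc_imp[OF assms(3,2)])
  then show ?thesis using 1 assms(1) by (auto simp del: creg.simps)
qed

theorem theorem1p1:
  fixes A B :: "(real^'n) set" and a b :: "real^'n"
    and \<kappa> :: smoothness and \<alpha> :: real
  assumes "C2_convex_body A" and "C2_convex_body B"
    and "a \<in> frontier A" and "b \<in> frontier B"
    and "a + b \<in> frontier (minkowski_sum A B)"
    and "0 \<le> \<alpha>" and "\<alpha> \<le> 1"
    and "body_reg_near A a \<kappa> \<alpha>"
    and "gauss_curvature A a \<noteq> 0"
  shows "body_reg_near (minkowski_sum A B) (a + b) (Fin 2) 0
         \<and> (gauss_curvature B b \<noteq> 0 \<longleftrightarrow> gauss_curvature (minkowski_sum A B) (a + b) \<noteq> 0)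
         \<and> (body_reg_near B b \<kappa> \<alpha> \<longleftrightarrow> body_reg_near (minkowski_sum A B) (a + b) \<kappa> \<alpha>)"
proof -
  let ?C = "minkowski_sum A B"
  have A: "convex_body A" "body_reg_near A a (Fin 2) 0" and B: "convex_body B" "body_reg_near B b (Fin 2) 0"
    using assms(1-4) by (auto simp: C2_convex_body_def)
  have C: "convex_body ?C" by (rule convex_body_minkowski_sum[OF A(1) B(1)])
  have ab: "a \<in> A" "b \<in> B" using assms(3,4) convex_body_facts(5)[OF A(1)] convex_body_facts(5)[OF B(1)] by auto
  \<comment> \<open>Starting from a normal of the sum yields a direction that supports A at a and B
    at b simultaneously; a + b being a boundary point is what relates a and b.\<close>
  obtain N where N: "norm N = 1" and sC: "supports ?C (a + b) N" using supports_exists[OF C assms(5)] .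
  have sA: "supports A a N" and sB: "supports B b N" using sC supports_minkowski_sum[OF ab] by auto
  obtain f \<delta> where f: "graph_rep (frontier A) a N (Fin 2) 0 f \<delta>"
    by (rule body_graph_rep[OF A(1) assms(3) sA N A(2)]) auto
  obtain g \<rho> where g: "graph_rep (frontier B) b N (Fin 2) 0 g \<rho>"
    by (rule body_graph_rep[OF B(1) assms(4) sB N B(2)]) auto
  \<comment> \<open>Stated for every representation of the boundary of A, since the locale is
    interpreted with three of them.\<close>
  have inj: "v = 0" if "graph_rep (frontier A) a N \<kappa>' \<beta> f' \<delta>'" "\<kappa>' \<noteq> Fin 0" "\<kappa>' \<noteq> Fin 1" "v \<bullet> N = 0" "hess f' a v = 0"
    for \<kappa>' \<beta> f' \<delta>' v
    using gauss_curvature_nonzero_iff[OF A(1) assms(3) sA N that(1-3)] assms(9) that(4,5) by blast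
  interpret C2: minkowski_local A B a b N "Fin 2" 0 f \<delta> g \<rho>
    by unfold_locales (use A B assms(3,4) sA sB N f g inj[OF f] in auto)
  obtain h \<epsilon> where h: "graph_rep (frontier ?C) (a + b) N (Fin 2) 0 h \<epsilon>"
    using C2.sum_graph_rep by blast
  have i: "body_reg_near ?C (a + b) (Fin 2) 0"
    unfolding body_reg_near_def by (rule graph_rep_imp_hypersurface[OF h N]) auto
  have iii: "body_reg_near B b \<kappa> \<alpha> \<longleftrightarrow> body_reg_near ?C (a + b) \<kappa> \<alpha>"
  proof (cases "\<kappa> = Fin 0 \<or> \<kappa> = Fin 1")
    \<comment> \<open>Both sides hold because both boundaries are C^2.\<close>
    case True
    note low = C2_imp_low_regularity[OF True assms(7)]
    have "body_reg_near B b \<kappa> \<alpha>" "body_reg_near ?C (a + b) \<kappa> \<alpha>"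
      unfolding body_reg_near_def
      by (rule graph_rep_imp_hypersurface[OF g N _ _ low] graph_rep_imp_hypersurface[OF h N _ _ low]; simp)+
    then show ?thesis by blast
  next
    case False
    then have k: "\<kappa> \<noteq> Fin 0" "\<kappa> \<noteq> Fin 1" by auto
    obtain f1 \<delta>1 where f1: "graph_rep (frontier A) a N \<kappa> \<alpha> f1 \<delta>1"
      by (rule body_graph_rep[OF A(1) assms(3) sA N assms(8) k(1) assms(7)])
    show ?thesis
    proof
      assume "body_reg_near B b \<kappa> \<alpha>"
      then obtain g1 \<rho>1 where g1: "graph_rep (frontier B) b N \<kappa> \<alpha> g1 \<rho>1"
        by (rule body_graph_rep[OF B(1) assms(4) sB N _ k(1) assms(7)])
      interpret K: minkowski_local A B a b N \<kappa> \<alpha> f1 \<delta>1 g1 \<rho>1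
        by unfold_locales (use A B assms(3,4,7) sA sB N k f1 g1 inj[OF f1] in auto)
      obtain h1 \<epsilon>1 where h1: "graph_rep (frontier ?C) (a + b) N \<kappa> \<alpha> h1 \<epsilon>1"
        using K.sum_graph_rep by blast
      show "body_reg_near ?C (a + b) \<kappa> \<alpha>"
        unfolding body_reg_near_def by (rule graph_rep_imp_hypersurface[OF h1 N k(1) assms(7)])
    next
      assume "body_reg_near ?C (a + b) \<kappa> \<alpha>"
      then obtain h1 \<epsilon>1 where h1: "graph_rep (frontier ?C) (a + b) N \<kappa> \<alpha> h1 \<epsilon>1"
        by (rule body_graph_rep[OF C assms(5) sC N _ k(1) assms(7)])
      \<comment> \<open>B is only known to be C^2 here, so the locale is interpreted in that class,
        but with the \<kappa>-regular function of A, whose extra regularity enters as a premise of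
        \<open>summand_regular\<close>.\<close>
      have f2: "graph_rep (frontier A) a N (Fin 2) 0 f1 \<delta>1"
        by (rule graph_rep_regular[OF f1 lreg_C2[OF open_ball k graph_repD(2)[OF f1]]])
      interpret K: minkowski_local A B a b N "Fin 2" 0 f1 \<delta>1 g \<rho>
        by unfold_locales (use A B assms(3,4) sA sB N f2 g inj[OF f2] in auto)
      obtain \<rho>1 where g1: "graph_rep (frontier B) b N \<kappa> \<alpha> g \<rho>1"
        using K.summand_regular[OF k assms(7) graph_repD(2)[OF f1] h1] by blast
      show "body_reg_near B b \<kappa> \<alpha>"
        unfolding body_reg_near_def by (rule graph_rep_imp_hypersurface[OF g1 N k(1) assms(7)])
    qed
  qed
  show ?thesis using i C2.sum_gauss_curvature iii by blast
qed

end
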